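(* Let $\{(\mathbf{z}^k,t_k)\}$ be generated by the inexact path-following generalized Newton scheme (PFGN) $$\left\{\begin{array}{ll}t_{k+1}&:=(1-\sigma_\beta)t_k,\\ \mathbf{z}^{k+1}&\approx\bar{\mathbf{z}}^{k+1}:=\mathcal{P}_{\mathbf{z}^k}\big(\mathbf{z}^k-\nabla^2F(\mathbf{z}^k)^{-1}\nabla F(\mathbf{z}^k);t_{k+1}\big),\end{array}\right.$$ where $\mathbf{z}^{k+1}$ is a $\delta_k$-approximation to $\bar{\mathbf{z}}^{k+1}$ (at $\mathbf{z}^k$ and $t_{k+1}$), with the update rule $$0<\sigma_\beta\le\bar\sigma_\beta:=\frac{c\sqrt\beta-\beta(1+c\sqrt\beta)}{(1+c\sqrt\beta)\sqrt\nu+c\sqrt\beta},\qquad 0\le\delta_k\le\bar\delta_t(\beta):=\frac{(1-c^2)\beta}{(1+c\sqrt\beta)^3\big[3c\sqrt\beta+c^2\beta+(1+c\sqrt\beta)^3\big]},$$ under the following configuration: (i) $c\in(0,1]$ is given, and $\beta$ is chosen such that $0<\beta<0.5(1+2c^2-\sqrt{1+4c^2})$. (ii) The initial points $\mathbf{z}^0$ and $t_0>0$ are chosen such that $\mathbf{z}^0\in\mathrm{int}(\mathcal{Z})$ and $\lambda_{t_0}(\mathbf{z}^0)\le\beta$. Then, the following conclusions hold: (a) $\lambda_{t_k}(\mathbf{z}^k)\le\beta$ for all $k\ge0$. (b) The number of iterations $k$ to achieve an $\varepsilon$-solution $\mathbf{z}^k$ of $0\in\mathcal{A}(\mathbf{z})+\mathcal{N}_{\mathcal{Z}}(\mathbf{z})$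 does not exceed $$k_{\max}:=\left\lfloor\left(\frac{(1+c\sqrt\beta)\sqrt\nu+c\sqrt\beta}{c\sqrt\beta-\beta(1+c\sqrt\beta)}\right)\ln\left(\frac{M_0t_0}{\varepsilon}\right)\right\rfloor+1,$$ where $M_0:=\left(1-\frac{c\sqrt\beta}{1+c\sqrt\beta}-\bar\delta_t(\beta)\right)^{-1}\left(\sqrt\nu+\frac{c\sqrt\beta}{1+c\sqrt\beta}+2\bar\delta_t(\beta)\right)=\mathcal{O}(\sqrt\nu)$. (c) Consequently, the worst-case iteration-complexity of (PFGN) is $\mathcal{O}\left(\sqrt\nu\ln\Big(\frac{\sqrt\nu\,t_0}{\varepsilon}\Big)\right)$.
   Context: Setting. $\mathcal{Z}\subseteq\mathbb{R}^p$ is nonempty, closed, convex and equipped with a $\nu$-self-concordant barrier $F$; $\mathcal{A}:\mathbb{R}^p\rightrightarrows2^{\mathbb{R}^p}$ is maximally monotone, $\mathrm{int}(\mathcal{Z})\cap\mathrm{dom}(\mathcal{A})\ne\emptyset$, $\mathrm{dom}(\mathcal{A})$ is open or closed; the solution set of $0\in\mathcal{A}(\mathbf{z})+\mathcal{N}_{\mathcal{Z}}(\mathbf{z})$ is nonempty, where $\mathcal{N}_{\mathcal{Z}}(\mathbf{z})=\{\mathbf{w}\mid\langle\mathbf{w},\mathbf{z}-\hat{\mathbf{z}}\rangle\ge0\ \forall\hat{\mathbf{z}}\in\mathcal{Z}\}$ for $\mathbf{z}\in\mathcal{Z}$ (and $\emptyset$ otherwise) is the normal cone. It is also assumed throughout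 that for any nonzero $\boldsymbol\omega$ in the horizon cone of $\mathrm{int}(\mathcal{Z})\cap\mathrm{dom}(\mathcal{A})$ there are $\hat{\mathbf{z}}\in\mathrm{int}(\mathcal{Z})\cap\mathrm{dom}(\mathcal{A})$ and $\hat{\mathbf{a}}\in\mathcal{A}(\hat{\mathbf{z}})$ with $\langle\hat{\mathbf{a}},\boldsymbol\omega\rangle>0$, where the horizon cone of a convex set $C$ is the set of $\boldsymbol\omega$ with $\mathbf{z}+\tau\boldsymbol\omega\in\mathrm{cl}(C)$ for all $\mathbf{z}\in C$, $\tau>0$. Self-concordance. $F$ is standard self-concordant if each restriction $\varphi(\tau)=F(\mathbf{z}+\tau\mathbf{v})$ is $\mathcal{C}^3$, convex and satisfies $|\varphi'''|\le2(\varphi'')^{3/2}$; it is a $\nu$-self-concordant barrier for $\mathcal{Z}$ ($\nu>0$) if in addition $\mathrm{dom}(F)=\mathrm{int}(\mathcal{Z})$, $\sup_{\mathbf{u}}\{2\langle\nabla F(\mathbf{z}),\mathbf{u}\rangle-\|\mathbf{u}\|_{\mathbf{z}}^2\}\le\nu$ for all $\mathbf{z}\in\mathrm{int}(\mathcal{Z})$, and $F(\mathbf{z})\to+\infty$ as $\mathbf{z}$ approaches the boundary of $\mathcal{Z}$. $\nabla^2F(\mathbf{z})\succ0$ on $\mathrm{int}(\mathcal{Z})$. Local norms: $\|\mathbf{u}\|_{\mathbf{z}}=\langle\nabla^2F(\mathbf{z})\mathbf{u},\mathbf{u}\rangle^{1/2}$, $\|\mathbf{v}\|^*_{\mathbf{z}}=\langle\nabla^2F(\mathbf{z})^{-1}\mathbf{v},\mathbf{v}\rangle^{1/2}$.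 $\mathrm{dist}_{\mathbf{z}}(\boldsymbol{0},S)=\min\{\|\mathbf{e}\|^*_{\mathbf{z}}\mid\mathbf{e}\in S\}$. Scaled resolvent: $\mathcal{P}_{\hat{\mathbf{z}}}(\cdot;t):=(\mathbb{I}+t^{-1}\nabla^2F(\hat{\mathbf{z}})^{-1}\mathcal{A})^{-1}(\cdot)$ for $\hat{\mathbf{z}}\in\mathrm{int}(\mathcal{Z})$, $t>0$ (single-valued, defined on $\mathbb{R}^p$). Generalized Newton decrement: $\lambda_t(\mathbf{z}):=\|\mathbf{z}-\mathcal{P}_{\mathbf{z}}(\mathbf{z}-\nabla^2F(\mathbf{z})^{-1}\nabla F(\mathbf{z});t)\|_{\mathbf{z}}$. Inexactness: for $\delta\in[0,1)$, $\mathbf{z}_+$ is a $\delta$-approximation (at $\mathbf{z}$ and $t$) to $\bar{\mathbf{z}}_+:=\mathcal{P}_{\mathbf{z}}(\mathbf{z}-\nabla^2F(\mathbf{z})^{-1}\nabla F(\mathbf{z});t)$, written $\mathbf{z}_+\approx\bar{\mathbf{z}}_+$, if $\mathrm{dist}_{\mathbf{z}}\big(\boldsymbol{0},\,t[\nabla F(\mathbf{z})+\nabla^2F(\mathbf{z})(\mathbf{z}_+-\mathbf{z})]+\mathcal{A}(\mathbf{z}_+)\big)\le t\delta$. A point $\tilde{\mathbf{z}}\in\mathrm{int}(\mathcal{Z})$ is an $\varepsilon$-solution of $0\in\mathcal{A}(\mathbf{z})+\mathcal{N}_{\mathcal{Z}}(\mathbf{z})$ if $\mathrm{dist}_{\tilde{\mathbf{z}}}(\boldsymbol{0},\mathcal{A}(\tilde{\mathbf{z}}))\le\varepsilon$.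 The desired accuracy $\varepsilon>0$ is given.
   Formalization: In (b) the bound k_max is proved for σ_β = σ̄_β and read as max(1, k_max); for smaller σ_β, where it can fail, the factor 1/σ̄_β is replaced by 1/σ_β. In (c), σ_β = σ̄_β, with constants depending on c, β once √ν t_0/ε exceeds a threshold. *)

theory Defs
  imports "HOL-Analysis.Analysis" "HOL-Library.Landau_Symbols"
begin

section \<open>Monotone operators and convex sets\<close>

definition dom_op :: "('a \<Rightarrow> 'a set) \<Rightarrow> 'a set" where
  "dom_op A = {x. A x \<noteq> {}}"

definition monotone_op :: "('a::real_inner \<Rightarrow> 'a set) \<Rightarrow> bool" where
  "monotone_op A \<longleftrightarrow>
     (\<forall>x y. \<forall>u\<in>A x. \<forall>v\<in>A y. 0 \<le> (u - v) \<bullet> (x - y))"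

definition maximally_monotone :: "('a::real_inner \<Rightarrow> 'a set) \<Rightarrow> bool" where
  "maximally_monotone A \<longleftrightarrow>
     monotone_op A \<and> (\<forall>B. monotone_op B \<and> (\<forall>x. A x \<subseteq> B x) \<longrightarrow> B = A)"

definition normal_cone :: "'a::real_inner set \<Rightarrow> 'a \<Rightarrow> 'a set" where
  "normal_cone Z z = (if z \<in> Z then {w. \<forall>y\<in>Z. 0 \<le> w \<bullet> (z - y)} else {})"

definition solution_set :: "'a::real_inner set \<Rightarrow> ('a \<Rightarrow> 'a set) \<Rightarrow> 'a set" where
  "solution_set Z A = {z. \<exists>a\<in>A z. \<exists>w\<in>normal_cone Z z. a + w = 0}"

definition horizon_cone :: "'a::real_normed_vector set \<Rightarrow> 'a set" where
  "horizon_cone C = {\<omega>. \<forall>z\<in>C. \<forall>\<tau>>0. z + \<tau> *\<^sub>R \<omega> \<in> closure C}"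


section \<open>Self-concordant barriers\<close>

text \<open>
  The barrier is a total function whose values outside the interior of the set are irrelevant;
  its effective domain is encoded by restricting every condition to that interior.
\<close>

definition gradient :: "('a::euclidean_space \<Rightarrow> real) \<Rightarrow> 'a \<Rightarrow> 'a" where
  "gradient F z = (THE g. GDERIV F z :> g)"

definition hessian :: "('a::euclidean_space \<Rightarrow> real) \<Rightarrow> 'a \<Rightarrow> 'a \<Rightarrow> 'a" where
  "hessian F z = frechet_derivative (gradient F) (at z)"

definition hessian_inv :: "('a::euclidean_space \<Rightarrow> real) \<Rightarrow> 'a \<Rightarrow> 'a \<Rightarrow> 'a" where
  "hessian_inv F z = inv (hessian F z)"

definition twice_continuously_differentiable_on ::
    "('a::euclidean_space \<Rightarrow> real) \<Rightarrow> 'a set \<Rightarrow> bool" where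
  "twice_continuously_differentiable_on F D \<longleftrightarrow>
     (\<forall>z\<in>D. F differentiable (at z)) \<and>
     (\<forall>z\<in>D. gradient F differentiable (at z)) \<and>
     (\<forall>u. continuous_on D (\<lambda>z. hessian F z u))"

definition standard_self_concordant_on ::
    "('a::euclidean_space \<Rightarrow> real) \<Rightarrow> 'a set \<Rightarrow> bool" where
  "standard_self_concordant_on F D \<longleftrightarrow>
     (\<forall>z\<in>D. \<forall>v.
        let \<phi> = (\<lambda>\<tau>::real. F (z + \<tau> *\<^sub>R v)); I = {\<tau>. z + \<tau> *\<^sub>R v \<in> D} in
          convex_on I \<phi> \<and>
          (\<exists>\<phi>1 \<phi>2 \<phi>3.
             (\<forall>\<tau>\<in>I. (\<phi> has_real_derivative \<phi>1 \<tau>) (at \<tau>)) \<and>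
             (\<forall>\<tau>\<in>I. (\<phi>1 has_real_derivative \<phi>2 \<tau>) (at \<tau>)) \<and>
             (\<forall>\<tau>\<in>I. (\<phi>2 has_real_derivative \<phi>3 \<tau>) (at \<tau>)) \<and>
             continuous_on I \<phi>3 \<and>
             (\<forall>\<tau>\<in>I. \<bar>\<phi>3 \<tau>\<bar> \<le> 2 * \<phi>2 \<tau> powr (3 / 2))))"

definition local_norm :: "('a::euclidean_space \<Rightarrow> real) \<Rightarrow> 'a \<Rightarrow> 'a \<Rightarrow> real" where
  "local_norm F z u = sqrt (hessian F z u \<bullet> u)"

definition dual_local_norm :: "('a::euclidean_space \<Rightarrow> real) \<Rightarrow> 'a \<Rightarrow> 'a \<Rightarrow> real" where
  "dual_local_norm F z v = sqrt (hessian_inv F z v \<bullet> v)"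

text \<open>
  The requirement of joint twice continuous differentiability is what gives the gradient and
  the Hessian a meaning; smoothness of order three is only required along lines.
\<close>

definition self_concordant_barrier ::
    "('a::euclidean_space \<Rightarrow> real) \<Rightarrow> real \<Rightarrow> 'a set \<Rightarrow> bool" where
  "self_concordant_barrier F \<nu> Z \<longleftrightarrow>
     0 < \<nu> \<and>
     twice_continuously_differentiable_on F (interior Z) \<and>
     standard_self_concordant_on F (interior Z) \<and>
     (\<forall>z\<in>interior Z. \<forall>u. 2 * (gradient F z \<bullet> u) - (local_norm F z u)\<^sup>2 \<le> \<nu>) \<and>
     (\<forall>x\<in>frontier Z. filterlim F at_top (at x within interior Z))"

text \<open>Valued in the extended reals, so that the distance to the empty set is \<open>\<infinity>\<close>.\<close>

definition local_dist :: "('a::euclidean_space \<Rightarrow> real) \<Rightarrow> 'a \<Rightarrow> 'a set \<Rightarrow> ereal" where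
  "local_dist F z S = (INF e\<in>S. ereal (dual_local_norm F z e))"


section \<open>Self-concordant inclusions\<close>

locale self_concordant_inclusion =
  fixes Z :: "'a::euclidean_space set"
    and F :: "'a \<Rightarrow> real"
    and \<nu> :: real
    and A :: "'a \<Rightarrow> 'a set"
  assumes Z_nonempty: "Z \<noteq> {}"
    and Z_closed: "closed Z"
    and Z_convex: "convex Z"
    and barrier: "self_concordant_barrier F \<nu> Z"
    and hessian_pos_def: "\<And>z u. z \<in> interior Z \<Longrightarrow> u \<noteq> 0 \<Longrightarrow> 0 < hessian F z u \<bullet> u"
    and A_maximal: "maximally_monotone A"
    and interior_dom_nonempty: "interior Z \<inter> dom_op A \<noteq> {}"
    and dom_open_or_closed: "open (dom_op A) \<or> closed (dom_op A)"
    and solution_exists: "solution_set Z A \<noteq> {}"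
    and horizon_condition:
      "\<And>\<omega>. \<omega> \<in> horizon_cone (interior Z \<inter> dom_op A) \<Longrightarrow> \<omega> \<noteq> 0 \<Longrightarrow>
         \<exists>z\<in>interior Z \<inter> dom_op A. \<exists>a\<in>A z. 0 < a \<bullet> \<omega>"

definition scaled_resolvent ::
    "('a::euclidean_space \<Rightarrow> real) \<Rightarrow> ('a \<Rightarrow> 'a set) \<Rightarrow> 'a \<Rightarrow> real \<Rightarrow> 'a \<Rightarrow> 'a" where
  "scaled_resolvent F A zh t w =
     (THE x. w \<in> {x + (1 / t) *\<^sub>R hessian_inv F zh a | a. a \<in> A x})"

definition newton_point ::
    "('a::euclidean_space \<Rightarrow> real) \<Rightarrow> ('a \<Rightarrow> 'a set) \<Rightarrow> real \<Rightarrow> 'a \<Rightarrow> 'a" where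
  "newton_point F A t z = scaled_resolvent F A z t (z - hessian_inv F z (gradient F z))"

definition newton_decrement ::
    "('a::euclidean_space \<Rightarrow> real) \<Rightarrow> ('a \<Rightarrow> 'a set) \<Rightarrow> real \<Rightarrow> 'a \<Rightarrow> real" where
  "newton_decrement F A t z = local_norm F z (z - newton_point F A t z)"

text \<open>
  \<open>approx_newton_point F A t \<delta> z zp\<close>: \<open>zp\<close> is a \<open>\<delta>\<close>-approximation to \<open>newton_point F A t z\<close>.
\<close>

definition approx_newton_point ::
    "('a::euclidean_space \<Rightarrow> real) \<Rightarrow> ('a \<Rightarrow> 'a set) \<Rightarrow> real \<Rightarrow> real \<Rightarrow> 'a \<Rightarrow> 'a \<Rightarrow> bool" where
  "approx_newton_point F A t \<delta> z zp \<longleftrightarrow>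
     local_dist F z
       {t *\<^sub>R (gradient F z + hessian F z (zp - z)) + a | a. a \<in> A zp} \<le> ereal (t * \<delta>)"

definition eps_solution ::
    "'a::euclidean_space set \<Rightarrow> ('a \<Rightarrow> real) \<Rightarrow> ('a \<Rightarrow> 'a set) \<Rightarrow> real \<Rightarrow> 'a \<Rightarrow> bool" where
  "eps_solution Z F A \<epsilon> z \<longleftrightarrow> z \<in> interior Z \<and> local_dist F z (A z) \<le> ereal \<epsilon>"


section \<open>The inexact path-following generalized Newton scheme\<close>

definition sigma_bar :: "real \<Rightarrow> real \<Rightarrow> real \<Rightarrow> real" where
  "sigma_bar c \<beta> \<nu> =
     (c * sqrt \<beta> - \<beta> * (1 + c * sqrt \<beta>)) / ((1 + c * sqrt \<beta>) * sqrt \<nu> + c * sqrt \<beta>)"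

definition delta_bar :: "real \<Rightarrow> real \<Rightarrow> real" where
  "delta_bar c \<beta> =
     (1 - c\<^sup>2) * \<beta> /
     ((1 + c * sqrt \<beta>) ^ 3 * (3 * c * sqrt \<beta> + c\<^sup>2 * \<beta> + (1 + c * sqrt \<beta>) ^ 3))"

definition M0 :: "real \<Rightarrow> real \<Rightarrow> real \<Rightarrow> real" where
  "M0 c \<beta> \<nu> =
     inverse (1 - c * sqrt \<beta> / (1 + c * sqrt \<beta>) - delta_bar c \<beta>) *
     (sqrt \<nu> + c * sqrt \<beta> / (1 + c * sqrt \<beta>) + 2 * delta_bar c \<beta>)"

definition k_max :: "real \<Rightarrow> real \<Rightarrow> real \<Rightarrow> real \<Rightarrow> real \<Rightarrow> int" where
  "k_max c \<beta> \<nu> t0 \<epsilon> =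
     \<lfloor>((1 + c * sqrt \<beta>) * sqrt \<nu> + c * sqrt \<beta>) / (c * sqrt \<beta> - \<beta> * (1 + c * sqrt \<beta>)) *
        ln (M0 c \<beta> \<nu> * t0 / \<epsilon>)\<rfloor> + 1"

definition pfgn_sequence ::
    "'a::euclidean_space set \<Rightarrow> ('a \<Rightarrow> real) \<Rightarrow> real \<Rightarrow> ('a \<Rightarrow> 'a set) \<Rightarrow> real \<Rightarrow> real \<Rightarrow>
     real \<Rightarrow> (nat \<Rightarrow> real) \<Rightarrow> (nat \<Rightarrow> 'a) \<Rightarrow> (nat \<Rightarrow> real) \<Rightarrow> bool" where
  "pfgn_sequence Z F \<nu> A c \<beta> \<sigma> \<delta> z t \<longleftrightarrow>
     0 < \<sigma> \<and> \<sigma> \<le> sigma_bar c \<beta> \<nu> \<and>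
     (\<forall>k. 0 \<le> \<delta> k \<and> \<delta> k \<le> delta_bar c \<beta>) \<and>
     z 0 \<in> interior Z \<and> 0 < t 0 \<and> newton_decrement F A (t 0) (z 0) \<le> \<beta> \<and>
     (\<forall>k. t (Suc k) = (1 - \<sigma>) * t k) \<and>
     (\<forall>k. approx_newton_point F A (t (Suc k)) (\<delta> k) (z k) (z (Suc k)))"

end

theory Submission
  imports Defs
begin

text \<open>
  Let \<open>\<kappa> = c\<surd>\<beta> / (1 + c\<surd>\<beta>)\<close>.  One iteration changes the decrement in two moves.  Shrinking the parameter \<open>t\<close> by
  \<open>1 - \<sigma>\<close> moves the Newton point at the same \<open>z\<close> by at most \<open>\<sigma>/(1 - \<sigma>) (\<surd>\<nu> + \<beta>)\<close> in the local norm, because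
  \<open>A\<close> is monotone and the dual local norm of \<open>\<nabla>F\<close> is at most \<open>\<surd>\<nu>\<close>; the largest admissible \<open>\<sigma>\<close> is the one for
  which this bound takes the decrement from \<open>\<beta>\<close> to exactly \<open>\<kappa>\<close> (\<open>newton_decrement_parameter_update\<close>).  The inexact Newton
  step then has local length \<open>r \<le> \<kappa> + \<delta>\<close>, stays inside the Dikin ellipsoid, and brings the decrement down to
  \<open>(r / (1 - r))^2 + \<delta> / (1 - r)\<close> (\<open>newton_decrement_after_step\<close>), which is at most \<open>\<beta>\<close> by the choice of the
  error tolerance (\<open>inexact_step_bound\<close>).  The same step exhibits an element of \<open>A (z (Suc k))\<close> whose dual
  norm is at most \<open>M0 t (Suc k)\<close>.  Since \<open>t k = (1 - \<sigma>)^k t 0\<close>, this drops below \<open>\<epsilon>\<close> after about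
  \<open>ln (M0 t 0 / \<epsilon>) / \<sigma>\<close> steps.

  Two ingredients carry the analysis.  The first is Minty's theorem: the Newton point exists because the
  resolvent of a maximally monotone operator in the metric of a positive definite operator is defined
  everywhere.  Each pair of the graph confines the sought point to a ball, and monotonicity gives these
  balls the finite intersection property.

  The second is the Hessian comparison
  \<open>(1 - r)^2 \<nabla>^2 F(z) \<le> \<nabla>^2 F(z + d) \<le> (1 - r)^-2 \<nabla>^2 F(z)\<close> for \<open>r = \<parallel>d\<parallel>\<^sub>z < 1\<close>.  The usual proof bounds the mixed
  third derivative \<open>D^3 F[d,h,h]\<close> by the pure ones.  Here \<open>F\<close> is only twice differentiable jointly and three
  times along lines, and the third derivatives along lines need not come from a trilinear form.
  Averaging \<open>F\<close> over a rectangle spanned by \<open>d\<close> and \<open>h\<close> removes the obstacle: third derivatives of the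
  average along \<open>v = \<alpha> d + \<beta> h\<close> form a genuine cubic in \<open>(\<alpha>, \<beta>)\<close>, its mixed coefficient is a second difference
  of \<open>\<nabla>F\<close>, and the sharp bound of that coefficient by the values of the cubic on the unit circle is an
  explicit trigonometric identity (\<open>mixed_cubic_bound\<close>).

  The complexity statement for all barriers at once finally uses \<open>\<nu> \<ge> 1\<close>, which holds because a barrier
  with positive definite Hessian lives on a proper subset of the space and blows up at its boundary.
\<close>

section \<open>Positive definite operators and their norms\<close>

locale positive_operator =
  fixes K :: "'a::euclidean_space \<Rightarrow> 'a"
  assumes lin: "linear K"
    and sym: "\<And>u v. K u \<bullet> v = K v \<bullet> u"
    and pos: "\<And>u. u \<noteq> 0 \<Longrightarrow> 0 < K u \<bullet> u"
begin

definition nrm :: "'a \<Rightarrow> real" where "nrm u = sqrt (K u \<bullet> u)"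
definition dnrm :: "'a \<Rightarrow> real" where "dnrm v = sqrt (inv K v \<bullet> v)"

lemmas K_simps = linear_add[OF lin] linear_diff[OF lin] linear_cmul[OF lin] linear_neg[OF lin] linear_0[OF lin]

lemma nonneg: "0 \<le> K u \<bullet> u"
  using pos[of u] by (cases "u = 0") auto

lemma nrm_nonneg: "0 \<le> nrm u" by (simp add: nrm_def nonneg)

lemma nrm_sq: "(nrm u)\<^sup>2 = K u \<bullet> u" by (simp add: nrm_def nonneg)

lemma nrm_pos: "u \<noteq> 0 \<Longrightarrow> 0 < nrm u" by (simp add: nrm_def pos)

lemma K_bij: "bij K"
proof -
  have "inj K"
    unfolding linear_injective_0[OF lin] using pos by force
  then show ?thesis using lin linear_injective_imp_surjective by (auto simp: bij_def)
qed

lemma K_inv: "K (inv K v) = v"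
  using K_bij by (simp add: bij_is_surj surj_f_inv_f)

lemma inv_K: "inv K (K u) = u"
  using K_bij by (simp add: bij_is_inj)

lemma inv_eqI: "K u = v \<Longrightarrow> inv K v = u" using inv_K by blast

lemma inv_add: "inv K (u + v) = inv K u + inv K v"
  by (rule inv_eqI) (simp add: K_simps K_inv)

lemma inv_cmul: "inv K (c *\<^sub>R u) = c *\<^sub>R inv K u"
  by (rule inv_eqI) (simp add: K_simps K_inv)

lemma K_continuous: "continuous_on S K"
  by (rule linear_continuous_on) (use lin linear_conv_bounded_linear in blast)

lemma dnrm_eq_nrm: "dnrm v = nrm (inv K v)"
  by (simp add: dnrm_def nrm_def K_inv inner_commute)

lemma dnrm_K: "dnrm (K u) = nrm u" by (simp add: dnrm_eq_nrm inv_K)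

lemma dnrm_nonneg: "0 \<le> dnrm v" by (simp add: dnrm_eq_nrm nrm_nonneg)

lemma Cauchy_Schwarz: "\<bar>K u \<bullet> v\<bar> \<le> nrm u * nrm v"
proof (cases "v = 0")
  case False
  have v: "0 < K v \<bullet> v" using pos False .
  have "0 \<le> K (u - ((K u \<bullet> v) / (K v \<bullet> v)) *\<^sub>R v) \<bullet> (u - ((K u \<bullet> v) / (K v \<bullet> v)) *\<^sub>R v)"
    by (rule nonneg)
  also have "\<dots> = K u \<bullet> u - (K u \<bullet> v)\<^sup>2 / (K v \<bullet> v)"
    using v sym[of v u] by (simp add: K_simps inner_diff algebra_simps power2_eq_square field_simps)
  finally have "(K u \<bullet> v)\<^sup>2 \<le> (K u \<bullet> u) * (K v \<bullet> v)" using v by (simp add: field_simps)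
  then have "sqrt ((K u \<bullet> v)\<^sup>2) \<le> sqrt ((K u \<bullet> u) * (K v \<bullet> v))" by (rule real_sqrt_le_mono)
  then show ?thesis by (simp add: nrm_def real_sqrt_mult)
qed (simp add: nrm_def)

lemma nrm_triangle: "nrm (u + v) \<le> nrm u + nrm v"
proof (rule power2_le_imp_le)
  have "(nrm (u + v))\<^sup>2 = (nrm u)\<^sup>2 + 2 * (K u \<bullet> v) + (nrm v)\<^sup>2"
    using sym[of v u] by (simp add: nrm_sq K_simps inner_add)
  also have "\<dots> \<le> (nrm u + nrm v)\<^sup>2"
    using Cauchy_Schwarz[of u v] by (simp add: power2_sum abs_le_iff)
  finally show "(nrm (u + v))\<^sup>2 \<le> (nrm u + nrm v)\<^sup>2" .
qed (simp add: nrm_nonneg)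

lemma nrm_scale: "nrm (c *\<^sub>R u) = \<bar>c\<bar> * nrm u"
  by (simp add: nrm_def K_simps real_sqrt_mult mult.assoc[symmetric] flip: power2_eq_square)

lemma nrm_minus: "nrm (- u) = nrm u" using nrm_scale[of "-1" u] by simp

lemma nrm_minus_commute: "nrm (u - v) = nrm (v - u)" using nrm_minus[of "u - v"] by simp

lemma dnrm_triangle: "dnrm (u + v) \<le> dnrm u + dnrm v"
  by (simp add: dnrm_eq_nrm inv_add nrm_triangle)

lemma dnrm_scale: "dnrm (c *\<^sub>R u) = \<bar>c\<bar> * dnrm u"
  by (simp add: dnrm_eq_nrm inv_cmul nrm_scale)

lemma dnrm_minus: "dnrm (- u) = dnrm u" using dnrm_scale[of "-1" u] by simp

lemma dual_pairing: "\<bar>v \<bullet> u\<bar> \<le> dnrm v * nrm u"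
  using Cauchy_Schwarz[of "inv K v" u] by (simp add: K_inv dnrm_eq_nrm)

text \<open>
  Testing the inequality at \<open>u = inv K v\<close> suffices, since there the pairing equals the square of the
  dual norm.
\<close>

lemma dnrm_le:
  assumes "\<And>u. v \<bullet> u \<le> c * nrm u" shows "dnrm v \<le> c"
proof (cases "v = 0")
  case True
  have "0 \<le> c * nrm (SOME i. i \<in> Basis)" using assms[of "SOME i. i \<in> Basis"] True by simp
  moreover have "0 < nrm (SOME i. i \<in> Basis)" by (rule nrm_pos) (simp add: nonzero_Basis some_in_eq)
  ultimately have "0 \<le> c" by (simp add: zero_le_mult_iff)
  then show ?thesis using True dnrm_scale[of 0 v] by simp
next
  case False
  have "0 < dnrm v" unfolding dnrm_eq_nrm
    by (rule nrm_pos) (metis False K_inv linear_0[OF lin])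
  moreover have "dnrm v * dnrm v \<le> c * dnrm v"
  proof -
    have "dnrm v * dnrm v = v \<bullet> inv K v"
      using nrm_sq[of "inv K v"] by (simp add: dnrm_eq_nrm K_inv power2_eq_square)
    then show ?thesis using assms[of "inv K v"] by (simp add: dnrm_eq_nrm)
  qed
  ultimately show ?thesis by simp
qed

lemma coercive: "\<exists>\<mu>>0. \<forall>u. \<mu> * (norm u)\<^sup>2 \<le> K u \<bullet> u"
proof -
  have "continuous_on (sphere 0 1) (\<lambda>u. K u \<bullet> u)" by (intro continuous_intros K_continuous)
  moreover have "sphere (0::'a) 1 \<noteq> {}" by simp
  ultimately obtain m where m: "norm m = 1" "\<And>u. norm u = 1 \<Longrightarrow> K m \<bullet> m \<le> K u \<bullet> u"
    using continuous_attains_inf[of "sphere (0::'a) 1" "\<lambda>u. K u \<bullet> u"] by auto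
  have "(K m \<bullet> m) * (norm u)\<^sup>2 \<le> K u \<bullet> u" for u
  proof (cases "u = 0")
    case False
    have "K m \<bullet> m \<le> K ((1 / norm u) *\<^sub>R u) \<bullet> ((1 / norm u) *\<^sub>R u)" by (rule m(2)) (use False in simp)
    also have "\<dots> = (K u \<bullet> u) / (norm u)\<^sup>2" by (simp add: K_simps power2_eq_square)
    finally show ?thesis using False by (simp add: field_simps)
  qed (simp add: K_simps)
  moreover have "0 < K m \<bullet> m" using m by (intro pos) auto
  ultimately show ?thesis by blast
qed

text \<open>
  Polarization, with \<open>u\<close> and \<open>v\<close> first scaled to unit length so that no constant is lost.
\<close>

lemma bilinear_form_bound:
  assumes M: "linear M" and Msym: "\<And>u v. M u \<bullet> v = M v \<bullet> u"
    and bd: "\<And>v. \<bar>M v \<bullet> v\<bar> \<le> c * (nrm v)\<^sup>2"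
  shows "\<bar>M u \<bullet> v\<bar> \<le> c * nrm u * nrm v"
proof -
  have pol: "\<bar>M u \<bullet> v\<bar> \<le> c * ((nrm u)\<^sup>2 + (nrm v)\<^sup>2) / 2" for u v
  proof -
    have "4 * (M u \<bullet> v) = M (u + v) \<bullet> (u + v) - M (u - v) \<bullet> (u - v)"
      using Msym[of v u] by (simp add: linear_add[OF M] linear_diff[OF M] inner_add inner_diff)
    then have "4 * \<bar>M u \<bullet> v\<bar> \<le> \<bar>M (u + v) \<bullet> (u + v)\<bar> + \<bar>M (u - v) \<bullet> (u - v)\<bar>" by linarith
    also have "\<dots> \<le> c * (nrm (u + v))\<^sup>2 + c * (nrm (u - v))\<^sup>2" by (intro add_mono bd)
    also have "\<dots> = 2 * (c * ((nrm u)\<^sup>2 + (nrm v)\<^sup>2))"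
      using sym[of v u] by (simp add: nrm_sq K_simps inner_add inner_diff algebra_simps)
    finally show ?thesis by simp
  qed
  show ?thesis
  proof (cases "u = 0 \<or> v = 0")
    case True
    then show ?thesis by (auto simp: linear_0[OF M] nrm_def)
  next
    case False
    then have n: "0 < nrm u" "0 < nrm v" by (auto intro: nrm_pos)
    have "\<bar>M ((1 / nrm u) *\<^sub>R u) \<bullet> ((1 / nrm v) *\<^sub>R v)\<bar> \<le> c"
      using pol[of "(1 / nrm u) *\<^sub>R u" "(1 / nrm v) *\<^sub>R v"] n by (simp add: nrm_scale)
    then have "\<bar>(M u \<bullet> v) / (nrm u * nrm v)\<bar> \<le> c"
      by (simp add: linear_cmul[OF M] mult.commute)
    then show ?thesis using n by (simp add: abs_divide abs_mult field_simps)
  qed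
qed

text \<open>
  Sublevel sets of the dual norm are compact, so an infimum of dual norms over a closed set is a minimum.
  This turns a bound on a local distance into a bound for one element.
\<close>

lemma inf_dual_norm_attained:
  assumes S: "closed S" and le: "(INF e\<in>S. ereal (dnrm e)) \<le> ereal c"
  shows "\<exists>e\<in>S. dnrm e \<le> c"
proof -
  obtain \<mu> where \<mu>: "\<mu> > 0" "\<And>u. \<mu> * (norm u)\<^sup>2 \<le> K u \<bullet> u" using coercive by blast
  have nrm_cont: "continuous_on T nrm" for T
    unfolding nrm_def by (intro continuous_intros K_continuous)
  define B where "B = {u. nrm u \<le> c + 1}"
  have "closed B" unfolding B_def by (intro closed_Collect_le continuous_intros nrm_cont)
  moreover have "bounded B"
  proof -
    have "norm u \<le> sqrt ((c + 1)\<^sup>2 / \<mu>)" if "u \<in> B" for u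
    proof -
      have "\<mu> * (norm u)\<^sup>2 \<le> (nrm u)\<^sup>2" using \<mu>(2)[of u] by (simp add: nrm_sq)
      also have "\<dots> \<le> (c + 1)\<^sup>2" using that nrm_nonneg[of u] by (intro power_mono) (auto simp: B_def)
      finally show ?thesis using \<mu>(1) by (intro real_le_rsqrt) (simp add: field_simps)
    qed
    then show ?thesis unfolding bounded_iff by blast
  qed
  ultimately have B: "compact B" by (simp add: compact_eq_bounded_closed)
  have "closed (K -` S)" by (rule closed_vimage[OF S K_continuous])
  then have "compact (B \<inter> K -` S)" by (rule compact_Int_closed[OF B])
  moreover have "B \<inter> K -` S \<noteq> {}"
  proof -
    have "(INF e\<in>S. ereal (dnrm e)) < ereal (c + 1)" using le by (rule le_less_trans) simp
    then obtain e where e: "e \<in> S" "dnrm e < c + 1" by (auto simp: INF_less_iff)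
    then have "inv K e \<in> B \<inter> K -` S" by (simp add: B_def K_inv dnrm_eq_nrm)
    then show ?thesis by blast
  qed
  ultimately have "\<exists>u\<in>B \<inter> K -` S. \<forall>y\<in>B \<inter> K -` S. nrm u \<le> nrm y"
    by (rule continuous_attains_inf[OF _ _ nrm_cont])
  then obtain u where u: "u \<in> B \<inter> K -` S" "\<And>y. y \<in> B \<inter> K -` S \<Longrightarrow> nrm u \<le> nrm y"
    by blast
  have "ereal (nrm u) \<le> (INF e\<in>S. ereal (dnrm e))"
  proof (rule INF_greatest)
    fix e assume e: "e \<in> S"
    have "nrm u \<le> dnrm e"
    proof (cases "inv K e \<in> B")
      case True
      then show ?thesis using u(2)[of "inv K e"] e by (simp add: K_inv dnrm_eq_nrm)
    next
      case False
      then show ?thesis using u(1) by (simp add: B_def dnrm_eq_nrm)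
    qed
    then show "ereal (nrm u) \<le> ereal (dnrm e)" by simp
  qed
  then have "nrm u \<le> c" using le by (metis ereal_less_eq(3) order_trans)
  then show ?thesis using u(1) by (intro bexI[of _ "K u"]) (auto simp: dnrm_K)
qed

end

section \<open>Resolvents of maximally monotone operators\<close>

text \<open>
  Adding the pair \<open>(x, a)\<close> to the graph keeps it monotone, so maximality puts it there already.
\<close>

lemma maximally_monotone_memI:
  fixes A :: "'b::real_inner \<Rightarrow> 'b set"
  assumes "maximally_monotone A" and a: "\<And>y v. v \<in> A y \<Longrightarrow> 0 \<le> (v - a) \<bullet> (y - x)"
  shows "a \<in> A x"
proof -
  define B where "B y = (if y = x then insert a (A x) else A y)" for y
  have mono: "\<And>x y u v. u \<in> A x \<Longrightarrow> v \<in> A y \<Longrightarrow> 0 \<le> (u - v) \<bullet> (x - y)"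
    using assms(1) unfolding maximally_monotone_def monotone_op_def by blast
  have a': "0 \<le> (a - v) \<bullet> (x - y)" if "v \<in> A y" for y v
    using a[OF that] by (simp add: inner_diff algebra_simps)
  have "monotone_op B"
    unfolding monotone_op_def B_def by (auto simp: mono a a')
  moreover have "A y \<subseteq> B y" for y by (auto simp: B_def)
  ultimately have "B = A" using assms(1) unfolding maximally_monotone_def by blast
  then show ?thesis by (metis B_def insertI1)
qed

lemma maximally_monotone_closed_values:
  fixes A :: "'b::real_inner \<Rightarrow> 'b set"
  assumes A: "maximally_monotone A" shows "closed (A x)"
proof -
  have "A x = (\<Inter>y. \<Inter>v\<in>A y. {a. 0 \<le> (v - a) \<bullet> (y - x)})"
  proof
    show "A x \<subseteq> (\<Inter>y. \<Inter>v\<in>A y. {a. 0 \<le> (v - a) \<bullet> (y - x)})"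
      using A unfolding maximally_monotone_def monotone_op_def by blast
    show "(\<Inter>y. \<Inter>v\<in>A y. {a. 0 \<le> (v - a) \<bullet> (y - x)}) \<subseteq> A x"
      by (auto intro!: maximally_monotone_memI[OF A])
  qed
  moreover have "closed {a. 0 \<le> (v - a) \<bullet> (y - x)}" for v y
    by (intro closed_Collect_le continuous_intros)
  ultimately show ?thesis by (simp add: closed_INT)
qed

context positive_operator
begin

text \<open>
  In the \<open>K\<close> inner product \<open>K (x - b) \<bullet> (x - y) \<le> 0\<close> says that \<open>x\<close> lies in the ball with diameter \<open>[b, y]\<close>.  The
  minimizer of the largest of the functions \<open>x \<mapsto> K (x - b) \<bullet> (x - y)\<close> lies in all balls; it is found from the dual
  problem.  For weights with averages \<open>B\<close>, \<open>Y\<close>, \<open>r\<close> of \<open>b\<close>, \<open>y\<close>, \<open>K b \<bullet> y\<close>, the weighted sum of the functions is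
  minimal at \<open>(B + Y)/2\<close> with value \<open>r - K (B + Y) \<bullet> (B + Y) / 4\<close>.  Monotonicity makes this value nonpositive, and
  stationarity of the maximizing weights in the direction of each vertex bounds each single function by it.
\<close>

lemma finitely_many_balls_meet:
  assumes fin: "finite I"
    and mono: "\<And>y b y' b'. (y, b) \<in> I \<Longrightarrow> (y', b') \<in> I \<Longrightarrow> K (b - b') \<bullet> (y - y') \<le> 0"
  shows "\<exists>x. \<forall>(y, b)\<in>I. K (x - b) \<bullet> (x - y) \<le> 0"
proof (cases "I = {}")
  case False
  define P where "P = (\<lambda>(y, b). (b, y, K b \<bullet> y))"
  define S where "S = convex hull (P ` I)"
  define G where "G = (\<lambda>(B, Y, r). r - K (B + Y) \<bullet> (B + Y) / 4)"
  have "compact S" unfolding S_def using fin by (simp add: finite_imp_compact_convex_hull)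
  moreover have "S \<noteq> {}" using False by (simp add: S_def)
  moreover have "continuous_on S G"
    unfolding G_def split_beta by (intro continuous_intros continuous_on_compose2[OF K_continuous]) auto
  ultimately obtain Q where Q: "Q \<in> S" "\<And>Q'. Q' \<in> S \<Longrightarrow> G Q' \<le> G Q"
    using continuous_attains_sup by metis
  obtain B Y r where Qe: "Q = (B, Y, r)" by (cases Q)
  \<comment> \<open>An affine function of \<open>(B, Y, r)\<close> that is nonpositive at the generators is nonpositive on the hull.
      It is applied twice, freezing one argument of the bilinear expression at a time.\<close>
  have lin_le: "r' + \<rho> - K B' \<bullet> \<eta> - K \<xi> \<bullet> Y' \<le> 0" if "(B', Y', r') \<in> S"
    and gen: "\<And>y b. (y, b) \<in> I \<Longrightarrow> K b \<bullet> y + \<rho> - K b \<bullet> \<eta> - K \<xi> \<bullet> y \<le> 0" for B' Y' r' \<rho> \<eta> \<xi>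
  proof -
    have "convex {q :: 'a \<times> 'a \<times> real. (- K \<eta>, - K \<xi>, 1) \<bullet> q \<le> - \<rho>}" by (rule convex_halfspace_le)
    moreover have "P ` I \<subseteq> {q. (- K \<eta>, - K \<xi>, 1) \<bullet> q \<le> - \<rho>}"
    proof
      fix q assume "q \<in> P ` I"
      then obtain y b where yb: "(y, b) \<in> I" and q: "q = (b, y, K b \<bullet> y)" by (auto simp: P_def)
      from gen[OF yb] show "q \<in> {q. (- K \<eta>, - K \<xi>, 1) \<bullet> q \<le> - \<rho>}"
        using sym[of b \<eta>] by (simp add: q)
    qed
    ultimately have "S \<subseteq> {q. (- K \<eta>, - K \<xi>, 1) \<bullet> q \<le> - \<rho>}" unfolding S_def by (rule hull_minimal[rotated])
    with that(1) have "(- K \<eta>, - K \<xi>, 1) \<bullet> (B', Y', r') \<le> - \<rho>" by blast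
    then show ?thesis using sym[of B' \<eta>] by simp
  qed
  have "r + K b \<bullet> y - K B \<bullet> y - K b \<bullet> Y \<le> 0" if "(y, b) \<in> I" for y b
    using Q(1) unfolding Qe
  proof (rule lin_le)
    fix y' b' assume "(y', b') \<in> I"
    from mono[OF this that] show "K b' \<bullet> y' + K b \<bullet> y - K b' \<bullet> y - K b \<bullet> y' \<le> 0"
      by (simp add: K_simps inner_diff)
  qed
  then have "r + r - K B \<bullet> Y - K B \<bullet> Y \<le> 0"
    using Q(1) unfolding Qe by (intro lin_le[where B' = B and Y' = Y]) (auto simp: algebra_simps)
  then have r: "r \<le> K B \<bullet> Y" by simp
  have GQ: "G Q \<le> 0"
    using r nonneg[of "B - Y"] sym[of Y B] by (simp add: G_def Qe K_simps inner_add inner_diff)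
  define x where "x = (1/2) *\<^sub>R (B + Y)"
  have GQx: "G Q = r - K x \<bullet> x" by (simp add: G_def Qe x_def K_simps inner_add field_simps)
  have "K (x - b) \<bullet> (x - y) \<le> 0" if yb: "(y, b) \<in> I" for y b
  proof -
    define e where "e = (1/2) *\<^sub>R (b + y) - x"
    have "K b \<bullet> y - r - 2 * (K x \<bullet> e) \<le> s * (K e \<bullet> e)" if s: "0 < s" "s \<le> 1" for s
    proof -
      let ?Q = "(1 - s) *\<^sub>R Q + s *\<^sub>R P (y, b)"
      have "?Q \<in> S" using Q(1) yb s
        by (intro convexD[of S]) (auto simp: S_def intro: hull_inc)
      from Q(2)[OF this] have "G ?Q \<le> G Q" .
      moreover have "G ?Q = (1 - s) * r + s * (K b \<bullet> y) - K (x + s *\<^sub>R e) \<bullet> (x + s *\<^sub>R e)"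
      proof -
        have "(1 - s) *\<^sub>R B + s *\<^sub>R b + ((1 - s) *\<^sub>R Y + s *\<^sub>R y) = 2 *\<^sub>R (x + s *\<^sub>R e)"
          by (simp add: x_def e_def algebra_simps)
        then have "K ((1 - s) *\<^sub>R B + s *\<^sub>R b + ((1 - s) *\<^sub>R Y + s *\<^sub>R y)) \<bullet> ((1 - s) *\<^sub>R B + s *\<^sub>R b + ((1 - s) *\<^sub>R Y + s *\<^sub>R y))
            = 4 * (K (x + s *\<^sub>R e) \<bullet> (x + s *\<^sub>R e))" by (simp only: linear_cmul[OF lin]) simp
        then show ?thesis by (simp add: G_def Qe P_def)
      qed
      moreover have "K (x + s *\<^sub>R e) \<bullet> (x + s *\<^sub>R e) = K x \<bullet> x + 2 * s * (K x \<bullet> e) + s * (s * (K e \<bullet> e))"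
        using sym[of e x] by (simp add: K_simps inner_add algebra_simps)
      ultimately have "s * (K b \<bullet> y - r - 2 * (K x \<bullet> e)) \<le> s * (s * (K e \<bullet> e))"
        unfolding GQx by (simp add: algebra_simps)
      then show ?thesis using s by simp
    qed
    then have "eventually (\<lambda>s. K b \<bullet> y - r - 2 * (K x \<bullet> e) \<le> s * (K e \<bullet> e)) (at_right 0)"
      unfolding eventually_at_right_field by (intro exI[of _ 1]) auto
    moreover have "((\<lambda>s. s * (K e \<bullet> e)) \<longlongrightarrow> 0 * (K e \<bullet> e)) (at_right 0)"
      by (intro tendsto_intros)
    ultimately have "K b \<bullet> y - r - 2 * (K x \<bullet> e) \<le> 0 * (K e \<bullet> e)"
      by (intro tendsto_lowerbound[of "\<lambda>s. s * (K e \<bullet> e)" _ "at_right (0::real)"]) auto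
    moreover have "K (x - b) \<bullet> (x - y) = K b \<bullet> y - 2 * (K x \<bullet> e) - K x \<bullet> x"
      using sym[of b x] by (simp add: e_def K_simps inner_diff inner_add algebra_simps)
    ultimately show ?thesis using GQ unfolding GQx by simp
  qed
  then show ?thesis by blast
qed simp

text \<open>
  The inequality that the pair \<open>(y, v)\<close> of the graph imposes on a solution \<open>x\<close> describes the ball with diameter
  \<open>[y, w - inv K v]\<close>.  One of these balls is compact, so a common point exists as soon as every finite
  subfamily has one; maximality then puts \<open>K (w - x)\<close> into \<open>A x\<close>.
\<close>

theorem Minty:
  assumes max: "maximally_monotone A" and ne: "dom_op A \<noteq> {}"
  shows "\<exists>x. K (w - x) \<in> A x"
proof -
  obtain y0 v0 where v0: "v0 \<in> A y0" using ne by (auto simp: dom_op_def)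
  define C where "C = (\<lambda>(y, v). {x. K (x - (w - inv K v)) \<bullet> (x - y) \<le> 0})"
  define Gr where "Gr = {(y, v). v \<in> A y}"
  have closed: "closed (C p)" for p
    unfolding C_def split_beta
    by (intro closed_Collect_le continuous_intros continuous_on_compose2[OF K_continuous]) auto
  have "bounded (C (y0, v0))"
  proof -
    obtain \<mu> where \<mu>: "\<mu> > 0" "\<And>u. \<mu> * (norm u)\<^sup>2 \<le> K u \<bullet> u" using coercive by blast
    define b where "b = w - inv K v0"
    define m where "m = (1/2) *\<^sub>R (b + y0)"
    define h where "h = (1/2) *\<^sub>R (b - y0)"
    have "dist m x \<le> sqrt (K h \<bullet> h / \<mu>)" if "x \<in> C (y0, v0)" for x
    proof -
      have "K (x - b) \<bullet> (x - y0) \<le> 0" using that by (simp add: C_def b_def)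
      moreover have "x - b = (x - m) - h" "x - y0 = (x - m) + h" by (auto simp: m_def h_def algebra_simps simp flip: scaleR_add_left)
      ultimately have "K (x - m) \<bullet> (x - m) \<le> K h \<bullet> h"
        using sym[of "x - m" h] unfolding \<open>x - b = _\<close> \<open>x - y0 = _\<close>
        by (simp add: linear_diff[OF lin, of "x - m" h] inner_diff_left[of "K (x - m)"] inner_add_right[of _ "x - m" h])
      with \<mu>(2)[of "x - m"] have "\<mu> * (norm (x - m))\<^sup>2 \<le> K h \<bullet> h" by linarith
      then have "(norm (x - m))\<^sup>2 \<le> K h \<bullet> h / \<mu>" using \<mu>(1) by (simp add: field_simps)
      then show ?thesis by (simp add: dist_norm norm_minus_commute real_le_rsqrt)
    qed
    then show ?thesis unfolding bounded_def by blast
  qed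
  then have comp: "compact (C (y0, v0))" using closed by (simp add: compact_eq_bounded_closed)
  have "C (y0, v0) \<inter> \<Inter> (C ` Gr) \<noteq> {}"
  proof (rule compact_imp_fip[OF comp])
    fix \<F> assume fin: "finite \<F>" and sub: "\<F> \<subseteq> C ` Gr"
    obtain I where I: "finite I" "I \<subseteq> Gr" "\<F> = C ` I" using finite_subset_image[OF fin sub] by blast
    define J where "J = (\<lambda>(y, v). (y, w - inv K v)) ` insert (y0, v0) I"
    have "\<exists>x. \<forall>(y, b)\<in>J. K (x - b) \<bullet> (x - y) \<le> 0"
    proof (rule finitely_many_balls_meet)
      fix y b y' b' assume "(y, b) \<in> J" "(y', b') \<in> J"
      moreover have "\<exists>v. v \<in> A y \<and> b = w - inv K v" if "(y, b) \<in> J" for y b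
        using that I(2) v0 unfolding J_def Gr_def by auto
      ultimately obtain v v' where vv: "v \<in> A y" "v' \<in> A y'" "b = w - inv K v" "b' = w - inv K v'"
        by meson
      have "0 \<le> (v - v') \<bullet> (y - y')"
        using max vv unfolding maximally_monotone_def monotone_op_def by blast
      then show "K (b - b') \<bullet> (y - y') \<le> 0" unfolding vv by (simp add: K_simps K_inv inner_diff)
    qed (use I in \<open>simp add: J_def\<close>)
    then obtain x where x: "\<And>y b. (y, b) \<in> J \<Longrightarrow> K (x - b) \<bullet> (x - y) \<le> 0" by blast
    have "x \<in> C p" if p: "p \<in> insert (y0, v0) I" for p
    proof -
      have "(fst p, w - inv K (snd p)) \<in> J" unfolding J_def using p by force
      from x[OF this] show ?thesis by (simp add: C_def split_beta)
    qed
    then show "C (y0, v0) \<inter> \<Inter> \<F> \<noteq> {}" unfolding I by blast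
  qed (use closed in auto)
  then obtain x where x: "\<And>p. p \<in> Gr \<Longrightarrow> x \<in> C p" by blast
  have "K (w - x) \<in> A x"
  proof (rule maximally_monotone_memI[OF max])
    fix y v assume "v \<in> A y"
    then have "x \<in> C (y, v)" by (intro x) (simp add: Gr_def)
    then have "K (x - (w - inv K v)) \<bullet> (x - y) \<le> 0" by (simp add: C_def)
    then show "0 \<le> (v - K (w - x)) \<bullet> (y - x)"
      by (simp add: K_simps K_inv inner_diff inner_add algebra_simps)
  qed
  then show ?thesis by blast
qed

lemma Minty_unique:
  assumes mono: "monotone_op A" and "K (w - x) \<in> A x" "K (w - y) \<in> A y"
  shows "x = y"
proof (rule ccontr)
  assume "x \<noteq> y"
  have "0 \<le> (K (w - x) - K (w - y)) \<bullet> (x - y)"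
    using assms unfolding monotone_op_def by blast
  also have "\<dots> = - (K (x - y) \<bullet> (x - y))" by (simp add: K_simps inner_diff)
  finally show False using pos[of "x - y"] \<open>x \<noteq> y\<close> by simp
qed

end

section \<open>Mixed third differences of twice differentiable functions\<close>

text \<open>
  The numbers \<open>T1, T2, T3, T4\<close> are the values \<open>T(d,d,d)\<close>, \<open>T(d,d,h)\<close>, \<open>T(d,h,h)\<close>, \<open>T(h,h,h)\<close> of a symmetric trilinear form
  on a Euclidean plane with unit vectors \<open>d\<close>, \<open>h\<close> at angle \<open>3\<theta>\<close>, and the hypothesis bounds \<open>T(v,v,v)\<close> for
  unit vectors \<open>v = \<alpha> d + \<beta> h\<close>.  Measuring angles from \<open>h\<close>, let \<open>v\<^sub>k\<close> be the unit vectors at the three angles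
  \<open>\<theta>\<^sub>k = \<theta> + 2\<pi>k/3\<close>.  The symmetrized product of \<open>d\<close>, \<open>h\<close>, \<open>h\<close> is \<open>\<Sum>\<^sub>k c\<^sub>k v\<^sub>k \<otimes> v\<^sub>k \<otimes> v\<^sub>k\<close> with
  \<open>c\<^sub>k = ((1 + 2 cos (2\<theta>\<^sub>k)) / 3)^2\<close>.  These weights are nonnegative and sum to one, so \<open>T(d,h,h)\<close> is a convex
  combination of values on the diagonal.
\<close>

lemma mixed_cubic_bound:
  fixes T1 T2 T3 T4 L \<theta> :: real
  assumes S: "sin (3 * \<theta>) \<noteq> 0"
    and T: "\<And>\<alpha> \<beta>. \<alpha>\<^sup>2 + \<beta>\<^sup>2 + 2 * \<alpha> * \<beta> * cos (3 * \<theta>) = 1 \<Longrightarrow>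
              \<bar>\<alpha>^3 * T1 + 3 * \<alpha>\<^sup>2 * \<beta> * T2 + 3 * \<alpha> * \<beta>\<^sup>2 * T3 + \<beta>^3 * T4\<bar> \<le> L"
  shows "\<bar>T3\<bar> \<le> L"
proof -
  define S where "S = sin (3 * \<theta>)"
  define C where "C = cos (3 * \<theta>)"
  define q where "q = 2 * pi / 3"
  define X where "X k = cos (\<theta> + k)" for k
  define Y where "Y k = sin (\<theta> + k)" for k
  define c where "c k = ((4 * (X k)\<^sup>2 - 1) / 3)\<^sup>2" for k
  define P where "P k = (Y k)^3 * T1 + 3 * (Y k)\<^sup>2 * (S * X k - C * Y k) * T2
       + 3 * Y k * (S * X k - C * Y k)\<^sup>2 * T3 + (S * X k - C * Y k) ^ 3 * T4" for k
  define A1 where "A1 = T1 - 3 * C * T2 + 3 * C\<^sup>2 * T3 - C^3 * T4"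
  define A2 where "A2 = 3 * S * T2 - 6 * S * C * T3 + 3 * S * C\<^sup>2 * T4"
  define A3 where "A3 = 3 * S\<^sup>2 * T3 - 3 * S\<^sup>2 * C * T4"
  have SC: "S\<^sup>2 + C\<^sup>2 = 1" by (simp add: S_def C_def)
  have S0: "S \<noteq> 0" using S by (simp add: S_def)
  have XY: "(X k)\<^sup>2 + (Y k)\<^sup>2 = 1" for k by (simp add: X_def Y_def)
  have sin3: "sin (3 * x) = 3 * sin x - 4 * sin x ^ 3" for x :: real
  proof -
    have "sin (3 * x) = sin (2 * x + x)" by simp
    also have "\<dots> = 2 * sin x * (cos x)\<^sup>2 + (1 - 2 * (sin x)\<^sup>2) * sin x"
      unfolding sin_add[of "2 * x"] sin_double cos_double_sin by (simp add: algebra_simps power2_eq_square)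
    also have "\<dots> = 3 * sin x - 4 * sin x ^ 3"
      unfolding cos_squared_eq by (simp add: algebra_simps power2_eq_square power3_eq_cube)
    finally show ?thesis .
  qed
  \<comment> \<open>The three angles have the same triple angle, so cubic monomials in \<open>X k\<close>, \<open>Y k\<close> are affine in \<open>X k\<close>, \<open>Y k\<close>.\<close>
  have period: "cos (3 * (\<theta> + k)) = C" "sin (3 * (\<theta> + k)) = S" if "k \<in> {0, q, -q}" for k
  proof -
    have "3 * (\<theta> + k) = 3 * \<theta> \<or> 3 * (\<theta> + k) = 3 * \<theta> + 2 * pi \<or> 3 * (\<theta> + k) = 3 * \<theta> - 2 * pi"
      using that by (auto simp: q_def)
    then show "cos (3 * (\<theta> + k)) = C" "sin (3 * (\<theta> + k)) = S" by (auto simp: C_def S_def cos_diff sin_diff)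
  qed
  have X3: "X k ^ 3 = (C + 3 * X k) / 4" if "k \<in> {0, q, -q}" for k
    using period(1)[OF that] cos_treble_cos[of "\<theta> + k"] by (simp add: X_def)
  have Y3: "Y k ^ 3 = (3 * Y k - S) / 4" if "k \<in> {0, q, -q}" for k
    using period(2)[OF that] sin3[of "\<theta> + k"] by (simp add: Y_def)
  have X2: "(X k)\<^sup>2 = 1 - (Y k)\<^sup>2" for k using XY[of k] by simp
  have Y2: "(Y k)\<^sup>2 = 1 - (X k)\<^sup>2" for k using XY[of k] by simp
  have XXY: "(X k)\<^sup>2 * Y k = (S + Y k) / 4" if "k \<in> {0, q, -q}" for k
    using Y3[OF that] unfolding X2 by (simp add: algebra_simps power2_eq_square power3_eq_cube)
  have XYY: "X k * (Y k)\<^sup>2 = (X k - C) / 4" if "k \<in> {0, q, -q}" for k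
    using X3[OF that] unfolding Y2 by (simp add: algebra_simps power2_eq_square power3_eq_cube)
  have c: "c k = (4 * C * X k + 4 * (X k)\<^sup>2 + 1) / 9" if "k \<in> {0, q, -q}" for k
  proof -
    have "c k = (16 * (X k * X k ^ 3) - 8 * (X k)\<^sup>2 + 1) / 9"
      unfolding c_def by (simp add: power2_eq_square power3_eq_cube field_simps)
    then show ?thesis unfolding X3[OF that] by (simp add: field_simps power2_eq_square)
  qed
  have rot: "X q = - cos \<theta> / 2 - sqrt 3 / 2 * sin \<theta>" "X (-q) = - cos \<theta> / 2 + sqrt 3 / 2 * sin \<theta>"
    "Y q = - sin \<theta> / 2 + sqrt 3 / 2 * cos \<theta>" "Y (-q) = - sin \<theta> / 2 - sqrt 3 / 2 * cos \<theta>"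
    "X 0 = cos \<theta>" "Y 0 = sin \<theta>"
    unfolding X_def Y_def q_def by (simp_all add: cos_add sin_add cos_120 sin_120 cos_diff sin_diff)
  have sX: "X 0 + X q + X (-q) = 0" and sY: "Y 0 + Y q + Y (-q) = 0" by (simp_all add: rot)
  have sXY: "X 0 * Y 0 + X q * Y q + X (-q) * Y (-q) = 0"
    unfolding rot by (simp add: algebra_simps)
  have sXX: "(X 0)\<^sup>2 + (X q)\<^sup>2 + (X (-q))\<^sup>2 = 3 / 2"
  proof -
    have "(X 0)\<^sup>2 + (X q)\<^sup>2 + (X (-q))\<^sup>2 = 3 / 2 * ((cos \<theta>)\<^sup>2 + (sin \<theta>)\<^sup>2)"
      unfolding rot power2_eq_square distrib_left by (simp add: algebra_simps)
    then show ?thesis by simp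
  qed
  have k: "0 \<in> {0, q, -q}" "q \<in> {0, q, -q}" "-q \<in> {0, q, -q}" by auto
  have c9: "9 * c k = 4 * C * X k + 4 * (X k)\<^sup>2 + 1" if "k \<in> {0, q, -q}" for k
    unfolding c[OF that] by simp
  have c1: "c 0 + c q + c (-q) = 1"
  proof -
    have "9 * c 0 + 9 * c q + 9 * c (-q) = 4 * C * (X 0 + X q + X (-q)) + 4 * ((X 0)\<^sup>2 + (X q)\<^sup>2 + (X (-q))\<^sup>2) + 3"
      unfolding k[THEN c9] by (simp add: algebra_simps)
    then show ?thesis unfolding sX sXX by simp
  qed
  have cX: "c 0 * X 0 + c q * X q + c (-q) * X (-q) = C"
  proof -
    have "9 * c 0 * X 0 + 9 * c q * X q + 9 * c (-q) * X (-q) = 4 * C * ((X 0)\<^sup>2 + (X q)\<^sup>2 + (X (-q))\<^sup>2)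
         + 4 * (X 0 ^ 3 + X q ^ 3 + X (-q) ^ 3) + (X 0 + X q + X (-q))"
      unfolding k[THEN c9] by (simp add: power2_eq_square power3_eq_cube algebra_simps)
    also have "X 0 ^ 3 + X q ^ 3 + X (-q) ^ 3 = (3 * C + 3 * (X 0 + X q + X (-q))) / 4"
      unfolding k[THEN X3] by (simp add: field_simps)
    finally show ?thesis unfolding sX sXX by simp
  qed
  have cY: "c 0 * Y 0 + c q * Y q + c (-q) * Y (-q) = S / 3"
  proof -
    have "9 * c 0 * Y 0 + 9 * c q * Y q + 9 * c (-q) * Y (-q) = 4 * C * (X 0 * Y 0 + X q * Y q + X (-q) * Y (-q))
         + 4 * ((X 0)\<^sup>2 * Y 0 + (X q)\<^sup>2 * Y q + (X (-q))\<^sup>2 * Y (-q)) + (Y 0 + Y q + Y (-q))"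
      unfolding k[THEN c9] by (simp add: algebra_simps)
    also have "(X 0)\<^sup>2 * Y 0 + (X q)\<^sup>2 * Y q + (X (-q))\<^sup>2 * Y (-q) = (3 * S + (Y 0 + Y q + Y (-q))) / 4"
      unfolding k[THEN XXY] by (simp add: field_simps)
    finally show ?thesis unfolding sXY sY by simp
  qed
  have P: "P k = (3 * Y k - S) / 4 * A1 + (X k - C) / 4 * A2 + (S + Y k) / 4 * A3 + (C + 3 * X k) / 4 * (S^3 * T4)"
    if "k \<in> {0, q, -q}" for k
    unfolding P_def A1_def A2_def A3_def X3[OF that, symmetric] Y3[OF that, symmetric] XXY[OF that, symmetric]
      XYY[OF that, symmetric] by (simp add: power2_eq_square power3_eq_cube algebra_simps)
  have sum: "c 0 * P 0 + c q * P q + c (-q) * P (-q) = S^3 * T3"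
  proof -
    have "c 0 * P 0 + c q * P q + c (-q) * P (-q) =
      (3 * (c 0 * Y 0 + c q * Y q + c (-q) * Y (-q)) - S * (c 0 + c q + c (-q))) / 4 * A1
      + ((c 0 * X 0 + c q * X q + c (-q) * X (-q)) - C * (c 0 + c q + c (-q))) / 4 * A2
      + (S * (c 0 + c q + c (-q)) + (c 0 * Y 0 + c q * Y q + c (-q) * Y (-q))) / 4 * A3
      + (C * (c 0 + c q + c (-q)) + 3 * (c 0 * X 0 + c q * X q + c (-q) * X (-q))) / 4 * (S^3 * T4)"
      unfolding k[THEN P] by (simp add: field_simps)
    also have "\<dots> = S^3 * T3"
      unfolding c1 cX cY A3_def by (simp add: power2_eq_square power3_eq_cube algebra_simps)
    finally show ?thesis .
  qed
  have bound: "\<bar>P k\<bar> \<le> \<bar>S\<bar>^3 * L" for k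
  proof -
    \<comment> \<open>Coordinates of the unit vector at angle \<open>\<theta> + k\<close> in the basis \<open>d\<close>, \<open>h\<close>.\<close>
    let ?\<alpha> = "Y k / S" and ?\<beta> = "(S * X k - C * Y k) / S"
    have "?\<alpha>\<^sup>2 + ?\<beta>\<^sup>2 + 2 * ?\<alpha> * ?\<beta> * C = ((Y k)\<^sup>2 + (S * X k - C * Y k)\<^sup>2 + 2 * Y k * (S * X k - C * Y k) * C) / S\<^sup>2"
      using S0 by (simp add: field_simps power2_eq_square)
    also have "(Y k)\<^sup>2 + (S * X k - C * Y k)\<^sup>2 + 2 * Y k * (S * X k - C * Y k) * C = S\<^sup>2"
      using XY[of k] SC by algebra
    finally have "?\<alpha>\<^sup>2 + ?\<beta>\<^sup>2 + 2 * ?\<alpha> * ?\<beta> * cos (3 * \<theta>) = 1" using S0 by (simp add: C_def)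
    note * = T[OF this]
    have "y^3 * T1 + 3 * y\<^sup>2 * r * T2 + 3 * y * r\<^sup>2 * T3 + r^3 * T4 =
        S^3 * ((y/S)^3 * T1 + 3 * (y/S)\<^sup>2 * (r/S) * T2 + 3 * (y/S) * (r/S)\<^sup>2 * T3 + (r/S)^3 * T4)" for y r
      using S0 by (simp add: field_simps power2_eq_square power3_eq_cube)
    from this[of "Y k" "S * X k - C * Y k", folded P_def] * have "\<bar>P k / S^3\<bar> \<le> L"
      using S0 by simp
    then show ?thesis using S0 by (simp add: abs_divide power_abs field_simps)
  qed
  have c0: "0 \<le> c k" for k by (simp add: c_def)
  have "\<bar>S\<bar>^3 * \<bar>T3\<bar> = \<bar>c 0 * P 0 + c q * P q + c (-q) * P (-q)\<bar>"
    unfolding sum by (simp add: abs_mult power_abs)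
  also have "\<dots> \<le> \<bar>c 0 * P 0\<bar> + \<bar>c q * P q\<bar> + \<bar>c (-q) * P (-q)\<bar>" by linarith
  also have "\<dots> = c 0 * \<bar>P 0\<bar> + c q * \<bar>P q\<bar> + c (-q) * \<bar>P (-q)\<bar>" using c0 by (simp add: abs_mult)
  also have "\<dots> \<le> c 0 * (\<bar>S\<bar>^3 * L) + c q * (\<bar>S\<bar>^3 * L) + c (-q) * (\<bar>S\<bar>^3 * L)"
    by (intro add_mono mult_left_mono bound c0)
  also have "\<dots> = (c 0 + c q + c (-q)) * (\<bar>S\<bar>^3 * L)" by (simp add: algebra_simps)
  also have "\<dots> = \<bar>S\<bar>^3 * L" by (simp add: c1)
  finally show ?thesis using S0 by simp
qed

lemma convex_segment_mem:
  fixes x h :: "'a::real_vector"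
  assumes "convex U" "x \<in> U" "x + b *\<^sub>R h \<in> U" "0 \<le> q" "q \<le> (b::real)"
  shows "x + q *\<^sub>R h \<in> U"
proof (cases "b = 0")
  case True
  then show ?thesis using assms by auto
next
  case False
  then have b: "b > 0" using assms by auto
  have "(1 - q / b) *\<^sub>R x + (q / b) *\<^sub>R (x + b *\<^sub>R h) \<in> U"
    using assms b by (intro convexD) auto
  also have "(1 - q / b) *\<^sub>R x + (q / b) *\<^sub>R (x + b *\<^sub>R h) = x + q *\<^sub>R h"
    using b by (simp add: algebra_simps)
  finally show ?thesis .
qed

lemma open_line_neighbourhood:
  fixes x v :: "'a::real_normed_vector"
  assumes "open U" "x \<in> U"
  obtains \<delta> :: real where "\<delta> > 0" "\<And>\<tau>. \<bar>\<tau>\<bar> \<le> \<delta> \<Longrightarrow> x + \<tau> *\<^sub>R v \<in> U"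
proof -
  have "open ((\<lambda>\<tau>::real. x + \<tau> *\<^sub>R v) -` U)"
    by (rule open_vimage[OF assms(1)]) (auto intro!: continuous_intros)
  moreover have "0 \<in> (\<lambda>\<tau>::real. x + \<tau> *\<^sub>R v) -` U" using assms by simp
  ultimately obtain e where "e > 0" "cball 0 e \<subseteq> (\<lambda>\<tau>::real. x + \<tau> *\<^sub>R v) -` U"
    by (meson open_contains_cball)
  then show ?thesis by (intro that[of e]) (auto simp: subset_eq)
qed

lemma has_derivative_along_line:
  fixes k :: "'a::real_normed_vector \<Rightarrow> 'b::real_normed_vector"
  assumes "(k has_derivative K) (at (x + \<tau> *\<^sub>R v))"
  shows "((\<lambda>\<tau>. k (x + \<tau> *\<^sub>R v)) has_vector_derivative K v) (at \<tau> within T)"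
proof -
  have "((\<lambda>\<tau>. x + \<tau> *\<^sub>R v) has_derivative (\<lambda>s. s *\<^sub>R v)) (at \<tau> within T)"
    by (auto intro!: derivative_eq_intros)
  from has_derivative_in_compose[OF this has_derivative_at_withinI[OF assms]]
  have "((\<lambda>\<tau>. k (x + \<tau> *\<^sub>R v)) has_derivative (\<lambda>s. K (s *\<^sub>R v))) (at \<tau> within T)" .
  moreover have "K (s *\<^sub>R v) = s *\<^sub>R K v" for s
    using has_derivative_linear[OF assms] by (simp add: linear_cmul)
  ultimately show ?thesis by (simp add: has_vector_derivative_def)
qed

lemma has_real_derivative_along_line:
  fixes k :: "'a::real_normed_vector \<Rightarrow> real"
  assumes "(k has_derivative K) (at (x + \<tau> *\<^sub>R v))"
  shows "((\<lambda>\<tau>. k (x + \<tau> *\<^sub>R v)) has_real_derivative K v) (at \<tau> within T)"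
  using has_derivative_along_line[OF assms] by (simp add: has_real_derivative_iff_has_vector_derivative)

text \<open>
  Differentiation under the integral sign along a direction \<open>v\<close> in which the derivative of \<open>k\<close> is continuous.
\<close>

lemma segment_integral_has_derivative:
  fixes k :: "'a::euclidean_space \<Rightarrow> real"
  assumes U: "open U" "convex U"
    and kd: "\<And>x. x \<in> U \<Longrightarrow> (k has_derivative K x) (at x)"
    and kc: "continuous_on U (\<lambda>x. K x v)"
    and y: "y \<in> U" "y + b *\<^sub>R h \<in> U"
  shows "((\<lambda>\<tau>. integral {0..b} (\<lambda>q. k (y + \<tau> *\<^sub>R v + q *\<^sub>R h))) has_real_derivative
           integral {0..b} (\<lambda>q. K (y + q *\<^sub>R h) v)) (at 0)"
proof -
  obtain d1 where d1: "d1 > 0" "\<And>\<tau>. \<bar>\<tau>\<bar> \<le> d1 \<Longrightarrow> y + \<tau> *\<^sub>R v \<in> U"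
    using open_line_neighbourhood[OF U(1) y(1)] by blast
  obtain d2 where d2: "d2 > 0" "\<And>\<tau>. \<bar>\<tau>\<bar> \<le> d2 \<Longrightarrow> y + b *\<^sub>R h + \<tau> *\<^sub>R v \<in> U"
    using open_line_neighbourhood[OF U(1) y(2)] by blast
  define \<delta> where "\<delta> = min d1 d2"
  have \<delta>: "\<delta> > 0" using d1 d2 by (simp add: \<delta>_def)
  have mem: "y + \<tau> *\<^sub>R v + q *\<^sub>R h \<in> U" if "\<tau> \<in> {-\<delta>..\<delta>}" "q \<in> {0..b}" for \<tau> q
  proof (rule convex_segment_mem[OF U(2), of _ b])
    show "y + \<tau> *\<^sub>R v \<in> U" using d1(2)[of \<tau>] that by (auto simp: \<delta>_def)
    show "y + \<tau> *\<^sub>R v + b *\<^sub>R h \<in> U" using d2(2)[of \<tau>] that by (auto simp: \<delta>_def ac_simps)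
  qed (use that in auto)
  have kcont: "continuous_on U k"
    using kd has_derivative_continuous continuous_at_imp_continuous_on by blast
  have "((\<lambda>\<tau>. integral (cbox 0 b) (\<lambda>q. k (y + \<tau> *\<^sub>R v + q *\<^sub>R h))) has_field_derivative
           integral (cbox 0 b) (\<lambda>q. K (y + 0 *\<^sub>R v + q *\<^sub>R h) v)) (at 0 within {-\<delta>..\<delta>})"
  proof (rule leibniz_rule_field_derivative)
    fix \<tau> q :: real assume *: "\<tau> \<in> {-\<delta>..\<delta>}" "q \<in> cbox 0 b"
    have eq: "(y + q *\<^sub>R h) + \<tau> *\<^sub>R v = y + \<tau> *\<^sub>R v + q *\<^sub>R h" for \<tau> by (simp add: ac_simps)
    have "(k has_derivative K (y + \<tau> *\<^sub>R v + q *\<^sub>R h)) (at ((y + q *\<^sub>R h) + \<tau> *\<^sub>R v))"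
      unfolding eq using * mem by (intro kd) auto
    from has_real_derivative_along_line[OF this]
    show "((\<lambda>\<tau>. k (y + \<tau> *\<^sub>R v + q *\<^sub>R h)) has_field_derivative K (y + \<tau> *\<^sub>R v + q *\<^sub>R h) v)
             (at \<tau> within {-\<delta>..\<delta>})"
      unfolding eq .
  next
    fix \<tau> :: real assume *: "\<tau> \<in> {-\<delta>..\<delta>}"
    show "(\<lambda>q. k (y + \<tau> *\<^sub>R v + q *\<^sub>R h)) integrable_on cbox 0 b"
      using mem[OF *] by (intro integrable_continuous continuous_on_compose2[OF kcont] continuous_intros) auto
  next
    show "continuous_on ({-\<delta>..\<delta>} \<times> cbox 0 b) (\<lambda>(\<tau>, q). K (y + \<tau> *\<^sub>R v + q *\<^sub>R h) v)"
      unfolding split_beta using mem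
      by (intro continuous_on_compose2[OF kc] continuous_intros) auto
  qed (use \<delta> in auto)
  moreover have "at 0 within {-\<delta>..\<delta>} = at (0::real)"
    using \<delta> by (intro at_within_interior) auto
  ultimately show ?thesis by simp
qed

locale twice_differentiable =
  fixes U :: "'a::euclidean_space set" and F :: "'a \<Rightarrow> real"
    and g :: "'a \<Rightarrow> 'a" and H :: "'a \<Rightarrow> 'a \<Rightarrow> 'a"
  assumes open_U: "open U" and convex_U: "convex U"
    and F_deriv: "\<And>x. x \<in> U \<Longrightarrow> (F has_derivative (\<lambda>h. g x \<bullet> h)) (at x)"
    and g_deriv: "\<And>x. x \<in> U \<Longrightarrow> (g has_derivative H x) (at x)"
    and H_cont: "\<And>u. continuous_on U (\<lambda>x. H x u)"
begin

lemma H_linear: "x \<in> U \<Longrightarrow> linear (H x)"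
  using g_deriv has_derivative_linear by blast

lemma g_cont: "continuous_on U g"
  using g_deriv has_derivative_continuous continuous_at_imp_continuous_on by blast

lemma g_inner_deriv: "x \<in> U \<Longrightarrow> ((\<lambda>x. g x \<bullet> w) has_derivative (\<lambda>v. H x v \<bullet> w)) (at x)"
  by (auto intro!: derivative_eq_intros g_deriv)

lemma F_line_deriv:
  "x + \<tau> *\<^sub>R v \<in> U \<Longrightarrow> ((\<lambda>\<tau>. F (x + \<tau> *\<^sub>R v)) has_real_derivative g (x + \<tau> *\<^sub>R v) \<bullet> v) (at \<tau> within T)"
  by (rule has_real_derivative_along_line) (rule F_deriv)

lemma g_line_deriv:
  "x + \<tau> *\<^sub>R v \<in> U \<Longrightarrow>
     ((\<lambda>\<tau>. g (x + \<tau> *\<^sub>R v) \<bullet> w) has_real_derivative H (x + \<tau> *\<^sub>R v) v \<bullet> w) (at \<tau> within T)"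
  by (rule has_real_derivative_along_line[where k = "\<lambda>x. g x \<bullet> w" and K = "\<lambda>v. H _ v \<bullet> w"])
     (rule g_inner_deriv)

lemma second_difference_mean_value:
  assumes x: "x \<in> U" and s: "s > 0"
    and rect: "\<And>p q. 0 \<le> p \<Longrightarrow> p \<le> s \<Longrightarrow> 0 \<le> q \<Longrightarrow> q \<le> s \<Longrightarrow> x + p *\<^sub>R u + q *\<^sub>R w \<in> U"
  shows "\<exists>p q. 0 < p \<and> p < s \<and> 0 < q \<and> q < s \<and>
           F (x + s *\<^sub>R u + s *\<^sub>R w) - F (x + s *\<^sub>R u) - F (x + s *\<^sub>R w) + F x
             = s\<^sup>2 * (H (x + p *\<^sub>R u + q *\<^sub>R w) u \<bullet> w)"
proof -
  let ?G = "\<lambda>q. F (x + s *\<^sub>R u + q *\<^sub>R w) - F (x + q *\<^sub>R w)"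
  have m: "x + q *\<^sub>R w \<in> U" if "0 \<le> q" "q \<le> s" for q using rect[of 0 q] that s by simp
  have "\<exists>q. 0 < q \<and> q < s \<and> ?G s - ?G 0 = (s - 0) * (g (x + s *\<^sub>R u + q *\<^sub>R w) \<bullet> w - g (x + q *\<^sub>R w) \<bullet> w)"
    by (rule MVT2[OF s]) (use rect m s in \<open>auto intro!: DERIV_diff F_line_deriv\<close>)
  then obtain q where q: "0 < q" "q < s"
    and 1: "?G s - ?G 0 = s * (g (x + s *\<^sub>R u + q *\<^sub>R w) \<bullet> w - g (x + q *\<^sub>R w) \<bullet> w)" by auto
  let ?K = "\<lambda>p. g (x + q *\<^sub>R w + p *\<^sub>R u) \<bullet> w"
  have "\<exists>p. 0 < p \<and> p < s \<and> ?K s - ?K 0 = (s - 0) * (H (x + q *\<^sub>R w + p *\<^sub>R u) u \<bullet> w)"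
    using rect q by (intro MVT2[OF s] g_line_deriv) (auto simp: ac_simps)
  then obtain p where p: "0 < p" "p < s" and 2: "?K s - ?K 0 = s * (H (x + q *\<^sub>R w + p *\<^sub>R u) u \<bullet> w)"
    by auto
  show ?thesis using 1 2 p q
    by (intro exI[of _ p] exI[of _ q]) (simp add: ac_simps power2_eq_square)
qed

text \<open>
  Both sides are limits of the same second difference of \<open>F\<close> over a small square, taken in the two orders.
\<close>

lemma H_symmetric:
  assumes x: "x \<in> U" shows "H x u \<bullet> w = H x w \<bullet> u"
proof (rule ccontr)
  assume ne: "H x u \<bullet> w \<noteq> H x w \<bullet> u"
  define e where "e = \<bar>H x u \<bullet> w - H x w \<bullet> u\<bar> / 2"
  have e: "e > 0" using ne by (simp add: e_def)
  have c: "isCont (\<lambda>y. H y a \<bullet> b) x" for a b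
    using continuous_on_interior[OF H_cont, of x a] x open_U
    by (auto intro!: continuous_intros simp: interior_open)
  obtain d1 where d1: "d1 > 0" "\<And>y. dist y x < d1 \<Longrightarrow> dist (H y u \<bullet> w) (H x u \<bullet> w) < e"
    using c[of u w] e unfolding continuous_at_eps_delta by blast
  obtain d2 where d2: "d2 > 0" "\<And>y. dist y x < d2 \<Longrightarrow> dist (H y w \<bullet> u) (H x w \<bullet> u) < e"
    using c[of w u] e unfolding continuous_at_eps_delta by blast
  obtain d3 where d3: "d3 > 0" "ball x d3 \<subseteq> U" using x open_U open_contains_ball by blast
  define d where "d = min d1 (min d2 d3)"
  have d: "d > 0" using d1 d2 d3 by (simp add: d_def)
  define s where "s = d / (norm u + norm w + 1)"
  have nn: "0 < norm u + norm w + 1" using norm_ge_zero[of u] norm_ge_zero[of w] by linarith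
  have s: "s > 0" using d nn by (simp add: s_def)
  have near: "dist (x + p *\<^sub>R u + q *\<^sub>R w) x < d" if "0 \<le> p" "p \<le> s" "0 \<le> q" "q \<le> s" for p q
  proof -
    have "dist (x + p *\<^sub>R u + q *\<^sub>R w) x \<le> norm (p *\<^sub>R u) + norm (q *\<^sub>R w)"
      using norm_triangle_ineq[of "p *\<^sub>R u" "q *\<^sub>R w"] by (simp add: dist_norm add.assoc)
    also have "\<dots> \<le> s * norm u + s * norm w" using that by (simp add: add_mono mult_right_mono)
    also have "\<dots> < s * (norm u + norm w + 1)" using s by (simp add: algebra_simps)
    also have "\<dots> = d" using nn by (simp add: s_def)
    finally show ?thesis .
  qed
  have inU: "x + p *\<^sub>R u + q *\<^sub>R w \<in> U" if "0 \<le> p" "p \<le> s" "0 \<le> q" "q \<le> s" for p q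
    using near[OF that] d3 by (auto simp: d_def dist_commute)
  obtain p q where pq: "0 < p" "p < s" "0 < q" "q < s" and 1:
    "F (x + s *\<^sub>R u + s *\<^sub>R w) - F (x + s *\<^sub>R u) - F (x + s *\<^sub>R w) + F x
             = s\<^sup>2 * (H (x + p *\<^sub>R u + q *\<^sub>R w) u \<bullet> w)"
    using second_difference_mean_value[OF x s, of u w] inU by blast
  obtain p' q' where pq': "0 < p'" "p' < s" "0 < q'" "q' < s" and 2:
    "F (x + s *\<^sub>R w + s *\<^sub>R u) - F (x + s *\<^sub>R w) - F (x + s *\<^sub>R u) + F x
             = s\<^sup>2 * (H (x + p' *\<^sub>R w + q' *\<^sub>R u) w \<bullet> u)"
    using second_difference_mean_value[OF x s, of w u] inU by (force simp: add.assoc add.commute[of "_ *\<^sub>R w"])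
  have "s\<^sup>2 * (H (x + p *\<^sub>R u + q *\<^sub>R w) u \<bullet> w) = s\<^sup>2 * (H (x + p' *\<^sub>R w + q' *\<^sub>R u) w \<bullet> u)"
  proof -
    have "F (x + s *\<^sub>R u + s *\<^sub>R w) = F (x + s *\<^sub>R w + s *\<^sub>R u)" by (simp add: ac_simps)
    then show ?thesis using 1 2 by linarith
  qed
  then have eq: "H (x + p *\<^sub>R u + q *\<^sub>R w) u \<bullet> w = H (x + p' *\<^sub>R w + q' *\<^sub>R u) w \<bullet> u"
    using s by simp
  have "dist (H (x + p *\<^sub>R u + q *\<^sub>R w) u \<bullet> w) (H x u \<bullet> w) < e"
    using near[of p q] pq by (intro d1(2)) (auto simp: d_def)
  moreover have "dist (H (x + p' *\<^sub>R w + q' *\<^sub>R u) w \<bullet> u) (H x w \<bullet> u) < e"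
    using near[of q' p'] pq' by (intro d2(2)) (auto simp: d_def ac_simps)
  ultimately show False using eq unfolding e_def dist_real_def by (simp add: abs_if split: if_splits)
qed

lemma rectangle_mem:
  assumes "y \<in> U" "y + a *\<^sub>R d \<in> U" "y + b *\<^sub>R h \<in> U" "y + a *\<^sub>R d + b *\<^sub>R h \<in> U"
    and "0 \<le> p" "p \<le> a" "0 \<le> q" "q \<le> b"
  shows "y + p *\<^sub>R d + q *\<^sub>R h \<in> U"
proof (rule convex_segment_mem[OF convex_U _ _ assms(7,8)])
  show "y + p *\<^sub>R d \<in> U" by (rule convex_segment_mem[OF convex_U assms(1,2,5,6)])
  have "(y + b *\<^sub>R h) + p *\<^sub>R d \<in> U"
    by (rule convex_segment_mem[OF convex_U assms(3) _ assms(5,6)]) (use assms(4) in \<open>simp add: ac_simps\<close>)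
  then show "y + p *\<^sub>R d + b *\<^sub>R h \<in> U" by (simp add: ac_simps)
qed

lemma g_line_integral:
  assumes "y \<in> U" "y + b *\<^sub>R h \<in> U" "0 \<le> b"
  shows "integral {0..b} (\<lambda>q. H (y + q *\<^sub>R h) h \<bullet> w) = (g (y + b *\<^sub>R h) - g y) \<bullet> w"
proof -
  have "((\<lambda>q. H (y + q *\<^sub>R h) h \<bullet> w) has_integral (g (y + b *\<^sub>R h) \<bullet> w - g (y + 0 *\<^sub>R h) \<bullet> w)) {0..b}"
    using assms convex_segment_mem[OF convex_U assms(1,2)]
    by (intro fundamental_theorem_of_calculus)
       (auto simp: has_real_derivative_iff_has_vector_derivative[symmetric] intro!: g_line_deriv)
  then show ?thesis by (simp add: integral_unique inner_diff_left)
qed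

lemma F_line_integral:
  assumes "y \<in> U" "y + b *\<^sub>R h \<in> U" "0 \<le> b"
  shows "integral {0..b} (\<lambda>q. g (y + q *\<^sub>R h) \<bullet> h) = F (y + b *\<^sub>R h) - F y"
proof -
  have "((\<lambda>q. g (y + q *\<^sub>R h) \<bullet> h) has_integral (F (y + b *\<^sub>R h) - F (y + 0 *\<^sub>R h))) {0..b}"
    using assms convex_segment_mem[OF convex_U assms(1,2)]
    by (intro fundamental_theorem_of_calculus)
       (auto simp: has_real_derivative_iff_has_vector_derivative[symmetric] intro!: F_line_deriv)
  then show ?thesis by (simp add: integral_unique)
qed

end

lemma abs_derivative_le_if_local_bound:
  fixes f :: "real \<Rightarrow> real"
  assumes D: "(f has_real_derivative D) (at 0)"
    and d: "\<delta> > 0" "\<And>\<tau>. 0 < \<tau> \<Longrightarrow> \<tau> < \<delta> \<Longrightarrow> \<bar>f \<tau> - f 0\<bar> \<le> B * \<tau>"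
  shows "\<bar>D\<bar> \<le> B"
proof (rule tendsto_upperbound)
  have "((\<lambda>\<tau>. (f (0 + \<tau>) - f 0) / \<tau>) \<longlongrightarrow> D) (at_right 0)"
    using D unfolding DERIV_def by (rule tendsto_mono[OF at_le, rotated]) auto
  then show "((\<lambda>\<tau>. \<bar>(f (0 + \<tau>) - f 0) / \<tau>\<bar>) \<longlongrightarrow> \<bar>D\<bar>) (at_right 0)" by (rule tendsto_rabs)
  show "eventually (\<lambda>\<tau>. \<bar>(f (0 + \<tau>) - f 0) / \<tau>\<bar> \<le> B) (at_right 0)"
    unfolding eventually_at_right_field using d
    by (intro exI[of _ \<delta>]) (auto simp: field_simps)
qed simp

lemma integral_linear_combination3:
  fixes f1 f2 f3 :: "'n::euclidean_space \<Rightarrow> real"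
  assumes "f1 integrable_on S" "f2 integrable_on S" "f3 integrable_on S"
  shows "integral S (\<lambda>x. a * f1 x + b * f2 x + c * f3 x) =
           a * integral S f1 + b * integral S f2 + c * integral S f3"
proof -
  have i: "(\<lambda>x. a * f1 x) integrable_on S" "(\<lambda>x. b * f2 x) integrable_on S" "(\<lambda>x. c * f3 x) integrable_on S"
    by (rule integrable_on_mult_right[OF assms(1)] integrable_on_mult_right[OF assms(2)] integrable_on_mult_right[OF assms(3)])+
  show ?thesis
    by (simp add: integral_add[OF integrable_add[OF i(1,2)] i(3)] integral_add[OF i(1,2)])
qed

context twice_differentiable
begin

lemma Hessian_rectangle_continuous:
  assumes "\<And>p q. p \<in> {0..a} \<Longrightarrow> q \<in> {0..b} \<Longrightarrow> y + p *\<^sub>R d + q *\<^sub>R h \<in> U"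
  shows "continuous_on ({0..a} \<times> {0..b}) (\<lambda>(p, q). H (y + p *\<^sub>R d + q *\<^sub>R h) u \<bullet> w)"
  unfolding split_beta using assms
  by (intro continuous_intros continuous_on_compose2[OF H_cont]) auto

lemma Hessian_quadratic_expand:
  assumes "x \<in> U" "v = \<alpha> *\<^sub>R d + \<beta> *\<^sub>R h"
  shows "H x v \<bullet> v = \<alpha>\<^sup>2 * (H x d \<bullet> d) + 2 * \<alpha> * \<beta> * (H x d \<bullet> h) + \<beta>\<^sup>2 * (H x h \<bullet> h)"
  using H_linear[OF assms(1)] H_symmetric[OF assms(1), of h d] unfolding assms(2)
  by (simp add: linear_add linear_cmul inner_add power2_eq_square algebra_simps)

text \<open>
  Carrying out one or both integrations leaves expressions in \<open>F\<close> and \<open>g\<close>, whose derivatives are known.  This is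
  why the left-hand side can be differentiated when the rectangle moves, although \<open>H\<close> is merely continuous.
\<close>

lemma rectangle_integral:
  assumes ab: "0 \<le> a" "0 \<le> b"
    and m: "\<And>p q. p \<in> {0..a} \<Longrightarrow> q \<in> {0..b} \<Longrightarrow> y + p *\<^sub>R d + q *\<^sub>R h \<in> U"
    and v: "v = \<alpha> *\<^sub>R d + \<beta> *\<^sub>R h"
  shows "integral {0..a} (\<lambda>p. integral {0..b} (\<lambda>q. H (y + p *\<^sub>R d + q *\<^sub>R h) v \<bullet> v)) =
     \<alpha>\<^sup>2 * (integral {0..b} (\<lambda>q. g (y + a *\<^sub>R d + q *\<^sub>R h) \<bullet> d) - integral {0..b} (\<lambda>q. g (y + q *\<^sub>R h) \<bullet> d))
     + 2 * \<alpha> * \<beta> * (F (y + a *\<^sub>R d + b *\<^sub>R h) - F (y + a *\<^sub>R d) - F (y + b *\<^sub>R h) + F y)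
     + \<beta>\<^sup>2 * (integral {0..a} (\<lambda>p. g (y + b *\<^sub>R h + p *\<^sub>R d) \<bullet> h) - integral {0..a} (\<lambda>p. g (y + p *\<^sub>R d) \<bullet> h))"
proof -
  have m0: "y + p *\<^sub>R d \<in> U" "y + q *\<^sub>R h \<in> U" if "p \<in> {0..a}" "q \<in> {0..b}" for p q
    using m[of p 0] m[of 0 q] that ab by auto
  let ?r = "\<lambda>p q. y + p *\<^sub>R d + q *\<^sub>R h"
  have c: "continuous_on ({0..a} \<times> {0..b}) (\<lambda>(p, q). H (?r p q) u \<bullet> w)" for u w
    by (rule Hessian_rectangle_continuous[OF m])
  have ci: "continuous_on {0..b} (\<lambda>q. H (?r p q) u \<bullet> w)" if "p \<in> {0..a}" for p u w
    using m that by (intro continuous_intros continuous_on_compose2[OF H_cont]) auto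
  have co: "continuous_on {0..a} (\<lambda>p. integral {0..b} (\<lambda>q. H (?r p q) u \<bullet> w))" for u w
    using integral_continuous_on_param[of "{0..a}" 0 b "\<lambda>p q. H (?r p q) u \<bullet> w"] c by simp
  note int = integrable_continuous_real[OF ci] integrable_continuous_real[OF co]
  have swap: "integral {0..a} (\<lambda>p. integral {0..b} (\<lambda>q. H (?r p q) d \<bullet> d)) =
              integral {0..b} (\<lambda>q. integral {0..a} (\<lambda>p. H (?r p q) d \<bullet> d))"
    using integral_swap_continuous[of 0 0 a b "\<lambda>p q. H (?r p q) d \<bullet> d"] c[of d d]
    by (simp add: cbox_Pair_eq)
  have gc: "continuous_on {0..b} (\<lambda>q. g (y + a *\<^sub>R d + q *\<^sub>R h) \<bullet> w)" "continuous_on {0..b} (\<lambda>q. g (y + q *\<^sub>R h) \<bullet> w)"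
     "continuous_on {0..a} (\<lambda>p. g (y + b *\<^sub>R h + p *\<^sub>R d) \<bullet> w)" "continuous_on {0..a} (\<lambda>p. g (y + p *\<^sub>R d) \<bullet> w)" for w
    using m[of a] m[of _ b] m0(1)[where q = 0] m0(2)[where p = 0] ab
    by (auto intro!: continuous_intros continuous_on_compose2[OF g_cont] simp: add.assoc add.commute[of "b *\<^sub>R h"])
  note gi = gc[THEN integrable_continuous_real]
  have dd: "integral {0..b} (\<lambda>q. integral {0..a} (\<lambda>p. H (?r p q) d \<bullet> d)) =
     integral {0..b} (\<lambda>q. g (y + a *\<^sub>R d + q *\<^sub>R h) \<bullet> d) - integral {0..b} (\<lambda>q. g (y + q *\<^sub>R h) \<bullet> d)"
  proof -
    have "integral {0..b} (\<lambda>q. integral {0..a} (\<lambda>p. H (?r p q) d \<bullet> d)) =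
      integral {0..b} (\<lambda>q. g (y + a *\<^sub>R d + q *\<^sub>R h) \<bullet> d - g (y + q *\<^sub>R h) \<bullet> d)"
    proof (rule integral_cong)
      fix q assume q: "q \<in> {0..b}"
      have "integral {0..a} (\<lambda>p. H ((y + q *\<^sub>R h) + p *\<^sub>R d) d \<bullet> d) = (g ((y + q *\<^sub>R h) + a *\<^sub>R d) - g (y + q *\<^sub>R h)) \<bullet> d"
        using m[of a q] m0[of 0 q] q ab by (intro g_line_integral) (auto simp: ac_simps)
      then show "integral {0..a} (\<lambda>p. H (?r p q) d \<bullet> d) = g (y + a *\<^sub>R d + q *\<^sub>R h) \<bullet> d - g (y + q *\<^sub>R h) \<bullet> d"
        by (simp add: ac_simps inner_diff_left)
    qed
    also have "\<dots> = integral {0..b} (\<lambda>q. g (y + a *\<^sub>R d + q *\<^sub>R h) \<bullet> d) - integral {0..b} (\<lambda>q. g (y + q *\<^sub>R h) \<bullet> d)"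
      by (rule integral_diff[OF gi(1,2)])
    finally show ?thesis .
  qed
  have inner: "integral {0..b} (\<lambda>q. H (?r p q) h \<bullet> w) = g (y + b *\<^sub>R h + p *\<^sub>R d) \<bullet> w - g (y + p *\<^sub>R d) \<bullet> w"
    if p: "p \<in> {0..a}" for p w
  proof -
    have "integral {0..b} (\<lambda>q. H ((y + p *\<^sub>R d) + q *\<^sub>R h) h \<bullet> w) = (g ((y + p *\<^sub>R d) + b *\<^sub>R h) - g (y + p *\<^sub>R d)) \<bullet> w"
      using m[of p b] m0[of p 0] p ab by (intro g_line_integral) auto
    then show ?thesis by (simp add: ac_simps inner_diff_left)
  qed
  have hh: "integral {0..a} (\<lambda>p. integral {0..b} (\<lambda>q. H (?r p q) h \<bullet> w)) =
     integral {0..a} (\<lambda>p. g (y + b *\<^sub>R h + p *\<^sub>R d) \<bullet> w) - integral {0..a} (\<lambda>p. g (y + p *\<^sub>R d) \<bullet> w)" for w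
  proof -
    have "integral {0..a} (\<lambda>p. integral {0..b} (\<lambda>q. H (?r p q) h \<bullet> w)) =
      integral {0..a} (\<lambda>p. g (y + b *\<^sub>R h + p *\<^sub>R d) \<bullet> w - g (y + p *\<^sub>R d) \<bullet> w)"
      by (rule integral_cong) (rule inner)
    also have "\<dots> = integral {0..a} (\<lambda>p. g (y + b *\<^sub>R h + p *\<^sub>R d) \<bullet> w) - integral {0..a} (\<lambda>p. g (y + p *\<^sub>R d) \<bullet> w)"
      by (rule integral_diff[OF gi(3,4)])
    finally show ?thesis .
  qed
  have dh: "integral {0..a} (\<lambda>p. integral {0..b} (\<lambda>q. H (?r p q) d \<bullet> h)) =
     F (y + a *\<^sub>R d + b *\<^sub>R h) - F (y + a *\<^sub>R d) - F (y + b *\<^sub>R h) + F y"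
  proof -
    have "integral {0..a} (\<lambda>p. integral {0..b} (\<lambda>q. H (?r p q) d \<bullet> h)) =
          integral {0..a} (\<lambda>p. integral {0..b} (\<lambda>q. H (?r p q) h \<bullet> d))"
      by (intro integral_cong H_symmetric m)
    also have "\<dots> = (F ((y + b *\<^sub>R h) + a *\<^sub>R d) - F (y + b *\<^sub>R h)) - (F (y + a *\<^sub>R d) - F y)"
      unfolding hh using m[of a b] m0[of a b] m0[of 0 b] m0[of 0 0] ab
      by (subst (1 2) F_line_integral) (auto simp: ac_simps)
    finally show ?thesis by (simp add: ac_simps)
  qed
  have "integral {0..a} (\<lambda>p. integral {0..b} (\<lambda>q. H (?r p q) v \<bullet> v)) =
        integral {0..a} (\<lambda>p. \<alpha>\<^sup>2 * integral {0..b} (\<lambda>q. H (?r p q) d \<bullet> d)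
          + 2 * \<alpha> * \<beta> * integral {0..b} (\<lambda>q. H (?r p q) d \<bullet> h) + \<beta>\<^sup>2 * integral {0..b} (\<lambda>q. H (?r p q) h \<bullet> h))"
  proof (rule integral_cong)
    fix p assume p: "p \<in> {0..a}"
    have "integral {0..b} (\<lambda>q. H (?r p q) v \<bullet> v) = integral {0..b} (\<lambda>q. \<alpha>\<^sup>2 * (H (?r p q) d \<bullet> d)
          + 2 * \<alpha> * \<beta> * (H (?r p q) d \<bullet> h) + \<beta>\<^sup>2 * (H (?r p q) h \<bullet> h))"
      by (intro integral_cong Hessian_quadratic_expand m p v)
    also have "\<dots> = \<alpha>\<^sup>2 * integral {0..b} (\<lambda>q. H (?r p q) d \<bullet> d)
          + 2 * \<alpha> * \<beta> * integral {0..b} (\<lambda>q. H (?r p q) d \<bullet> h) + \<beta>\<^sup>2 * integral {0..b} (\<lambda>q. H (?r p q) h \<bullet> h)"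
      by (intro integral_linear_combination3 int(1) p)
    finally show "integral {0..b} (\<lambda>q. H (?r p q) v \<bullet> v) = \<dots>" .
  qed
  also have "\<dots> = \<alpha>\<^sup>2 * integral {0..a} (\<lambda>p. integral {0..b} (\<lambda>q. H (?r p q) d \<bullet> d))
          + 2 * \<alpha> * \<beta> * integral {0..a} (\<lambda>p. integral {0..b} (\<lambda>q. H (?r p q) d \<bullet> h))
          + \<beta>\<^sup>2 * integral {0..a} (\<lambda>p. integral {0..b} (\<lambda>q. H (?r p q) h \<bullet> h))"
    by (intro integral_linear_combination3 int(2))
  finally show ?thesis unfolding swap dd dh hh .
qed

text \<open>
  The cubic is the derivative at \<open>\<tau> = 0\<close> of the integral of \<open>H v \<bullet> v\<close> over the rectangle translated by \<open>\<tau> v\<close>, where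
  \<open>v = \<alpha> d + \<beta> h\<close>.  Its mixed coefficients are pairings with the exact second difference \<open>\<Delta>\<close> of \<open>g\<close>.  The bound
  holds because \<open>H v \<bullet> v\<close> is Lipschitz in direction \<open>v\<close> with constant \<open>M v\<close> throughout \<open>U\<close>.
\<close>

lemma third_difference_cubic_bound:
  assumes ab: "0 < a" "0 < b"
    and corners: "y \<in> U" "y + a *\<^sub>R d \<in> U" "y + b *\<^sub>R h \<in> U" "y + a *\<^sub>R d + b *\<^sub>R h \<in> U"
    and M: "\<And>v x \<tau>. x \<in> U \<Longrightarrow> x + \<tau> *\<^sub>R v \<in> U \<Longrightarrow> \<tau> > 0 \<Longrightarrow>
                \<bar>H (x + \<tau> *\<^sub>R v) v \<bullet> v - H x v \<bullet> v\<bar> \<le> M v * \<tau>"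
  defines "\<Delta> \<equiv> g (y + a *\<^sub>R d + b *\<^sub>R h) - g (y + a *\<^sub>R d) - g (y + b *\<^sub>R h) + g y"
  shows "\<exists>T1 T4. \<forall>\<alpha> \<beta>. \<bar>\<alpha>^3 * T1 + 3 * \<alpha>\<^sup>2 * \<beta> * (\<Delta> \<bullet> d) + 3 * \<alpha> * \<beta>\<^sup>2 * (\<Delta> \<bullet> h) + \<beta>^3 * T4\<bar>
            \<le> a * b * M (\<alpha> *\<^sub>R d + \<beta> *\<^sub>R h)"
proof -
  define T1 where "T1 = integral {0..b} (\<lambda>q. H (y + a *\<^sub>R d + q *\<^sub>R h) d \<bullet> d) - integral {0..b} (\<lambda>q. H (y + q *\<^sub>R h) d \<bullet> d)"
  define T4 where "T4 = integral {0..a} (\<lambda>p. H (y + b *\<^sub>R h + p *\<^sub>R d) h \<bullet> h) - integral {0..a} (\<lambda>p. H (y + p *\<^sub>R d) h \<bullet> h)"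
  have corner4: "y + b *\<^sub>R h + a *\<^sub>R d \<in> U" using corners(4) by (simp add: ac_simps)
  have "\<bar>\<alpha>^3 * T1 + 3 * \<alpha>\<^sup>2 * \<beta> * (\<Delta> \<bullet> d) + 3 * \<alpha> * \<beta>\<^sup>2 * (\<Delta> \<bullet> h) + \<beta>^3 * T4\<bar>
            \<le> a * b * M (\<alpha> *\<^sub>R d + \<beta> *\<^sub>R h)" for \<alpha> \<beta>
  proof -
    define v where "v = \<alpha> *\<^sub>R d + \<beta> *\<^sub>R h"
    define \<Omega> where "\<Omega> \<tau> = 
     \<alpha>\<^sup>2 * (integral {0..b} (\<lambda>q. g (y + a *\<^sub>R d + \<tau> *\<^sub>R v + q *\<^sub>R h) \<bullet> d) - integral {0..b} (\<lambda>q. g (y + \<tau> *\<^sub>R v + q *\<^sub>R h) \<bullet> d))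
     + 2 * \<alpha> * \<beta> * (F (y + a *\<^sub>R d + b *\<^sub>R h + \<tau> *\<^sub>R v) - F (y + a *\<^sub>R d + \<tau> *\<^sub>R v) - F (y + b *\<^sub>R h + \<tau> *\<^sub>R v) + F (y + \<tau> *\<^sub>R v))
     + \<beta>\<^sup>2 * (integral {0..a} (\<lambda>p. g (y + b *\<^sub>R h + \<tau> *\<^sub>R v + p *\<^sub>R d) \<bullet> h) - integral {0..a} (\<lambda>p. g (y + \<tau> *\<^sub>R v + p *\<^sub>R d) \<bullet> h))" for \<tau>
    obtain d1 where d1: "d1 > 0" "\<And>\<tau>. \<bar>\<tau>\<bar> \<le> d1 \<Longrightarrow> y + \<tau> *\<^sub>R v \<in> U"
      using open_line_neighbourhood[OF open_U corners(1)] by blast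
    obtain d2 where d2: "d2 > 0" "\<And>\<tau>. \<bar>\<tau>\<bar> \<le> d2 \<Longrightarrow> y + a *\<^sub>R d + \<tau> *\<^sub>R v \<in> U"
      using open_line_neighbourhood[OF open_U corners(2)] by blast
    obtain d3 where d3: "d3 > 0" "\<And>\<tau>. \<bar>\<tau>\<bar> \<le> d3 \<Longrightarrow> y + b *\<^sub>R h + \<tau> *\<^sub>R v \<in> U"
      using open_line_neighbourhood[OF open_U corners(3)] by blast
    obtain d4 where d4: "d4 > 0" "\<And>\<tau>. \<bar>\<tau>\<bar> \<le> d4 \<Longrightarrow> y + a *\<^sub>R d + b *\<^sub>R h + \<tau> *\<^sub>R v \<in> U"
      using open_line_neighbourhood[OF open_U corners(4)] by blast
    define \<delta> where "\<delta> = min (min d1 d2) (min d3 d4)"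
    have \<delta>: "\<delta> > 0" using d1 d2 d3 d4 by (simp add: \<delta>_def)
    have mem: "y + \<tau> *\<^sub>R v + p *\<^sub>R d + q *\<^sub>R h \<in> U" if "\<bar>\<tau>\<bar> \<le> \<delta>" "p \<in> {0..a}" "q \<in> {0..b}" for \<tau> p q
      by (rule rectangle_mem[where a = a and b = b])
         (use that d1(2)[of \<tau>] d2(2)[of \<tau>] d3(2)[of \<tau>] d4(2)[of \<tau>] in \<open>auto simp: \<delta>_def ac_simps\<close>)
    have \<Omega>: "\<Omega> \<tau> = integral {0..a} (\<lambda>p. integral {0..b} (\<lambda>q. H (y + \<tau> *\<^sub>R v + p *\<^sub>R d + q *\<^sub>R h) v \<bullet> v))"
      if "\<bar>\<tau>\<bar> \<le> \<delta>" for \<tau>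
      unfolding \<Omega>_def using ab mem[OF that] by (subst rectangle_integral[OF _ _ _ v_def]) (auto simp: ac_simps)
    have "\<bar>\<Omega> \<tau> - \<Omega> 0\<bar> \<le> (a * b * M v) * \<tau>" if \<tau>: "0 < \<tau>" "\<tau> < \<delta>" for \<tau>
    proof -
      let ?r = "\<lambda>\<tau> p q. y + \<tau> *\<^sub>R v + p *\<^sub>R d + q *\<^sub>R h"
      have c: "continuous_on ({0..a} \<times> {0..b}) (\<lambda>(p, q). H (?r \<tau> p q) v \<bullet> v)" if "\<bar>\<tau>\<bar> \<le> \<delta>" for \<tau>
        using Hessian_rectangle_continuous[of a b "y + \<tau> *\<^sub>R v"] mem[OF that] by blast
      have ci: "continuous_on {0..b} (\<lambda>q. H (?r \<tau> p q) v \<bullet> v)" if "\<bar>\<tau>\<bar> \<le> \<delta>" "p \<in> {0..a}" for p \<tau>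
        using mem that by (intro continuous_intros continuous_on_compose2[OF H_cont]) auto
      have co: "continuous_on {0..a} (\<lambda>p. integral {0..b} (\<lambda>q. H (?r \<tau> p q) v \<bullet> v))" if "\<bar>\<tau>\<bar> \<le> \<delta>" for \<tau>
        using integral_continuous_on_param[of "{0..a}" 0 b "\<lambda>p q. H (?r \<tau> p q) v \<bullet> v"] c[OF that] by simp
      have t: "\<bar>\<tau>\<bar> \<le> \<delta>" "\<bar>0::real\<bar> \<le> \<delta>" using \<tau> by auto
      have in_bd: "\<bar>integral {0..b} (\<lambda>q. H (?r \<tau> p q) v \<bullet> v) - integral {0..b} (\<lambda>q. H (?r 0 p q) v \<bullet> v)\<bar>
                \<le> M v * \<tau> * (b - 0)" if p: "p \<in> {0..a}" for p
      proof -
        have "integral {0..b} (\<lambda>q. H (?r \<tau> p q) v \<bullet> v) - integral {0..b} (\<lambda>q. H (?r 0 p q) v \<bullet> v)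
           = integral {0..b} (\<lambda>q. H (?r \<tau> p q) v \<bullet> v - H (?r 0 p q) v \<bullet> v)"
          using t p by (intro integral_diff[symmetric] integrable_continuous_real ci) auto
        moreover have "norm (integral {0..b} (\<lambda>q. H (?r \<tau> p q) v \<bullet> v - H (?r 0 p q) v \<bullet> v)) \<le> M v * \<tau> * (b - 0)"
        proof (rule integral_bound)
          fix q assume q: "q \<in> {0..b}"
          have "?r 0 p q + \<tau> *\<^sub>R v = ?r \<tau> p q" by (simp add: ac_simps)
          from M[of "?r 0 p q" \<tau> v, unfolded this] mem[OF t(1) p q] mem[OF t(2) p q] \<tau>
          show "norm (H (?r \<tau> p q) v \<bullet> v - H (?r 0 p q) v \<bullet> v) \<le> M v * \<tau>" by simp
        qed (use ab in \<open>simp_all add: continuous_on_diff ci[OF t(1) p] ci[OF t(2) p, simplified]\<close>)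
        ultimately show ?thesis by simp
      qed
      have "\<Omega> \<tau> - \<Omega> 0 = integral {0..a} (\<lambda>p. integral {0..b} (\<lambda>q. H (?r \<tau> p q) v \<bullet> v) - integral {0..b} (\<lambda>q. H (?r 0 p q) v \<bullet> v))"
        unfolding \<Omega>[OF t(1)] \<Omega>[OF t(2)]
        using t by (intro integral_diff[symmetric] integrable_continuous_real co) auto
      moreover have "norm (integral {0..a} (\<lambda>p. integral {0..b} (\<lambda>q. H (?r \<tau> p q) v \<bullet> v) - integral {0..b} (\<lambda>q. H (?r 0 p q) v \<bullet> v))) \<le> M v * \<tau> * (b - 0) * (a - 0)"
        using ab in_bd t by (intro integral_bound continuous_on_diff co) auto
      ultimately show ?thesis by (simp add: mult_ac)
    qed
    moreover have "(\<Omega> has_real_derivative (\<alpha>^3 * T1 + 3 * \<alpha>\<^sup>2 * \<beta> * (\<Delta> \<bullet> d) + 3 * \<alpha> * \<beta>\<^sup>2 * (\<Delta> \<bullet> h) + \<beta>^3 * T4)) (at 0)"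
    proof -
      have Hv: "H x v \<bullet> w = \<alpha> * (H x d \<bullet> w) + \<beta> * (H x h \<bullet> w)" if "x \<in> U" for x w
        using H_linear[OF that] by (simp add: v_def linear_add linear_cmul inner_add)
      have seg: "((\<lambda>\<tau>. integral {0..c} (\<lambda>q. g (x + \<tau> *\<^sub>R v + q *\<^sub>R l) \<bullet> w)) has_real_derivative
           \<alpha> * integral {0..c} (\<lambda>q. H (x + q *\<^sub>R l) d \<bullet> w) + \<beta> * integral {0..c} (\<lambda>q. H (x + q *\<^sub>R l) h \<bullet> w)) (at 0)"
        if "x \<in> U" "x + c *\<^sub>R l \<in> U" "0 \<le> c" for x l w c
      proof -
        have mm: "x + q *\<^sub>R l \<in> U" if "q \<in> {0..c}" for q
          using convex_segment_mem[OF convex_U \<open>x \<in> U\<close> \<open>x + c *\<^sub>R l \<in> U\<close>] that by auto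
        have "((\<lambda>\<tau>. integral {0..c} (\<lambda>q. g (x + \<tau> *\<^sub>R v + q *\<^sub>R l) \<bullet> w)) has_real_derivative
           integral {0..c} (\<lambda>q. H (x + q *\<^sub>R l) v \<bullet> w)) (at 0)"
          by (rule segment_integral_has_derivative[OF open_U convex_U g_inner_deriv _ that(1,2)])
             (auto intro!: continuous_intros H_cont)
        also have "integral {0..c} (\<lambda>q. H (x + q *\<^sub>R l) v \<bullet> w) =
            integral {0..c} (\<lambda>q. \<alpha> * (H (x + q *\<^sub>R l) d \<bullet> w) + \<beta> * (H (x + q *\<^sub>R l) h \<bullet> w))"
          by (intro integral_cong Hv mm)
        also have "\<dots> = \<alpha> * integral {0..c} (\<lambda>q. H (x + q *\<^sub>R l) d \<bullet> w) + \<beta> * integral {0..c} (\<lambda>q. H (x + q *\<^sub>R l) h \<bullet> w)"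
        proof -
          have "continuous_on {0..c} (\<lambda>q. H (x + q *\<^sub>R l) u \<bullet> w)" for u
            using mm by (intro continuous_intros continuous_on_compose2[OF H_cont]) auto
          note i = this[THEN integrable_continuous_real]
          show ?thesis by (subst integral_add) (auto intro!: integrable_on_mult_right i)
        qed
        finally show ?thesis .
      qed
      have Fd: "((\<lambda>\<tau>. F (x + \<tau> *\<^sub>R v)) has_real_derivative \<alpha> * (g x \<bullet> d) + \<beta> * (g x \<bullet> h)) (at 0)" if "x \<in> U" for x
        using F_line_deriv[of x 0 v UNIV] that by (simp add: v_def inner_add)
      have sym: "integral {0..a} (\<lambda>p. H (x + p *\<^sub>R d) d \<bullet> h) = (g (x + a *\<^sub>R d) - g x) \<bullet> h"
        "integral {0..b} (\<lambda>q. H (x' + q *\<^sub>R h) h \<bullet> d) = (g (x' + b *\<^sub>R h) - g x') \<bullet> d"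
        if "x \<in> U" "x + a *\<^sub>R d \<in> U" "x' \<in> U" "x' + b *\<^sub>R h \<in> U" for x x'
        using g_line_integral[OF that(1,2)] g_line_integral[OF that(3,4)] ab by auto
      show ?thesis unfolding \<Omega>_def
        using ab corners corner4
        by (auto intro!: derivative_eq_intros seg Fd simp: sym T1_def T4_def \<Delta>_def)
           (simp add: algebra_simps inner_diff_left inner_add_left power2_eq_square power3_eq_cube)
    qed
    ultimately show ?thesis
      using abs_derivative_le_if_local_bound[of \<Omega>, OF _ \<delta>] by (simp add: v_def)
  qed
  then show ?thesis by blast
qed

text \<open>
  If \<open>H v \<bullet> v\<close> is Lipschitz along \<open>v\<close> with constant \<open>L \<parallel>v\<parallel>^3\<close> for all \<open>v\<close>, the same constant controls the variation of
  \<open>H h \<bullet> h\<close> along another direction \<open>d\<close>.  For independent unit vectors, \<open>mixed_cubic_bound\<close> applied to the cubic of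
  the rectangle with sides \<open>s d\<close> and \<open>b h\<close> bounds a second difference of \<open>g\<close> by \<open>s b L\<close>; dividing by \<open>b \<rightarrow> 0\<close> gives
  the claim.  Parallel vectors are covered by the hypothesis itself.
\<close>

lemma mixed_Hessian_Lipschitz:
  assumes K: "positive_operator K"
    and L: "\<And>v x \<tau>. x \<in> U \<Longrightarrow> x + \<tau> *\<^sub>R v \<in> U \<Longrightarrow> \<tau> > 0 \<Longrightarrow>
              \<bar>H (x + \<tau> *\<^sub>R v) v \<bullet> v - H x v \<bullet> v\<bar> \<le> L * (positive_operator.nrm K v) ^ 3 * \<tau>"
    and x: "x \<in> U" "x + s *\<^sub>R d \<in> U" and s: "0 \<le> s"
  shows "\<bar>H (x + s *\<^sub>R d) h \<bullet> h - H x h \<bullet> h\<bar> \<le> L * s * positive_operator.nrm K d * (positive_operator.nrm K h)\<^sup>2"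
proof -
  interpret K: positive_operator K by (rule K)
  have unit: "\<bar>H (x + s *\<^sub>R d) h \<bullet> h - H x h \<bullet> h\<bar> \<le> L * s"
    if s: "s > 0" and xs: "x + s *\<^sub>R d \<in> U" and d: "K.nrm d = 1" and h: "K.nrm h = 1" for s d h
  proof -
    have dd: "K d \<bullet> d = 1" "K h \<bullet> h = 1" using K.nrm_sq[of d] K.nrm_sq[of h] d h by auto
    have "\<bar>K d \<bullet> h\<bar> \<le> 1" using K.Cauchy_Schwarz[of d h] d h by simp
    then consider "\<bar>K d \<bullet> h\<bar> < 1" | "K d \<bullet> h = 1" | "K d \<bullet> h = -1" by linarith
    then show ?thesis
    proof cases
      case 1
      define \<theta> where "\<theta> = arccos (K d \<bullet> h) / 3"
      have cs: "cos (3 * \<theta>) = K d \<bullet> h" using 1 by (simp add: \<theta>_def abs_le_iff)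
      have "(sin (3 * \<theta>))\<^sup>2 = 1 - (K d \<bullet> h)\<^sup>2" unfolding sin_squared_eq cs ..
      then have sn: "sin (3 * \<theta>) \<noteq> 0" using 1 by (auto simp: abs_square_eq_1 abs_if split: if_splits)
      obtain e1 where e1: "e1 > 0" "\<And>\<tau>. \<bar>\<tau>\<bar> \<le> e1 \<Longrightarrow> x + \<tau> *\<^sub>R h \<in> U"
        using open_line_neighbourhood[OF open_U x(1)] by blast
      obtain e2 where e2: "e2 > 0" "\<And>\<tau>. \<bar>\<tau>\<bar> \<le> e2 \<Longrightarrow> x + s *\<^sub>R d + \<tau> *\<^sub>R h \<in> U"
        using open_line_neighbourhood[OF open_U xs] by blast
      define f where "f \<tau> = g (x + s *\<^sub>R d + \<tau> *\<^sub>R h) \<bullet> h - g (x + \<tau> *\<^sub>R h) \<bullet> h" for \<tau>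
      have "(f has_real_derivative (H (x + s *\<^sub>R d + 0 *\<^sub>R h) h \<bullet> h - H (x + 0 *\<^sub>R h) h \<bullet> h)) (at 0)"
        unfolding f_def using x xs by (intro DERIV_diff g_line_deriv) auto
      moreover have "\<bar>f b - f 0\<bar> \<le> (L * s) * b" if b: "0 < b" "b < min e1 e2" for b
      proof -
        define \<Delta> where "\<Delta> = g (x + s *\<^sub>R d + b *\<^sub>R h) - g (x + s *\<^sub>R d) - g (x + b *\<^sub>R h) + g x"
        obtain T1 T4 where T: "\<And>\<alpha> \<beta>. \<bar>\<alpha>^3 * T1 + 3 * \<alpha>\<^sup>2 * \<beta> * (\<Delta> \<bullet> d) + 3 * \<alpha> * \<beta>\<^sup>2 * (\<Delta> \<bullet> h) + \<beta>^3 * T4\<bar>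
            \<le> s * b * (L * (K.nrm (\<alpha> *\<^sub>R d + \<beta> *\<^sub>R h))^3)"
          using third_difference_cubic_bound[OF s b(1) x(1) xs _ _ L, of h] e1(2)[of b] e2(2)[of b] b
          unfolding \<Delta>_def by auto
        have "\<bar>\<Delta> \<bullet> h\<bar> \<le> s * b * L"
        proof (rule mixed_cubic_bound[OF sn])
          fix \<alpha> \<beta> :: real assume "\<alpha>\<^sup>2 + \<beta>\<^sup>2 + 2 * \<alpha> * \<beta> * cos (3 * \<theta>) = 1"
          then have "(K.nrm (\<alpha> *\<^sub>R d + \<beta> *\<^sub>R h))\<^sup>2 = 1"
            using dd K.sym[of h d] unfolding K.nrm_sq cs
            by (simp add: K.K_simps inner_add power2_eq_square algebra_simps)
          then have "K.nrm (\<alpha> *\<^sub>R d + \<beta> *\<^sub>R h) = 1"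
            using K.nrm_nonneg[of "\<alpha> *\<^sub>R d + \<beta> *\<^sub>R h"] by (simp add: power2_eq_1_iff)
          with T[of \<alpha> \<beta>]
          show "\<bar>\<alpha>^3 * T1 + 3 * \<alpha>\<^sup>2 * \<beta> * (\<Delta> \<bullet> d) + 3 * \<alpha> * \<beta>\<^sup>2 * (\<Delta> \<bullet> h) + \<beta>^3 * T4\<bar> \<le> s * b * L" by simp
        qed
        moreover have "f b - f 0 = \<Delta> \<bullet> h" by (simp add: f_def \<Delta>_def inner_diff_left inner_add_left)
        ultimately show ?thesis by (simp add: mult_ac)
      qed
      ultimately show ?thesis
        using abs_derivative_le_if_local_bound[of f _ "min e1 e2" "L * s"] e1 e2 by simp
    next
      case 2
      have "K (d - h) \<bullet> (d - h) = 0" using 2 dd K.sym[of h d] by (simp add: K.K_simps inner_diff)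
      then have "d = h" using K.pos[of "d - h"] by force
      then show ?thesis using L[OF x(1) xs s] h by simp
    next
      case 3
      have "K (d + h) \<bullet> (d + h) = 0" using 3 dd K.sym[of h d] by (simp add: K.K_simps inner_add)
      then have "d = - h" using K.pos[of "d + h"] by (metis add_eq_0_iff less_irrefl minus_minus)
      then show ?thesis using L[OF x(1) xs s] h linear_neg[OF H_linear[OF x(1)], of h] linear_neg[OF H_linear[OF xs], of h]
        by (simp add: K.nrm_minus)
    qed
  qed
  show ?thesis
  proof (cases "s = 0 \<or> d = 0 \<or> h = 0")
    case True
    then show ?thesis using linear_0[OF H_linear[OF x(1)]] linear_0[OF H_linear[OF x(2)]]
      by (auto simp: K.nrm_def K.K_simps)
  next
    case False
    then have n: "0 < K.nrm d" "0 < K.nrm h" "0 < s" using s by (auto intro: K.nrm_pos)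
    let ?d = "(1 / K.nrm d) *\<^sub>R d" and ?h = "(1 / K.nrm h) *\<^sub>R h"
    have "\<bar>H (x + (s * K.nrm d) *\<^sub>R ?d) ?h \<bullet> ?h - H x ?h \<bullet> ?h\<bar> \<le> L * (s * K.nrm d)"
      using n x by (intro unit) (auto simp: K.nrm_scale)
    also have "(s * K.nrm d) *\<^sub>R ?d = s *\<^sub>R d" using n by simp
    also have "\<bar>H (x + s *\<^sub>R d) ?h \<bullet> ?h - H x ?h \<bullet> ?h\<bar> = \<bar>H (x + s *\<^sub>R d) h \<bullet> h - H x h \<bullet> h\<bar> / (K.nrm h)\<^sup>2"
    proof -
      have "H (x + s *\<^sub>R d) ?h \<bullet> ?h - H x ?h \<bullet> ?h = (H (x + s *\<^sub>R d) h \<bullet> h - H x h \<bullet> h) / (K.nrm h)\<^sup>2"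
        using n by (simp add: linear_cmul[OF H_linear[OF x(1)]] linear_cmul[OF H_linear[OF x(2)]] field_simps power2_eq_square)
      then show ?thesis by (simp add: abs_divide)
    qed
    finally show ?thesis using n by (simp add: field_simps)
  qed
qed

end

section \<open>Self-concordant functions\<close>

locale self_concordant = twice_differentiable +
  assumes pos_def: "\<And>x u. x \<in> U \<Longrightarrow> u \<noteq> 0 \<Longrightarrow> 0 < H x u \<bullet> u"
    and third: "\<And>x v. x \<in> U \<Longrightarrow> \<exists>D. ((\<lambda>\<tau>. H (x + \<tau> *\<^sub>R v) v \<bullet> v) has_real_derivative D) (at 0)
                    \<and> \<bar>D\<bar> \<le> 2 * (H x v \<bullet> v) powr (3 / 2)"
begin

lemma positive_operator_H: "x \<in> U \<Longrightarrow> positive_operator (H x)"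
  by (intro positive_operator.intro H_linear H_symmetric pos_def)

text \<open>
  The primal and the dual local norm at the point \<open>x\<close>.
\<close>

definition N where "N x u = positive_operator.nrm (H x) u"
definition Nd where "Nd x v = positive_operator.dnrm (H x) v"

lemma N_eq: "x \<in> U \<Longrightarrow> N x u = sqrt (H x u \<bullet> u)"
  unfolding N_def by (rule positive_operator.nrm_def[OF positive_operator_H])

lemma powr_three_halves: "0 \<le> q \<Longrightarrow> q powr (3 / 2) = sqrt q ^ 3" for q :: real
proof (cases "q = 0")
  case False
  assume "0 \<le> q"
  then have "q powr (3/2) = q powr (1 + 1/2)" by simp
  also have "\<dots> = q * sqrt q" using False \<open>0 \<le> q\<close> by (subst powr_add) (simp add: powr_half_sqrt)
  also have "\<dots> = sqrt q ^ 3" using \<open>0 \<le> q\<close> by (simp add: power3_eq_cube)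
  finally show ?thesis .
qed simp

lemma third_at:
  assumes "x + \<tau> *\<^sub>R v \<in> U"
  obtains D where "((\<lambda>\<tau>. H (x + \<tau> *\<^sub>R v) v \<bullet> v) has_real_derivative D) (at \<tau>)"
    "\<bar>D\<bar> \<le> 2 * N (x + \<tau> *\<^sub>R v) v ^ 3"
proof -
  obtain D where D: "((\<lambda>s. H (x + \<tau> *\<^sub>R v + s *\<^sub>R v) v \<bullet> v) has_real_derivative D) (at 0)"
    "\<bar>D\<bar> \<le> 2 * (H (x + \<tau> *\<^sub>R v) v \<bullet> v) powr (3 / 2)"
    using third[OF assms] by blast
  have "((\<lambda>s. H (x + (\<tau> + s) *\<^sub>R v) v \<bullet> v) has_real_derivative D) (at 0)"
    using D(1) by (simp add: scaleR_add_left add.assoc)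
  then have "((\<lambda>\<tau>. H (x + \<tau> *\<^sub>R v) v \<bullet> v) has_real_derivative D) (at \<tau>)"
    using DERIV_shift[of "\<lambda>\<tau>. H (x + \<tau> *\<^sub>R v) v \<bullet> v" D 0 \<tau>] by (simp add: add.commute)
  moreover have "\<bar>D\<bar> \<le> 2 * N (x + \<tau> *\<^sub>R v) v ^ 3"
    using D(2) N_eq[OF assms, of v] positive_operator.nonneg[OF positive_operator_H[OF assms], of v]
    by (simp add: powr_three_halves)
  ultimately show ?thesis by (rule that)
qed

text \<open>
  This is the form in which \<open>\<bar>\<phi>'''\<bar> \<le> 2 \<phi>''^(3/2)\<close> enters, with \<open>\<phi> \<tau> = F (x + \<tau> v)\<close>: along a line, \<open>\<phi>''^(-1/2)\<close> has slope at most one.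
\<close>

lemma inverse_N_deriv:
  assumes x: "x + \<tau> *\<^sub>R v \<in> U" and v: "v \<noteq> 0"
  shows "\<exists>D. ((\<lambda>\<tau>. 1 / N (x + \<tau> *\<^sub>R v) v) has_real_derivative D) (at \<tau>) \<and> \<bar>D\<bar> \<le> 1"
proof -
  obtain D where D: "((\<lambda>\<tau>. H (x + \<tau> *\<^sub>R v) v \<bullet> v) has_real_derivative D) (at \<tau>)"
    "\<bar>D\<bar> \<le> 2 * N (x + \<tau> *\<^sub>R v) v ^ 3" using third_at[OF x] .
  define q where "q = H (x + \<tau> *\<^sub>R v) v \<bullet> v"
  have q: "q > 0" using pos_def[OF x v] by (simp add: q_def)
  have Nq: "N (x + \<tau> *\<^sub>R v) v = sqrt q" by (simp add: N_eq[OF x] q_def)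
  have "((\<lambda>\<tau>. 1 / sqrt (H (x + \<tau> *\<^sub>R v) v \<bullet> v)) has_real_derivative (- (D / (2 * sqrt q)) / q)) (at \<tau>)"
    using q unfolding q_def by (auto intro!: derivative_eq_intros D(1) simp: field_simps)
  moreover have "eventually (\<lambda>t. 1 / sqrt (H (x + t *\<^sub>R v) v \<bullet> v) = 1 / N (x + t *\<^sub>R v) v) (nhds \<tau>)"
  proof -
    obtain e where e: "e > 0" "\<And>t. \<bar>t\<bar> \<le> e \<Longrightarrow> x + \<tau> *\<^sub>R v + t *\<^sub>R v \<in> U"
      using open_line_neighbourhood[OF open_U x] by blast
    have "1 / sqrt (H (x + t *\<^sub>R v) v \<bullet> v) = 1 / N (x + t *\<^sub>R v) v" if "dist t \<tau> < e" for t
    proof -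
      have "x + \<tau> *\<^sub>R v + (t - \<tau>) *\<^sub>R v \<in> U" using that by (intro e(2)) (simp add: dist_real_def)
      then have "x + t *\<^sub>R v \<in> U" by (simp add: algebra_simps)
      then show ?thesis by (simp add: N_eq)
    qed
    then show ?thesis using e(1) by (auto simp: eventually_nhds_metric)
  qed
  ultimately have "((\<lambda>\<tau>. 1 / N (x + \<tau> *\<^sub>R v) v) has_real_derivative (- (D / (2 * sqrt q)) / q)) (at \<tau>)"
    using DERIV_cong_ev[OF refl _ refl] by fast
  moreover have "\<bar>- (D / (2 * sqrt q)) / q\<bar> \<le> 1"
  proof -
    have "\<bar>D\<bar> \<le> 2 * (sqrt q * q)" using D(2) q unfolding Nq by (simp add: power3_eq_cube mult.commute)
    then show ?thesis using q by (simp add: abs_mult abs_divide field_simps)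
  qed
  ultimately show ?thesis by blast
qed

lemma N_along_line:
  assumes x: "x \<in> U" "x + s *\<^sub>R v \<in> U" "0 \<le> s"
  shows "N (x + s *\<^sub>R v) v * (1 - s * N x v) \<le> N x v"
proof (cases "s = 0 \<or> v = 0")
  case True
  then show ?thesis
    using linear_0[OF H_linear[OF x(1)]] by (auto simp: N_eq x)
next
  case False
  then have s: "0 < s" and v: "v \<noteq> 0" using x by auto
  let ?\<chi> = "\<lambda>\<tau>. 1 / N (x + \<tau> *\<^sub>R v) v"
  have mem: "x + \<tau> *\<^sub>R v \<in> U" if "0 \<le> \<tau>" "\<tau> \<le> s" for \<tau>
    using convex_segment_mem[OF convex_U x(1,2) that] .
  have "\<forall>\<tau>. \<exists>D. 0 \<le> \<tau> \<longrightarrow> \<tau> \<le> s \<longrightarrow> (?\<chi> has_real_derivative D) (at \<tau>) \<and> \<bar>D\<bar> \<le> 1"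
    using inverse_N_deriv[OF mem v] by blast
  then obtain D where D: "\<And>\<tau>. 0 \<le> \<tau> \<Longrightarrow> \<tau> \<le> s \<Longrightarrow> (?\<chi> has_real_derivative D \<tau>) (at \<tau>)"
     "\<And>\<tau>. 0 \<le> \<tau> \<Longrightarrow> \<tau> \<le> s \<Longrightarrow> \<bar>D \<tau>\<bar> \<le> 1" by metis
  have "\<exists>\<tau>. 0 < \<tau> \<and> \<tau> < s \<and> ?\<chi> s - ?\<chi> 0 = (s - 0) * D \<tau>"
    using D(1) by (intro MVT2[OF s]) auto
  then obtain \<tau> where \<tau>: "0 < \<tau>" "\<tau> < s" "?\<chi> s - ?\<chi> 0 = s * D \<tau>" by auto
  have "s * (-1) \<le> s * D \<tau>" using D(2)[of \<tau>] \<tau> s by (intro mult_left_mono) auto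
  with \<tau>(3) have "1 / N x v - s \<le> 1 / N (x + s *\<^sub>R v) v" by simp
  moreover have "0 < N x v" "0 < N (x + s *\<^sub>R v) v" using pos_def[OF x(1) v] pos_def[OF x(2) v] by (simp_all add: N_eq x)
  ultimately show ?thesis by (simp add: field_simps)
qed

text \<open>
  Continuity of \<open>H\<close> on the finitely many basis vectors is uniform in the direction, and coercivity of \<open>H x\<close> makes it
  relative.
\<close>

lemma H_locally_close:
  assumes x: "x \<in> U" and \<eta>: "0 < \<eta>"
  shows "\<exists>e>0. ball x e \<subseteq> U \<and> (\<forall>y\<in>ball x e. \<forall>v. \<bar>H y v \<bullet> v - H x v \<bullet> v\<bar> \<le> \<eta> * (H x v \<bullet> v))"
proof -
  interpret K: positive_operator "H x" by (rule positive_operator_H[OF x])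
  obtain \<mu> where \<mu>: "\<mu> > 0" "\<And>u. \<mu> * (norm u)\<^sup>2 \<le> H x u \<bullet> u" using K.coercive by blast
  define \<kappa> where "\<kappa> = \<mu> * \<eta> / DIM('a)"
  have \<kappa>: "\<kappa> > 0" using \<mu> \<eta> by (simp add: \<kappa>_def)
  have "isCont (\<lambda>y. H y i) x" for i
    using continuous_on_interior[OF H_cont, of x i] x open_U by (auto simp: interior_open)
  then have "((\<lambda>y. H y i) \<longlongrightarrow> H x i) (nhds x)" for i
    using tendsto_at_iff_tendsto_nhds[of "\<lambda>y. H y i" x] unfolding isCont_def by metis
  then have "eventually (\<lambda>y. dist (H y i) (H x i) < \<kappa>) (nhds x)" for i
    using tendstoD[OF _ \<kappa>] by blast
  then have "eventually (\<lambda>y. \<forall>i\<in>Basis. dist (H y i) (H x i) < \<kappa>) (nhds x)"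
    by (simp add: eventually_ball_finite_distrib)
  moreover have "eventually (\<lambda>y. y \<in> U) (nhds x)" using x open_U by (simp add: eventually_nhds_in_open)
  ultimately have "eventually (\<lambda>y. y \<in> U \<and> (\<forall>i\<in>Basis. dist (H y i) (H x i) < \<kappa>)) (nhds x)"
    by (rule eventually_conj[rotated])
  then obtain e where e: "e > 0" "\<And>y. dist y x < e \<Longrightarrow> y \<in> U \<and> (\<forall>i\<in>Basis. dist (H y i) (H x i) < \<kappa>)"
    unfolding eventually_nhds_metric by blast
  have "\<bar>H y v \<bullet> v - H x v \<bullet> v\<bar> \<le> \<eta> * (H x v \<bullet> v)" if "y \<in> ball x e" for y v
  proof -
    have y: "y \<in> U" "\<And>i. i \<in> Basis \<Longrightarrow> dist (H y i) (H x i) < \<kappa>" using e(2)[of y] that by (auto simp: dist_commute)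
    have exp: "H w v = (\<Sum>i\<in>Basis. (v \<bullet> i) *\<^sub>R H w i)" if "w \<in> U" for w
      by (subst euclidean_representation[of v, symmetric])
         (simp add: linear_sum[OF H_linear[OF that]] linear_cmul[OF H_linear[OF that]] del: euclidean_representation)
    have "norm (H y v - H x v) = norm (\<Sum>i\<in>Basis. (v \<bullet> i) *\<^sub>R (H y i - H x i))"
      unfolding exp[OF y(1)] exp[OF x] by (simp add: sum_subtractf scaleR_diff_right)
    also have "\<dots> \<le> (\<Sum>i\<in>(Basis::'a set). norm v * \<kappa>)"
    proof (rule sum_norm_le)
      fix i :: 'a assume i: "i \<in> Basis"
      show "norm ((v \<bullet> i) *\<^sub>R (H y i - H x i)) \<le> norm v * \<kappa>"
        using Basis_le_norm[OF i, of v] y(2)[OF i] by (simp add: dist_norm mult_mono)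
    qed
    also have "\<dots> = \<mu> * \<eta> * norm v" by (simp add: \<kappa>_def)
    finally have "norm (H y v - H x v) \<le> \<mu> * \<eta> * norm v" .
    then have "norm (H y v - H x v) * norm v \<le> \<mu> * \<eta> * norm v * norm v" by (rule mult_right_mono) simp
    moreover have "\<bar>H y v \<bullet> v - H x v \<bullet> v\<bar> \<le> norm (H y v - H x v) * norm v"
      unfolding inner_diff_left[symmetric] by (rule Cauchy_Schwarz_ineq2)
    moreover have "\<eta> * (\<mu> * (norm v)\<^sup>2) \<le> \<eta> * (H x v \<bullet> v)" using \<mu>(2)[of v] \<eta> by simp
    ultimately show ?thesis by (simp add: power2_eq_square mult_ac)
  qed
  then show ?thesis using e by (intro exI[of _ e]) (auto simp: dist_commute)
qed

end

lemma ln_lipschitz: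
  fixes p q m :: real
  assumes "0 < m" "m \<le> p" "m \<le> q"
  shows "\<bar>ln p - ln q\<bar> \<le> \<bar>p - q\<bar> / m"
proof -
  have *: "ln a - ln b \<le> \<bar>a - b\<bar> / m" if "m \<le> a" "m \<le> b" for a b
  proof -
    have "ln a - ln b \<le> (a - b) / b" using that assms(1) by (intro ln_diff_le) auto
    also have "\<dots> \<le> \<bar>a - b\<bar> / b" using that assms(1) by (intro divide_right_mono) auto
    also have "\<dots> \<le> \<bar>a - b\<bar> / m" using that assms(1) by (intro divide_left_mono) auto
    finally show ?thesis .
  qed
  from *[OF assms(2,3)] *[OF assms(3,2)] show ?thesis by (simp add: abs_le_iff abs_minus_commute)
qed

context self_concordant
begin

text \<open>
  On a small ball all local norms agree with the one at the centre up to a factor \<open>1 + \<eta>\<close>, so the Hessian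
  satisfies there the hypothesis of \<open>mixed_Hessian_Lipschitz\<close> for a fixed inner product.
\<close>

lemma local_Hessian_variation:
  assumes x: "x \<in> U" and \<eta>: "0 < \<eta>" "\<eta> < 1"
  shows "\<exists>e>0. ball x e \<subseteq> U \<and> (\<forall>y s d h. y \<in> ball x e \<longrightarrow> y + s *\<^sub>R d \<in> ball x e \<longrightarrow> 0 \<le> s \<longrightarrow>
            \<bar>H (y + s *\<^sub>R d) h \<bullet> h - H y h \<bullet> h\<bar> \<le> 2 * (1 + \<eta>)^3 * s * N x d * (N x h)\<^sup>2)
          \<and> (\<forall>y\<in>ball x e. \<forall>h. (1 - \<eta>) * (H x h \<bullet> h) \<le> H y h \<bullet> h)"
proof -
  obtain e where e: "e > 0" "ball x e \<subseteq> U"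
    and close: "\<And>y v. y \<in> ball x e \<Longrightarrow> \<bar>H y v \<bullet> v - H x v \<bullet> v\<bar> \<le> \<eta> * (H x v \<bullet> v)"
    using H_locally_close[OF x \<eta>(1)] by blast
  interpret K: positive_operator "H x" by (rule positive_operator_H[OF x])
  interpret B: twice_differentiable "ball x e" F g H
    using e(2) F_deriv g_deriv continuous_on_subset[OF H_cont e(2)] by unfold_locales auto
  have Nle: "N y v \<le> (1 + \<eta>) * N x v" if "y \<in> ball x e" for y v
  proof -
    have y: "y \<in> U" using that e by auto
    have "H y v \<bullet> v \<le> (1 + \<eta>) * (H x v \<bullet> v)" using close[OF that, of v] by (simp add: abs_le_iff algebra_simps)
    also have "\<dots> \<le> (1 + \<eta>)\<^sup>2 * (H x v \<bullet> v)"
      using \<eta> K.nonneg[of v] by (intro mult_right_mono) (auto simp: power2_eq_square)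
    finally have "sqrt (H y v \<bullet> v) \<le> sqrt ((1 + \<eta>)\<^sup>2 * (H x v \<bullet> v))" by (rule real_sqrt_le_mono)
    then show ?thesis using \<eta> by (simp add: N_eq y x real_sqrt_mult)
  qed
  have "\<bar>H (y + s *\<^sub>R d) h \<bullet> h - H y h \<bullet> h\<bar> \<le> 2 * (1 + \<eta>)^3 * s * N x d * (N x h)\<^sup>2"
    if y: "y \<in> ball x e" "y + s *\<^sub>R d \<in> ball x e" "0 \<le> s" for y s d h
    unfolding N_def
  proof (rule B.mixed_Hessian_Lipschitz[OF K.positive_operator_axioms _ y])
    fix v y \<tau> assume y: "y \<in> ball x e" "y + \<tau> *\<^sub>R v \<in> ball x e" "(0::real) < \<tau>"
    have mem: "y + q *\<^sub>R v \<in> ball x e" if "0 \<le> q" "q \<le> \<tau>" for q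
      using convex_segment_mem[OF convex_ball y(1,2) that] .
    have "\<forall>q. \<exists>D. 0 \<le> q \<longrightarrow> q \<le> \<tau> \<longrightarrow> ((\<lambda>\<tau>. H (y + \<tau> *\<^sub>R v) v \<bullet> v) has_real_derivative D) (at q) \<and>
        \<bar>D\<bar> \<le> 2 * N (y + q *\<^sub>R v) v ^ 3"
      using third_at mem e(2) by (metis subsetD)
    then obtain D where D: "\<And>q. 0 \<le> q \<Longrightarrow> q \<le> \<tau> \<Longrightarrow> ((\<lambda>\<tau>. H (y + \<tau> *\<^sub>R v) v \<bullet> v) has_real_derivative D q) (at q)"
        "\<And>q. 0 \<le> q \<Longrightarrow> q \<le> \<tau> \<Longrightarrow> \<bar>D q\<bar> \<le> 2 * N (y + q *\<^sub>R v) v ^ 3" by metis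
    have "\<exists>q. 0 < q \<and> q < \<tau> \<and> H (y + \<tau> *\<^sub>R v) v \<bullet> v - H (y + 0 *\<^sub>R v) v \<bullet> v = (\<tau> - 0) * D q"
      using D(1) by (intro MVT2[OF y(3)]) auto
    then obtain q where q: "0 < q" "q < \<tau>" "H (y + \<tau> *\<^sub>R v) v \<bullet> v - H y v \<bullet> v = \<tau> * D q" by auto
    have "\<bar>D q\<bar> \<le> 2 * N (y + q *\<^sub>R v) v ^ 3" using D(2) q by simp
    also have "\<dots> \<le> 2 * ((1 + \<eta>) * N x v) ^ 3"
    proof -
      have m: "y + q *\<^sub>R v \<in> ball x e" using mem q by simp
      then have "0 \<le> N (y + q *\<^sub>R v) v" using e(2) by (simp add: N_def positive_operator.nrm_nonneg positive_operator_H subset_eq)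
      with Nle[OF m, of v] show ?thesis by (simp add: power_mono)
    qed
    finally show "\<bar>H (y + \<tau> *\<^sub>R v) v \<bullet> v - H y v \<bullet> v\<bar> \<le> 2 * (1 + \<eta>) ^ 3 * K.nrm v ^ 3 * \<tau>"
      using y(3) unfolding q(3) N_def by (simp add: abs_mult power_mult_distrib mult_ac)
  qed
  moreover have "(1 - \<eta>) * (H x h \<bullet> h) \<le> H y h \<bullet> h" if "y \<in> ball x e" for y h
    using close[OF that, of h] by (simp add: abs_le_iff algebra_simps)
  ultimately show ?thesis using e by blast
qed

lemma N_nonneg: "x \<in> U \<Longrightarrow> 0 \<le> N x u"
  unfolding N_def by (rule positive_operator.nrm_nonneg[OF positive_operator_H])

lemma N_sq: "x \<in> U \<Longrightarrow> (N x u)\<^sup>2 = H x u \<bullet> u"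
  unfolding N_def by (rule positive_operator.nrm_sq[OF positive_operator_H])

lemma N_scale: "x \<in> U \<Longrightarrow> N x (c *\<^sub>R u) = \<bar>c\<bar> * N x u"
  unfolding N_def by (rule positive_operator.nrm_scale[OF positive_operator_H])

text \<open>
  For smooth \<open>F\<close> this integrates \<open>\<bar>(ln \<phi>)'\<bar> \<le> 2 r / (1 - s r)\<close> over \<open>s \<in> [0,1]\<close>, where \<open>\<phi> s = H (z + s d) h \<bullet> h\<close>.  Here \<open>\<phi>\<close> is
  only locally Lipschitz, so the local estimates are glued by bisection, with a factor that tends to
  one as \<open>\<eta> \<rightarrow> 0\<close>.
\<close>

lemma log_Hessian_variation:
  assumes z: "z \<in> U" "z + d \<in> U" and r: "N z d < 1" and h: "h \<noteq> 0"
  shows "\<bar>ln (H (z + d) h \<bullet> h) - ln (H z h \<bullet> h)\<bar> \<le> - (2 * ln (1 - N z d))"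
proof -
  define r where "r = N z d"
  have r01: "0 \<le> r" "r < 1" using r N_nonneg[OF z(1)] by (auto simp: r_def)
  define G where "G s = H (z + s *\<^sub>R d) h \<bullet> h" for s
  define R where "R s = - ln (1 - s * r)" for s
  have mem: "z + s *\<^sub>R d \<in> U" if "0 \<le> s" "s \<le> 1" for s
    using convex_segment_mem[OF convex_U z(1) _ that] z(2) by simp
  have sr: "0 < 1 - s * r" if "0 \<le> s" "s \<le> 1" for s
    using mult_right_mono[OF that(2) r01(1)] r01 by simp
  have Nd: "N (z + s *\<^sub>R d) d \<le> r / (1 - s * r)" if "0 \<le> s" "s \<le> 1" for s
    using N_along_line[OF z(1) mem[OF that] that(1)] sr[OF that] by (simp add: r_def field_simps)
  have Rinc: "(b - a) * (r / (1 - a * r)) \<le> R b - R a" if ab: "0 \<le> a" "a \<le> b" "b \<le> 1" for a b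
  proof -
    have p: "0 < 1 - a * r" "0 < 1 - b * r" using sr that by auto
    have "ln (1 - b * r) - ln (1 - a * r) \<le> ((1 - b * r) - (1 - a * r)) / (1 - a * r)"
      using p by (intro ln_diff_le)
    then show ?thesis unfolding R_def using p by (simp add: field_simps)
  qed
  have main: "\<bar>ln (G 1) - ln (G 0)\<bar> \<le> 2 * (1 + \<eta>)^4 / (1 - \<eta>) * (R 1 - R 0)" if \<eta>: "0 < \<eta>" "\<eta> < 1" for \<eta>
  proof -
    define P where "P a b \<longleftrightarrow> (0 \<le> a \<and> b \<le> 1 \<longrightarrow> \<bar>ln (G b) - ln (G a)\<bar> \<le> 2 * (1 + \<eta>)^4 / (1 - \<eta>) * (R b - R a))" for a b
    have "(0::real) \<le> 1" by simp
    then have "P 0 1"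
    proof (induction rule: Bolzano)
      case (trans a b c)
      have le: "\<bar>ln (G c) - ln (G a)\<bar> \<le> \<bar>ln (G c) - ln (G b)\<bar> + \<bar>ln (G b) - ln (G a)\<bar>" by linarith
      have "2 * (1 + \<eta>)^4 / (1 - \<eta>) * (R c - R a) = 2 * (1 + \<eta>)^4 / (1 - \<eta>) * (R c - R b) + 2 * (1 + \<eta>)^4 / (1 - \<eta>) * (R b - R a)"
        by (simp only: distrib_left[symmetric]) simp
      with le trans show ?case unfolding P_def by linarith
    next
      case (local x)
      define y where "y = z + x *\<^sub>R d"
      have y: "y \<in> U" unfolding y_def using local by (intro mem)
      obtain e where e: "e > 0" "ball y e \<subseteq> U"
        and var: "\<And>u s d h. u \<in> ball y e \<Longrightarrow> u + s *\<^sub>R d \<in> ball y e \<Longrightarrow> 0 \<le> s \<Longrightarrow>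
            \<bar>H (u + s *\<^sub>R d) h \<bullet> h - H u h \<bullet> h\<bar> \<le> 2 * (1 + \<eta>)^3 * s * N y d * (N y h)\<^sup>2"
        and low: "\<And>u h. u \<in> ball y e \<Longrightarrow> (1 - \<eta>) * (H y h \<bullet> h) \<le> H u h \<bullet> h"
        using local_Hessian_variation[OF y \<eta>] by metis
      obtain e1 where e1: "e1 > 0" "\<And>\<tau>. \<bar>\<tau>\<bar> \<le> e1 \<Longrightarrow> y + \<tau> *\<^sub>R d \<in> ball y e"
        using open_line_neighbourhood[of "ball y e" y d] e(1) by auto
      have srx: "0 < 1 - x * r" using sr local by auto
      define e2 where "e2 = \<eta> * (1 - x * r)"
      have e2: "e2 > 0" using \<eta> srx by (simp add: e2_def)
      have "P a b" if ab: "a \<le> x" "x \<le> b" "b - a < min e1 e2" for a b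
        unfolding P_def
      proof (intro impI, elim conjE)
        assume a0: "0 \<le> a" and b1: "b \<le> 1"
        have abm: "z + a *\<^sub>R d \<in> ball y e" "z + b *\<^sub>R d \<in> ball y e"
        proof -
          have "\<bar>a - x\<bar> \<le> e1" "\<bar>b - x\<bar> \<le> e1" using ab by auto
          then have "y + (a - x) *\<^sub>R d \<in> ball y e" "y + (b - x) *\<^sub>R d \<in> ball y e" by (simp_all only: e1(2))
          then show "z + a *\<^sub>R d \<in> ball y e" "z + b *\<^sub>R d \<in> ball y e" by (simp_all add: y_def algebra_simps)
        qed
        have eqb: "(z + a *\<^sub>R d) + (b - a) *\<^sub>R d = z + b *\<^sub>R d" by (simp add: algebra_simps)
        have Gx: "0 < G x" unfolding G_def using pos_def[OF y h] by (simp add: y_def)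
        have "\<bar>G b - G a\<bar> \<le> 2 * (1 + \<eta>)^3 * (b - a) * N y d * (N y h)\<^sup>2"
          using var[OF abm(1), of "b - a" d h] abm(2) ab unfolding eqb G_def by simp
        also have "(N y h)\<^sup>2 = G x" using N_sq[OF y, of h] by (simp add: G_def y_def)
        finally have "\<bar>G b - G a\<bar> \<le> 2 * (1 + \<eta>)^3 * (b - a) * N y d * G x" .
        moreover have "\<bar>ln (G b) - ln (G a)\<bar> \<le> \<bar>G b - G a\<bar> / ((1 - \<eta>) * G x)"
          using low[OF abm(1), of h] low[OF abm(2), of h] \<eta> Gx by (intro ln_lipschitz) (auto simp: G_def y_def)
        ultimately have "\<bar>ln (G b) - ln (G a)\<bar> \<le> (2 * (1 + \<eta>)^3 * (b - a) * N y d * G x) / ((1 - \<eta>) * G x)"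
          using \<eta> Gx by (meson divide_right_mono less_imp_le mult_pos_pos order_trans diff_gt_0_iff_gt)
        also have "\<dots> = 2 * (1 + \<eta>)^3 / (1 - \<eta>) * ((b - a) * N y d)" using Gx by simp
        also have "\<dots> \<le> 2 * (1 + \<eta>)^3 / (1 - \<eta>) * ((b - a) * ((1 + \<eta>) * (r / (1 - a * r))))"
        proof (intro mult_left_mono)
          have pa: "0 < 1 - a * r" using sr[of a] a0 ab b1 by simp
          have "N y d \<le> r / (1 - x * r)" unfolding y_def using Nd local by simp
          also have "\<dots> \<le> (1 + \<eta>) * (r / (1 - a * r))"
          proof -
            have "(x - a) * r \<le> e2 * 1" using ab r01 e2 by (intro mult_mono) auto
            then have "1 - a * r \<le> (1 + \<eta>) * (1 - x * r)" by (simp add: e2_def algebra_simps)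
            then have "r * (1 - a * r) \<le> r * ((1 + \<eta>) * (1 - x * r))" using r01 by (intro mult_left_mono) auto
            then show ?thesis using pa srx by (simp add: field_simps)
          qed
          finally show "N y d \<le> (1 + \<eta>) * (r / (1 - a * r))" .
        qed (use ab \<eta> in auto)
        also have "\<dots> = 2 * (1 + \<eta>)^4 / (1 - \<eta>) * ((b - a) * (r / (1 - a * r)))"
          by (simp add: power_Suc[of _ 3, simplified] mult_ac numeral_eq_Suc)
        also have "\<dots> \<le> 2 * (1 + \<eta>)^4 / (1 - \<eta>) * (R b - R a)"
          using Rinc[of a b] a0 ab b1 \<eta> by (intro mult_left_mono) auto
        finally show "\<bar>ln (G b) - ln (G a)\<bar> \<le> 2 * (1 + \<eta>)^4 / (1 - \<eta>) * (R b - R a)" .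
      qed
      then show ?case using e1 e2 by (intro exI[of _ "min e1 e2"]) auto
    qed
    then show ?thesis by (simp add: P_def)
  qed
  have "\<bar>ln (G 1) - ln (G 0)\<bar> \<le> 2 * (1 + 0)^4 / (1 - 0) * (R 1 - R 0)"
  proof (rule tendsto_lowerbound)
    show "((\<lambda>\<eta>. 2 * (1 + \<eta>)^4 / (1 - \<eta>) * (R 1 - R 0)) \<longlongrightarrow> 2 * (1 + 0)^4 / (1 - 0) * (R 1 - R 0)) (at_right 0)"
      by (intro tendsto_intros) auto
    show "eventually (\<lambda>\<eta>. \<bar>ln (G 1) - ln (G 0)\<bar> \<le> 2 * (1 + \<eta>)^4 / (1 - \<eta>) * (R 1 - R 0)) (at_right 0)"
      unfolding eventually_at_right_field using main by (intro exI[of _ 1]) auto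
  qed simp
  then show ?thesis by (simp add: G_def R_def r_def)
qed

lemma Hessian_comparison:
  assumes z: "z \<in> U" "z + d \<in> U" and r: "N z d < 1"
  shows "(1 - N z d)\<^sup>2 * (H z h \<bullet> h) \<le> H (z + d) h \<bullet> h" "(1 - N z d)\<^sup>2 * (H (z + d) h \<bullet> h) \<le> H z h \<bullet> h"
proof -
  have "(1 - N z d)\<^sup>2 * (H z h \<bullet> h) \<le> H (z + d) h \<bullet> h \<and> (1 - N z d)\<^sup>2 * (H (z + d) h \<bullet> h) \<le> H z h \<bullet> h"
  proof (cases "h = 0")
    case False
    have p: "0 < H z h \<bullet> h" "0 < H (z + d) h \<bullet> h" "0 < 1 - N z d" using pos_def z False r by auto
    have l: "\<bar>ln (H (z + d) h \<bullet> h) - ln (H z h \<bullet> h)\<bar> \<le> - (2 * ln (1 - N z d))"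
      by (rule log_Hessian_variation[OF z r False])
    have "ln ((1 - N z d)\<^sup>2 * (H z h \<bullet> h)) \<le> ln (H (z + d) h \<bullet> h)"
      using l p by (simp add: ln_mult ln_realpow abs_le_iff)
    moreover have "ln ((1 - N z d)\<^sup>2 * (H (z + d) h \<bullet> h)) \<le> ln (H z h \<bullet> h)"
      using l p by (simp add: ln_mult ln_realpow abs_le_iff)
    ultimately show ?thesis using p by simp
  qed simp
  then show "(1 - N z d)\<^sup>2 * (H z h \<bullet> h) \<le> H (z + d) h \<bullet> h" "(1 - N z d)\<^sup>2 * (H (z + d) h \<bullet> h) \<le> H z h \<bullet> h" by auto
qed

lemma N_comparison:
  assumes z: "z \<in> U" "z + d \<in> U" and r: "N z d < 1"
  shows "(1 - N z d) * N z h \<le> N (z + d) h"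
proof -
  have "sqrt ((1 - N z d)\<^sup>2 * (H z h \<bullet> h)) \<le> sqrt (H (z + d) h \<bullet> h)"
    by (rule real_sqrt_le_mono) (rule Hessian_comparison[OF assms])
  then show ?thesis using r by (simp add: N_eq z real_sqrt_mult)
qed

lemma Nd_comparison:
  assumes z: "z \<in> U" "z + d \<in> U" and r: "N z d < 1"
  shows "Nd (z + d) v \<le> Nd z v / (1 - N z d)"
  unfolding Nd_def
proof (rule positive_operator.dnrm_le[OF positive_operator_H[OF z(2)]])
  fix u
  have "v \<bullet> u \<le> Nd z v * N z u"
    using positive_operator.dual_pairing[OF positive_operator_H[OF z(1)], of v u] by (simp add: Nd_def N_def)
  also have "\<dots> \<le> Nd z v * (N (z + d) u / (1 - N z d))"
    using N_comparison[OF assms, of u] r positive_operator.dnrm_nonneg[OF positive_operator_H[OF z(1)], of v]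
    by (intro mult_left_mono) (auto simp: field_simps Nd_def)
  finally show "v \<bullet> u \<le> positive_operator.dnrm (H z) v / (1 - N z d) * positive_operator.nrm (H (z + d)) u"
    by (simp add: Nd_def N_def)
qed

text \<open>
  Along the segment the derivative of \<open>g\<close> in direction \<open>d\<close> differs from \<open>H z d\<close> by at most \<open>(1 - s r)^-2 - 1\<close> times
  \<open>r\<close> in the dual norm, and \<open>s / (1 - s r) - s\<close> is an antiderivative of this factor.
\<close>

lemma gradient_linearization_error:
  assumes z: "z \<in> U" "z + d \<in> U" and r: "N z d < 1"
  shows "Nd z (g (z + d) - g z - H z d) \<le> (N z d)\<^sup>2 / (1 - N z d)"
  unfolding Nd_def
proof (rule positive_operator.dnrm_le[OF positive_operator_H[OF z(1)]])
  fix h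
  interpret K: positive_operator "H z" by (rule positive_operator_H[OF z(1)])
  define r where "r = N z d"
  have r01: "0 \<le> r" "r < 1" using r N_nonneg[OF z(1)] by (auto simp: r_def)
  have mem: "z + s *\<^sub>R d \<in> U" if "0 \<le> s" "s \<le> 1" for s
    using convex_segment_mem[OF convex_U z(1) _ that] z(2) by simp
  have sr: "s * r < 1" "0 \<le> s * r" if "0 \<le> s" "s \<le> 1" for s
    using mult_right_mono[OF that(2) r01(1)] r01 that by auto
  have var: "(H (z + s *\<^sub>R d) d - H z d) \<bullet> h \<le> (1 / (1 - s * r)\<^sup>2 - 1) * r * N z h" if s: "0 \<le> s" "s \<le> 1" for s
  proof -
    define q where "q = (1 - s * r)\<^sup>2"
    have q: "0 < q" "q \<le> 1" using sr[OF s] by (auto simp: q_def power_le_one)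
    have Ns: "N z (s *\<^sub>R d) = s * r" using s by (simp add: N_scale z r_def)
    have bd: "\<bar>(H (z + s *\<^sub>R d) v - H z v) \<bullet> v\<bar> \<le> (1 / q - 1) * (K.nrm v)\<^sup>2" for v
    proof -
      have "q * (H z v \<bullet> v) \<le> H (z + s *\<^sub>R d) v \<bullet> v" "q * (H (z + s *\<^sub>R d) v \<bullet> v) \<le> H z v \<bullet> v"
        using Hessian_comparison[OF z(1) mem[OF s], of v] sr[OF s] unfolding Ns q_def by auto
      then have 1: "(H (z + s *\<^sub>R d) v - H z v) \<bullet> v \<le> (1 / q - 1) * (H z v \<bullet> v)"
        and 2: "- ((H (z + s *\<^sub>R d) v - H z v) \<bullet> v) \<le> (1 - q) * (H z v \<bullet> v)"
        using q by (auto simp: inner_diff_left field_simps)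
      have "1 - q \<le> 1 / q - 1"
      proof -
        have "0 \<le> (1 - q)\<^sup>2 / q" using q by simp
        then show ?thesis using q by (simp add: power2_eq_square field_simps)
      qed
      then have "(1 - q) * (H z v \<bullet> v) \<le> (1 / q - 1) * (H z v \<bullet> v)" by (intro mult_right_mono K.nonneg)
      with 1 2 show ?thesis by (simp add: K.nrm_sq abs_le_iff)
    qed
    have "\<bar>(H (z + s *\<^sub>R d) d - H z d) \<bullet> h\<bar> \<le> (1 / q - 1) * K.nrm d * K.nrm h"
    proof (rule K.bilinear_form_bound[where M = "\<lambda>v. H (z + s *\<^sub>R d) v - H z v"])
      show "linear (\<lambda>v. H (z + s *\<^sub>R d) v - H z v)"
        by (intro linear_compose_sub H_linear z mem s)
      show "(H (z + s *\<^sub>R d) u - H z u) \<bullet> v = (H (z + s *\<^sub>R d) v - H z v) \<bullet> u" for u v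
        using H_symmetric[OF z(1), of u v] H_symmetric[OF mem[OF s], of u v] by (simp add: inner_diff_left)
    qed (rule bd)
    then show ?thesis by (simp add: q_def r_def N_def abs_le_iff)
  qed
  define \<psi> where "\<psi> s = r * N z h * (s / (1 - s * r) - s) - (g (z + s *\<^sub>R d) \<bullet> h - s * (H z d \<bullet> h))" for s
  have "\<psi> 0 \<le> \<psi> 1"
  proof (rule DERIV_nonneg_imp_nondecreasing[where f = \<psi>])
    fix s :: real assume s: "0 \<le> s" "s \<le> 1"
    have s1: "1 - s * r \<noteq> 0" using sr[OF s] by simp
    have "((\<lambda>s. s / (1 - s * r)) has_real_derivative 1 / (1 - s * r)\<^sup>2) (at s)"
      using s1 by (auto intro!: derivative_eq_intros simp: field_simps power2_eq_square)
    then have "(\<psi> has_real_derivative (r * N z h * (1 / (1 - s * r)\<^sup>2 - 1) - (H (z + s *\<^sub>R d) d \<bullet> h - 1 * (H z d \<bullet> h)))) (at s)"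
      unfolding \<psi>_def by (intro DERIV_diff DERIV_cmult DERIV_cmult_right DERIV_ident g_line_deriv mem s)
    moreover have "0 \<le> r * N z h * (1 / (1 - s * r)\<^sup>2 - 1) - (H (z + s *\<^sub>R d) d \<bullet> h - 1 * (H z d \<bullet> h))"
      using var[OF s] by (simp add: inner_diff_left mult_ac)
    ultimately show "\<exists>y. (\<psi> has_real_derivative y) (at s) \<and> 0 \<le> y" by blast
  qed simp
  then have "(g (z + d) - g z - H z d) \<bullet> h \<le> r * N z h * (1 / (1 - r) - 1)"
    by (simp add: \<psi>_def inner_diff_left)
  also have "\<dots> = r\<^sup>2 / (1 - r) * N z h" using r01 by (simp add: field_simps power2_eq_square)
  finally show "(g (z + d) - g z - H z d) \<bullet> h \<le> (N z d)\<^sup>2 / (1 - N z d) * K.nrm h"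
    by (simp add: r_def N_def)
qed

end

section \<open>Self-concordant barriers\<close>

lemma gradient_has_derivative:
  fixes F :: "'a::euclidean_space \<Rightarrow> real"
  assumes "F differentiable (at z)"
  shows "(F has_derivative (\<lambda>h. gradient F z \<bullet> h)) (at z)"
proof -
  obtain D where D: "(F has_derivative D) (at z)" using assms unfolding differentiable_def by blast
  define u where "u = (\<Sum>i\<in>Basis. D i *\<^sub>R i)"
  have lin: "linear D" using D has_derivative_linear by blast
  have Du: "D = (\<lambda>h. h \<bullet> u)"
  proof
    fix h
    have "D h = D (\<Sum>i\<in>Basis. (h \<bullet> i) *\<^sub>R i)" by (simp add: euclidean_representation)
    also have "\<dots> = h \<bullet> u" unfolding u_def
      by (simp add: linear_sum[OF lin] linear_cmul[OF lin] inner_sum_right mult.commute)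
    finally show "D h = h \<bullet> u" .
  qed
  have G: "GDERIV F z :> u" using D unfolding gderiv_def Du .
  have "gradient F z = u"
    unfolding gradient_def
  proof (rule the_equality)
    show "GDERIV F z :> u" by (rule G)
  next
    fix u' assume "GDERIV F z :> u'"
    then have "(\<lambda>h. h \<bullet> u') = (\<lambda>h. h \<bullet> u)"
      using G unfolding gderiv_def by (rule has_derivative_unique)
    then show "u' = u" by (metis inner_commute vector_eq_ldot)
  qed
  then show ?thesis using D unfolding Du by (simp add: inner_commute)
qed

text \<open>
  The derivatives along lines, given only by their existence, are identified with those of the gradient and
  Hessian by uniqueness of derivatives on the open set of admissible parameters.
\<close>

lemma self_concordant_from_restrictions:
  fixes F :: "'a::euclidean_space \<Rightarrow> real"
  assumes D: "open D" "convex D"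
    and C2: "twice_continuously_differentiable_on F D"
    and sc: "standard_self_concordant_on F D"
    and pos: "\<And>x u. x \<in> D \<Longrightarrow> u \<noteq> 0 \<Longrightarrow> 0 < hessian F x u \<bullet> u"
  shows "self_concordant D F (gradient F) (hessian F)"
proof -
  interpret T: twice_differentiable D F "gradient F" "hessian F"
    using C2 D unfolding twice_continuously_differentiable_on_def hessian_def
    by unfold_locales (auto intro: gradient_has_derivative simp: frechet_derivative_works[symmetric])
  show ?thesis
  proof unfold_locales
    fix x v assume x: "x \<in> D"
    define I where "I = {\<tau>. x + \<tau> *\<^sub>R v \<in> D}"
    have I: "open I"
    proof -
      have "open ((\<lambda>\<tau>::real. x + \<tau> *\<^sub>R v) -` D)" by (rule open_vimage[OF D(1)]) (intro continuous_intros)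
      then show ?thesis by (simp add: I_def vimage_def)
    qed
    obtain \<phi>1 \<phi>2 \<phi>3 where \<phi>b: "\<forall>\<tau>\<in>I. ((\<lambda>\<tau>. F (x + \<tau> *\<^sub>R v)) has_real_derivative \<phi>1 \<tau>) (at \<tau>)"
      "\<forall>\<tau>\<in>I. (\<phi>1 has_real_derivative \<phi>2 \<tau>) (at \<tau>)"
      "\<forall>\<tau>\<in>I. (\<phi>2 has_real_derivative \<phi>3 \<tau>) (at \<tau>)"
      "\<forall>\<tau>\<in>I. \<bar>\<phi>3 \<tau>\<bar> \<le> 2 * \<phi>2 \<tau> powr (3 / 2)"
      using sc[unfolded standard_self_concordant_on_def Let_def, THEN bspec, OF x, THEN spec, of v, folded I_def]
      by (elim conjE exE) (rule that)
    note \<phi> = \<phi>b[rule_format]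
    have cong: "(f' has_real_derivative E) (at \<tau>)"
      if "(f has_real_derivative E) (at \<tau>)" "\<tau> \<in> I" "\<And>\<tau>. \<tau> \<in> I \<Longrightarrow> f \<tau> = f' \<tau>" for f f' E \<tau>
      using has_field_derivative_transform_within_open[OF that(1) I that(2,3)] .
    have 1: "\<phi>1 \<tau> = gradient F (x + \<tau> *\<^sub>R v) \<bullet> v" if "\<tau> \<in> I" for \<tau>
      using DERIV_unique[OF \<phi>(1)[OF that] T.F_line_deriv] that by (simp add: I_def)
    have 2: "\<phi>2 \<tau> = hessian F (x + \<tau> *\<^sub>R v) v \<bullet> v" if "\<tau> \<in> I" for \<tau>
      using DERIV_unique[OF cong[OF \<phi>(2)[OF that] that 1] T.g_line_deriv] that by (simp add: I_def)
    have 0: "0 \<in> I" using x by (simp add: I_def)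
    show "\<exists>E. ((\<lambda>\<tau>. hessian F (x + \<tau> *\<^sub>R v) v \<bullet> v) has_real_derivative E) (at 0)
            \<and> \<bar>E\<bar> \<le> 2 * (hessian F x v \<bullet> v) powr (3 / 2)"
      using cong[OF \<phi>(3)[OF 0] 0 2] \<phi>(4)[OF 0] 2[OF 0] by auto
  qed (rule pos)
qed

context self_concordant_inclusion
begin

sublocale sc: self_concordant "interior Z" F "gradient F" "hessian F"
  using barrier unfolding self_concordant_barrier_def
  by (intro self_concordant_from_restrictions hessian_pos_def)
     (auto simp: convex_interior Z_convex)

lemma nu_pos: "0 < \<nu>" using barrier by (simp add: self_concordant_barrier_def)

lemma local_norm_eq: "z \<in> interior Z \<Longrightarrow> local_norm F z u = sc.N z u"
  by (simp add: local_norm_def sc.N_eq)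

lemma dual_local_norm_eq: "z \<in> interior Z \<Longrightarrow> dual_local_norm F z v = sc.Nd z v"
  by (simp add: dual_local_norm_def hessian_inv_def sc.Nd_def positive_operator.dnrm_def[OF sc.positive_operator_H])

text \<open>
  The supremum in the definition of the barrier parameter is attained at \<open>u = \<nabla>^2 F(z)^-1 \<nabla>F(z)\<close>.
\<close>

lemma gradient_dual_norm_le:
  assumes z: "z \<in> interior Z" shows "sc.Nd z (gradient F z) \<le> sqrt \<nu>"
proof -
  interpret K: positive_operator "hessian F z" by (rule sc.positive_operator_H[OF z])
  define u where "u = inv (hessian F z) (gradient F z)"
  have "2 * (gradient F z \<bullet> u) - (local_norm F z u)\<^sup>2 \<le> \<nu>"
    using barrier z unfolding self_concordant_barrier_def by blast
  moreover have "gradient F z \<bullet> u = (K.nrm u)\<^sup>2" by (simp add: K.nrm_sq u_def K.K_inv)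
  ultimately have "(K.nrm u)\<^sup>2 \<le> \<nu>" by (simp add: local_norm_eq z sc.N_def)
  then have "K.nrm u \<le> sqrt \<nu>" by (simp add: real_le_rsqrt)
  then show ?thesis by (simp add: sc.Nd_def K.dnrm_eq_nrm u_def)
qed

lemma gradient_inner_le:
  assumes z: "z \<in> interior Z" shows "\<bar>gradient F z \<bullet> u\<bar> \<le> sqrt \<nu> * sc.N z u"
proof -
  have "\<bar>gradient F z \<bullet> u\<bar> \<le> sc.Nd z (gradient F z) * sc.N z u"
    unfolding sc.N_def sc.Nd_def by (rule positive_operator.dual_pairing[OF sc.positive_operator_H[OF z]])
  also have "\<dots> \<le> sqrt \<nu> * sc.N z u"
    by (intro mult_right_mono gradient_dual_norm_le z sc.N_nonneg)
  finally show ?thesis .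
qed

lemma ray_to_frontier_mem:
  assumes z: "z \<in> interior Z" and x: "x \<in> frontier Z" and s: "0 \<le> s" "s < 1"
  shows "z + s *\<^sub>R (x - z) \<in> interior Z"
proof -
  have "x \<in> closure Z" using x by (simp add: frontier_def)
  then have "x - (1 - s) *\<^sub>R (x - z) \<in> interior Z"
    using s by (intro mem_interior_closure_convex_shrink[OF Z_convex z]) auto
  then show ?thesis by (simp add: algebra_simps)
qed

lemma barrier_blow_up:
  assumes z: "z \<in> interior Z" and x: "x \<in> frontier Z"
  shows "\<exists>s. 0 \<le> s \<and> s < 1 \<and> B < F (z + s *\<^sub>R (x - z))"
proof -
  have "filterlim F at_top (at x within interior Z)"
    using barrier x unfolding self_concordant_barrier_def by blast
  then have "eventually (\<lambda>y. B < F y) (at x within interior Z)" by (simp add: filterlim_at_top_dense)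
  then obtain \<delta> where \<delta>: "\<delta> > 0" "\<And>y. y \<in> interior Z \<Longrightarrow> y \<noteq> x \<Longrightarrow> dist y x < \<delta> \<Longrightarrow> B < F y"
    unfolding eventually_at by blast
  define n where "n = norm (x - z) + 1"
  have n: "n > 0" "norm (x - z) < n" using norm_ge_zero[of "x - z"] unfolding n_def by linarith+
  define s where "s = max 0 (1 - \<delta> / n)"
  have s: "0 \<le> s" "s < 1" using \<delta>(1) n by (auto simp: s_def)
  have mem: "z + s *\<^sub>R (x - z) \<in> interior Z" by (rule ray_to_frontier_mem[OF z x s])
  have "dist (z + s *\<^sub>R (x - z)) x = norm ((s - 1) *\<^sub>R (x - z))" by (simp add: dist_norm algebra_simps)
  also have "\<dots> = (1 - s) * norm (x - z)" using s by simp
  also have "\<dots> < (1 - s) * n" using s n by (intro mult_strict_left_mono) auto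
  also have "\<dots> \<le> \<delta> / n * n" using n by (intro mult_right_mono) (auto simp: s_def)
  also have "\<dots> = \<delta>" using n by simp
  finally have "dist (z + s *\<^sub>R (x - z)) x < \<delta>" .
  moreover have "z + s *\<^sub>R (x - z) \<noteq> x" using mem x by (auto simp: frontier_def)
  ultimately show ?thesis using \<delta>(2)[OF mem] s by blast
qed

text \<open>
  Along a segment of local length less than one the second derivative of \<open>F\<close> stays bounded, hence so does \<open>F\<close>,
  whereas \<open>F\<close> blows up at the frontier.
\<close>

lemma local_norm_to_frontier:
  assumes z: "z \<in> interior Z" and x: "x \<in> frontier Z"
  shows "1 \<le> sc.N z (x - z)"
proof (rule ccontr)
  define v where "v = x - z"
  define r where "r = sc.N z v"
  assume "\<not> 1 \<le> sc.N z (x - z)"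
  then have r: "0 \<le> r" "r < 1" using sc.N_nonneg[OF z] by (auto simp: r_def v_def)
  define M where "M = (r / (1 - r))\<^sup>2"
  have mem: "z + s *\<^sub>R v \<in> interior Z" if "0 \<le> s" "s < 1" for s
    using ray_to_frontier_mem[OF z x that] by (simp add: v_def)
  have M: "hessian F (z + s *\<^sub>R v) v \<bullet> v \<le> M" if s: "0 \<le> s" "s < 1" for s
  proof -
    have sr: "s * r \<le> r" using s r by (simp add: mult_left_le_one_le)
    have "sc.N (z + s *\<^sub>R v) v * (1 - r) \<le> sc.N (z + s *\<^sub>R v) v * (1 - s * r)"
      using sr sc.N_nonneg[OF mem[OF s]] by (intro mult_left_mono) auto
    also have "\<dots> \<le> r" using sc.N_along_line[OF z mem[OF s] s(1)] by (simp add: r_def)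
    finally have "sc.N (z + s *\<^sub>R v) v \<le> r / (1 - r)" using r by (simp add: field_simps)
    then have "(sc.N (z + s *\<^sub>R v) v)\<^sup>2 \<le> M" unfolding M_def by (intro power_mono sc.N_nonneg mem s)
    then show ?thesis by (simp add: sc.N_sq[OF mem[OF s]])
  qed
  have M0: "0 \<le> M" by (simp add: M_def)
  have g: "gradient F (z + s *\<^sub>R v) \<bullet> v \<le> \<bar>gradient F z \<bullet> v\<bar> + M" if s: "0 \<le> s" "s < 1" for s
  proof (cases "s = 0")
    case False
    then have s0: "0 < s" using s by simp
    have "\<exists>q. 0 < q \<and> q < s \<and> gradient F (z + s *\<^sub>R v) \<bullet> v - gradient F (z + 0 *\<^sub>R v) \<bullet> v = (s - 0) * (hessian F (z + q *\<^sub>R v) v \<bullet> v)"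
      using s by (intro MVT2[OF s0] sc.g_line_deriv mem) auto
    then obtain q where q: "0 < q" "q < s" "gradient F (z + s *\<^sub>R v) \<bullet> v = gradient F z \<bullet> v + s * (hessian F (z + q *\<^sub>R v) v \<bullet> v)"
      by auto
    have "0 \<le> hessian F (z + q *\<^sub>R v) v \<bullet> v"
      using sc.N_sq[OF mem[of q], of v] q s by (metis less_imp_le less_trans zero_le_power2)
    then have "s * (hessian F (z + q *\<^sub>R v) v \<bullet> v) \<le> 1 * M"
      using M[of q] q s M0 by (intro mult_mono) auto
    then show ?thesis using q(3) by linarith
  qed (use M0 in simp)
  define B where "B = F z + (\<bar>gradient F z \<bullet> v\<bar> + M)"
  have "F (z + s *\<^sub>R v) \<le> B" if s: "0 \<le> s" "s < 1" for s
  proof (cases "s = 0")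
    case False
    then have s0: "0 < s" using s by simp
    have "\<exists>q. 0 < q \<and> q < s \<and> F (z + s *\<^sub>R v) - F (z + 0 *\<^sub>R v) = (s - 0) * (gradient F (z + q *\<^sub>R v) \<bullet> v)"
      using s by (intro MVT2[OF s0] sc.F_line_deriv mem) auto
    then obtain q where q: "0 < q" "q < s" "F (z + s *\<^sub>R v) = F z + s * (gradient F (z + q *\<^sub>R v) \<bullet> v)" by auto
    have "s * (gradient F (z + q *\<^sub>R v) \<bullet> v) \<le> s * (\<bar>gradient F z \<bullet> v\<bar> + M)"
      using g[of q] q s by (intro mult_left_mono) auto
    also have "\<dots> \<le> 1 * (\<bar>gradient F z \<bullet> v\<bar> + M)" using s M0 by (intro mult_right_mono) auto
    finally show ?thesis using q(3) by (simp add: B_def)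
  qed (use M0 in \<open>simp add: B_def\<close>)
  then show False using barrier_blow_up[OF z x, of B] unfolding v_def by force
qed

lemma Dikin_ellipsoid:
  assumes z: "z \<in> interior Z" and d: "sc.N z d < 1"
  shows "z + d \<in> interior Z"
proof (rule ccontr)
  assume "z + d \<notin> interior Z"
  then have "closed_segment z (z + d) \<inter> frontier (interior Z) \<noteq> {}"
    using z by (intro connected_Int_frontier) auto
  then obtain x where x: "x \<in> closed_segment z (z + d)" "x \<in> frontier Z"
    using frontier_interior_subset by blast
  then obtain u where u: "0 \<le> u" "u \<le> 1" "x - z = u *\<^sub>R d"
    by (auto simp: closed_segment_def algebra_simps)
  have "sc.N z (x - z) = u * sc.N z d" using u by (simp add: sc.N_scale z)
  also have "\<dots> < 1" using u d sc.N_nonneg[OF z, of d] mult_left_le_one_le[of "sc.N z d" u] by linarith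
  finally show False using local_norm_to_frontier[OF z x(2)] by simp
qed

text \<open>
  Along the ray \<open>\<phi> = \<langle>\<nabla>F, v\<rangle>\<close> satisfies \<open>\<phi>^2 \<le> \<nu> \<phi>'\<close>, so \<open>-1/\<phi> - \<tau>/\<nu>\<close> increases and \<open>\<phi>\<close> would become infinite no later than at
  time \<open>\<nu> / \<phi> 0\<close>.
\<close>

lemma no_increasing_ray:
  assumes mem: "\<And>\<tau>. 0 \<le> \<tau> \<Longrightarrow> z + \<tau> *\<^sub>R v \<in> interior Z" and p: "0 < gradient F z \<bullet> v"
  shows False
proof -
  define \<phi> where "\<phi> \<tau> = gradient F (z + \<tau> *\<^sub>R v) \<bullet> v" for \<tau>
  define h where "h \<tau> = hessian F (z + \<tau> *\<^sub>R v) v \<bullet> v" for \<tau>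
  have \<phi>d: "(\<phi> has_real_derivative h \<tau>) (at \<tau>)" if "0 \<le> \<tau>" for \<tau>
    unfolding \<phi>_def h_def by (rule sc.g_line_deriv[OF mem[OF that]])
  have bound: "(\<phi> \<tau>)\<^sup>2 \<le> \<nu> * h \<tau>" if "0 \<le> \<tau>" for \<tau>
  proof -
    have "(\<phi> \<tau>)\<^sup>2 \<le> (sqrt \<nu> * sc.N (z + \<tau> *\<^sub>R v) v)\<^sup>2"
      unfolding \<phi>_def using gradient_inner_le[OF mem[OF that], of v] nu_pos sc.N_nonneg[OF mem[OF that], of v]
      by (simp add: abs_le_square_iff[symmetric])
    then show ?thesis using nu_pos by (simp add: power_mult_distrib sc.N_sq[OF mem[OF that]] h_def)
  qed
  have h0: "0 \<le> h \<tau>" if "0 \<le> \<tau>" for \<tau> unfolding h_def using sc.N_sq[OF mem[OF that], of v] by (metis zero_le_power2)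
  have mono: "\<phi> 0 \<le> \<phi> \<tau>" if "0 \<le> \<tau>" for \<tau>
    using that \<phi>d h0 by (intro DERIV_nonneg_imp_nondecreasing[where f = \<phi>]) auto
  have \<phi>0: "0 < \<phi> 0" using p by (simp add: \<phi>_def)
  define T where "T = \<nu> / \<phi> 0"
  have T: "0 < T" using nu_pos \<phi>0 by (simp add: T_def)
  have "- 1 / \<phi> 0 - 0 / \<nu> \<le> - 1 / \<phi> T - T / \<nu>"
  proof (rule DERIV_nonneg_imp_nondecreasing[where f = "\<lambda>\<tau>. - 1 / \<phi> \<tau> - \<tau> / \<nu>"])
    fix \<tau> assume \<tau>: "0 \<le> \<tau>" "\<tau> \<le> T"
    have p: "0 < \<phi> \<tau>" using mono[OF \<tau>(1)] \<phi>0 by linarith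
    have "((\<lambda>\<tau>. - 1 / \<phi> \<tau> - \<tau> / \<nu>) has_real_derivative (h \<tau> / (\<phi> \<tau>)\<^sup>2 - 1 / \<nu>)) (at \<tau>)"
      using p nu_pos \<phi>d[OF \<tau>(1)] by (auto intro!: derivative_eq_intros simp: power2_eq_square)
    moreover have "0 \<le> h \<tau> / (\<phi> \<tau>)\<^sup>2 - 1 / \<nu>" using bound[OF \<tau>(1)] p nu_pos by (simp add: field_simps)
    ultimately show "\<exists>y. ((\<lambda>\<tau>. - 1 / \<phi> \<tau> - \<tau> / \<nu>) has_real_derivative y) (at \<tau>) \<and> 0 \<le> y" by blast
  qed (use T in simp)
  moreover have "T / \<nu> = 1 / \<phi> 0" using nu_pos by (simp add: T_def)
  ultimately have "0 \<le> - 1 / \<phi> T" by simp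
  moreover have "0 < \<phi> T" using mono[of T] \<phi>0 T by linarith
  ultimately show False by (simp add: field_simps)
qed

lemma interior_nonempty: "interior Z \<noteq> {}" using interior_dom_nonempty by blast

text \<open>
  On the whole space no direction could have a nonzero slope anywhere, so the Hessian would vanish.
\<close>

lemma Z_proper: "Z \<noteq> UNIV"
proof
  assume U: "Z = UNIV"
  define v :: 'a where "v = (SOME i. i \<in> Basis)"
  have v: "v \<noteq> 0" unfolding v_def by (simp add: nonzero_Basis some_in_eq)
  have no: "gradient F z \<bullet> u = 0" for z u
  proof (rule ccontr)
    assume "gradient F z \<bullet> u \<noteq> 0"
    then have "0 < gradient F z \<bullet> u \<or> 0 < gradient F z \<bullet> (- u)" by auto
    then show False using no_increasing_ray[of z u] no_increasing_ray[of z "- u"] U by auto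
  qed
  have "((\<lambda>\<tau>. gradient F (0 + \<tau> *\<^sub>R v) \<bullet> v) has_real_derivative hessian F (0 + 0 *\<^sub>R v) v \<bullet> v) (at 0)"
    by (rule sc.g_line_deriv) (simp add: U)
  then have "((\<lambda>\<tau>::real. 0) has_real_derivative hessian F 0 v \<bullet> v) (at 0)" by (simp add: no)
  then have "hessian F 0 v \<bullet> v = 0" using DERIV_unique DERIV_const by blast
  then show False using hessian_pos_def[of 0 v] v U by simp
qed

text \<open>
  On a segment running to the frontier consider \<open>w = \<phi>' \<phi>''^(-1/2) \<le> \<surd>\<nu>\<close>.  If \<open>\<surd>\<nu> < 1\<close>, then
  \<open>w' \<ge> (1 - \<surd>\<nu>) \<phi>''^(1/2) \<ge> (1 - \<surd>\<nu>)/\<surd>\<nu> \<phi>'\<close>, so \<open>w\<close> would grow at least like a multiple of \<open>\<phi>\<close>, which is unbounded.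
\<close>

lemma nu_ge_1: "1 \<le> \<nu>"
proof (rule ccontr)
  assume "\<not> 1 \<le> \<nu>"
  then have nu1: "0 < sqrt \<nu>" "sqrt \<nu> < 1" using nu_pos by auto
  obtain z where z: "z \<in> interior Z" using interior_nonempty by blast
  have "frontier Z \<noteq> {}" using Z_nonempty Z_proper by (simp add: frontier_eq_empty)
  then obtain x where x: "x \<in> frontier Z" by blast
  define v where "v = x - z"
  have v: "v \<noteq> 0" using z x by (auto simp: v_def frontier_def)
  have mem: "z + s *\<^sub>R v \<in> interior Z" if "0 \<le> s" "s < 1" for s
    using ray_to_frontier_mem[OF z x that] by (simp add: v_def)
  define k where "k = (1 - sqrt \<nu>) / sqrt \<nu>"
  have k: "k > 0" using nu1 by (simp add: k_def)
  define w where "w s = (gradient F (z + s *\<^sub>R v) \<bullet> v) * (1 / sc.N (z + s *\<^sub>R v) v)" for s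
  have wle: "w s \<le> sqrt \<nu>" if s: "0 \<le> s" "s < 1" for s
  proof -
    have "0 < sc.N (z + s *\<^sub>R v) v" using sc.pos_def[OF mem[OF s] v] by (simp add: sc.N_eq mem s)
    then show ?thesis using gradient_inner_le[OF mem[OF s], of v] by (simp add: w_def field_simps abs_le_iff)
  qed
  have inc: "w 0 - k * F (z + 0 *\<^sub>R v) \<le> w s - k * F (z + s *\<^sub>R v)" if s: "0 \<le> s" "s < 1" for s
  proof (rule DERIV_nonneg_imp_nondecreasing[where f = "\<lambda>s. w s - k * F (z + s *\<^sub>R v)"])
    fix \<tau> assume "0 \<le> \<tau>" "\<tau> \<le> s"
    then have \<tau>: "0 \<le> \<tau>" "\<tau> < 1" using s by auto
    note m = mem[OF \<tau>]
    define n where "n = sc.N (z + \<tau> *\<^sub>R v) v"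
    define \<phi> where "\<phi> = gradient F (z + \<tau> *\<^sub>R v) \<bullet> v"
    have n: "0 < n" using sc.pos_def[OF m v] by (simp add: sc.N_eq m n_def)
    have n2: "hessian F (z + \<tau> *\<^sub>R v) v \<bullet> v = n * n" using sc.N_sq[OF m, of v] by (simp add: n_def power2_eq_square)
    have \<phi>: "\<bar>\<phi>\<bar> \<le> sqrt \<nu> * n" using gradient_inner_le[OF m] by (simp add: \<phi>_def n_def)
    obtain D where D: "((\<lambda>\<tau>. 1 / sc.N (z + \<tau> *\<^sub>R v) v) has_real_derivative D) (at \<tau>)" "\<bar>D\<bar> \<le> 1"
      using sc.inverse_N_deriv[OF m v] by blast
    have "(w has_real_derivative ((n * n) * (1 / n) + D * \<phi>)) (at \<tau>)"
      unfolding w_def \<phi>_def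
      using DERIV_mult[OF sc.g_line_deriv[OF m, of v UNIV] D(1)] by (simp add: n2 n_def)
    then have "((\<lambda>s. w s - k * F (z + s *\<^sub>R v)) has_real_derivative ((n * n) * (1 / n) + D * \<phi> - k * \<phi>)) (at \<tau>)"
      unfolding \<phi>_def by (intro DERIV_diff DERIV_cmult sc.F_line_deriv m)
    moreover have "0 \<le> (n * n) * (1 / n) + D * \<phi> - k * \<phi>"
    proof -
      have "\<bar>D * \<phi>\<bar> \<le> 1 * (sqrt \<nu> * n)" unfolding abs_mult using D(2) \<phi> by (intro mult_mono) auto
      moreover have "k * \<phi> \<le> k * (sqrt \<nu> * n)" using k \<phi> by (intro mult_left_mono) auto
      moreover have "k * (sqrt \<nu> * n) = (1 - sqrt \<nu>) * n" using nu1 by (simp add: k_def)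
      moreover have "(n * n) * (1 / n) = n" using n by simp
      ultimately show ?thesis by (simp add: algebra_simps abs_le_iff)
    qed
    ultimately show "\<exists>y. ((\<lambda>s. w s - k * F (z + s *\<^sub>R v)) has_real_derivative y) (at \<tau>) \<and> 0 \<le> y" by blast
  qed (use s in simp)
  have "F (z + s *\<^sub>R v) \<le> (sqrt \<nu> - w 0 + k * F z) / k" if s: "0 \<le> s" "s < 1" for s
    using inc[OF s] wle[OF s] k by (simp add: field_simps)
  then show False using barrier_blow_up[OF z x, of "(sqrt \<nu> - w 0 + k * F z) / k"] unfolding v_def by force
qed

end

section \<open>The generalized Newton step\<close>

lemma cancel_square_le:
  fixes a b x :: real
  assumes "0 \<le> x" "a * x\<^sup>2 \<le> b * x" "0 < a" "0 \<le> b"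
  shows "x \<le> b / a"
proof (cases "x = 0")
  case False
  then have "a * x \<le> b" using assms by (simp add: power2_eq_square mult.assoc[symmetric])
  then show ?thesis using assms by (simp add: field_simps)
qed (use assms in simp)

context self_concordant_inclusion
begin

lemma A_mono: "u \<in> A x \<Longrightarrow> v \<in> A y \<Longrightarrow> 0 \<le> (u - v) \<bullet> (x - y)"
  using A_maximal unfolding maximally_monotone_def monotone_op_def by blast

text \<open>
  Minty's theorem for the operator \<open>t \<nabla>^2 F(z)\<close> shows that the resolvent is defined by a unique point.
\<close>

lemma newton_point_inclusion:
  assumes z: "z \<in> interior Z" and t: "0 < t"
  shows "- (t *\<^sub>R (gradient F z + hessian F z (newton_point F A t z - z))) \<in> A (newton_point F A t z)"
proof -
  interpret K: positive_operator "hessian F z" by (rule sc.positive_operator_H[OF z])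
  interpret tK: positive_operator "\<lambda>u. t *\<^sub>R hessian F z u"
    using t by unfold_locales (auto simp: K.K_simps scaleR_add_right K.sym K.pos)
  define w where "w = z - hessian_inv F z (gradient F z)"
  have eq: "w \<in> {x + (1 / t) *\<^sub>R hessian_inv F z a | a. a \<in> A x} \<longleftrightarrow> t *\<^sub>R hessian F z (w - x) \<in> A x" for x
  proof
    assume "w \<in> {x + (1 / t) *\<^sub>R hessian_inv F z a | a. a \<in> A x}"
    then obtain a where a: "a \<in> A x" "w = x + (1 / t) *\<^sub>R hessian_inv F z a" by blast
    have "t *\<^sub>R hessian F z (w - x) = a" using t unfolding a(2) hessian_inv_def by (simp add: K.K_simps K.K_inv)
    then show "t *\<^sub>R hessian F z (w - x) \<in> A x" using a(1) by simp
  next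
    assume "t *\<^sub>R hessian F z (w - x) \<in> A x"
    moreover have "w = x + (1 / t) *\<^sub>R hessian_inv F z (t *\<^sub>R hessian F z (w - x))"
      using t unfolding hessian_inv_def by (simp add: K.inv_cmul K.inv_K)
    ultimately show "w \<in> {x + (1 / t) *\<^sub>R hessian_inv F z a | a. a \<in> A x}" by blast
  qed
  have "dom_op A \<noteq> {}" using interior_dom_nonempty by blast
  then obtain x where x: "t *\<^sub>R hessian F z (w - x) \<in> A x" using tK.Minty[OF A_maximal] by blast
  have "newton_point F A t z = x"
    unfolding newton_point_def scaled_resolvent_def w_def[symmetric] eq
  proof (rule the_equality[of _ x])
    fix y assume "t *\<^sub>R hessian F z (w - y) \<in> A y"
    then show "y = x" using tK.Minty_unique[of A w y x] x A_maximal by (simp add: maximally_monotone_def)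
  qed (rule x)
  moreover have "t *\<^sub>R hessian F z (w - x) = - (t *\<^sub>R (gradient F z + hessian F z (x - z)))"
    unfolding w_def hessian_inv_def by (simp add: K.K_simps K.K_inv algebra_simps)
  ultimately show ?thesis using x by simp
qed

lemma newton_decrement_eq:
  "z \<in> interior Z \<Longrightarrow> newton_decrement F A t z = sc.N z (newton_point F A t z - z)"
  unfolding newton_decrement_def
  by (simp add: local_norm_eq sc.N_def positive_operator.nrm_minus_commute[OF sc.positive_operator_H])

lemma approx_newton_pointD:
  assumes z: "z \<in> interior Z" and ap: "approx_newton_point F A t \<delta> z zp"
  obtains a e where "a \<in> A zp" "e = t *\<^sub>R (gradient F z + hessian F z (zp - z)) + a" "sc.Nd z e \<le> t * \<delta>"
proof -
  define w where "w = t *\<^sub>R (gradient F z + hessian F z (zp - z))"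
  have "{w + a | a. a \<in> A zp} = (+) w ` A zp" by auto
  then have "closed {w + a | a. a \<in> A zp}"
    by (simp add: closed_translation maximally_monotone_closed_values[OF A_maximal])
  moreover have "(INF e\<in>{w + a | a. a \<in> A zp}. ereal (sc.Nd z e)) \<le> ereal (t * \<delta>)"
    using ap unfolding approx_newton_point_def local_dist_def w_def by (simp add: dual_local_norm_eq[OF z])
  ultimately have "\<exists>e\<in>{w + a | a. a \<in> A zp}. sc.Nd z e \<le> t * \<delta>"
    unfolding sc.Nd_def by (rule positive_operator.inf_dual_norm_attained[OF sc.positive_operator_H[OF z]])
  then show ?thesis using that unfolding w_def by blast
qed

text \<open>
  Monotonicity of \<open>A\<close> at the Newton points for \<open>t\<close> and \<open>t' = (1 - \<sigma>) t\<close> bounds their distance by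
  \<open>\<sigma> (\<surd>\<nu> + \<beta>) / (1 - \<sigma>)\<close>; the rest is the triangle inequality.
\<close>

lemma newton_decrement_parameter_update:
  assumes z: "z \<in> interior Z" and t: "0 < t" and \<sigma>: "0 < \<sigma>" "\<sigma> < 1"
    and \<beta>: "newton_decrement F A t z \<le> \<beta>"
  shows "newton_decrement F A ((1 - \<sigma>) * t) z \<le> (\<beta> + \<sigma> * sqrt \<nu>) / (1 - \<sigma>)"
proof -
  interpret K: positive_operator "hessian F z" by (rule sc.positive_operator_H[OF z])
  define t' where "t' = (1 - \<sigma>) * t"
  have t': "0 < t'" using t \<sigma> by (simp add: t'_def)
  define p where "p = newton_point F A t z"
  define p' where "p' = newton_point F A t' z"
  define g where "g = gradient F z"
  define e where "e = p' - p"
  have lam: "sc.N z (p - z) \<le> \<beta>" using \<beta> by (simp add: newton_decrement_eq z p_def)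
  have "0 \<le> (- (t' *\<^sub>R (g + hessian F z (p' - z))) - - (t *\<^sub>R (g + hessian F z (p - z)))) \<bullet> (p' - p)"
    unfolding p_def p'_def g_def by (intro A_mono newton_point_inclusion z t t')
  also have "- (t' *\<^sub>R (g + hessian F z (p' - z))) - - (t *\<^sub>R (g + hessian F z (p - z))) =
      (\<sigma> * t) *\<^sub>R (g + hessian F z (p - z)) - t' *\<^sub>R hessian F z e"
    by (simp add: e_def t'_def K.K_simps algebra_simps)
  finally have "t' * (hessian F z e \<bullet> e) \<le> (\<sigma> * t) * ((g + hessian F z (p - z)) \<bullet> e)"
    by (simp add: e_def[symmetric] inner_diff_left)
  also have "\<dots> \<le> (\<sigma> * t) * ((sqrt \<nu> + \<beta>) * sc.N z e)"
  proof (intro mult_left_mono)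
    have "g \<bullet> e \<le> sqrt \<nu> * sc.N z e" using gradient_inner_le[OF z, of e] by (simp add: g_def)
    moreover have "hessian F z (p - z) \<bullet> e \<le> sc.N z (p - z) * sc.N z e"
      using K.Cauchy_Schwarz[of "p - z" e] by (simp add: sc.N_def)
    moreover have "sc.N z (p - z) * sc.N z e \<le> \<beta> * sc.N z e"
      using lam sc.N_nonneg[OF z] by (intro mult_right_mono)
    ultimately show "(g + hessian F z (p - z)) \<bullet> e \<le> (sqrt \<nu> + \<beta>) * sc.N z e"
      by (simp add: inner_add_left algebra_simps)
  qed (use t \<sigma> in simp)
  finally have "t' * (sc.N z e)\<^sup>2 \<le> (\<sigma> * t * (sqrt \<nu> + \<beta>)) * sc.N z e" by (simp add: sc.N_sq[OF z])
  moreover have \<beta>0: "0 \<le> \<beta>" using lam sc.N_nonneg[OF z, of "p - z"] by linarith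
  ultimately have "sc.N z e \<le> (\<sigma> * t * (sqrt \<nu> + \<beta>)) / t'"
    using t t' \<sigma> nu_pos sc.N_nonneg[OF z] by (intro cancel_square_le) auto
  also have "\<dots> = \<sigma> * (sqrt \<nu> + \<beta>) / (1 - \<sigma>)" using t by (simp add: t'_def)
  finally have "sc.N z e \<le> \<sigma> * (sqrt \<nu> + \<beta>) / (1 - \<sigma>)" .
  moreover have "sc.N z (p' - z) \<le> sc.N z (p - z) + sc.N z e"
    using K.nrm_triangle[of "p - z" e] by (simp add: sc.N_def e_def)
  ultimately have "sc.N z (p' - z) \<le> \<beta> + \<sigma> * (sqrt \<nu> + \<beta>) / (1 - \<sigma>)" using lam by linarith
  also have "\<dots> = (\<beta> + \<sigma> * sqrt \<nu>) / (1 - \<sigma>)" using \<sigma> by (simp add: field_simps)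
  finally show ?thesis by (simp add: newton_decrement_eq z p'_def t'_def)
qed

text \<open>
  Monotonicity at \<open>zp\<close> and at the exact Newton point puts them within local distance \<open>\<delta>\<close>.
\<close>

lemma approx_newton_distance:
  assumes z: "z \<in> interior Z" and t: "0 < t" and \<delta>: "0 \<le> \<delta>"
    and a: "a \<in> A zp" and e: "e = t *\<^sub>R (gradient F z + hessian F z (zp - z)) + a" "sc.Nd z e \<le> t * \<delta>"
  shows "sc.N z (zp - z) \<le> newton_decrement F A t z + \<delta>"
proof -
  interpret K: positive_operator "hessian F z" by (rule sc.positive_operator_H[OF z])
  define p where "p = newton_point F A t z"
  have "0 \<le> (a - - (t *\<^sub>R (gradient F z + hessian F z (p - z)))) \<bullet> (zp - p)"
    unfolding p_def by (intro A_mono a newton_point_inclusion z t)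
  also have "a - - (t *\<^sub>R (gradient F z + hessian F z (p - z))) = e - t *\<^sub>R hessian F z (zp - p)"
    unfolding e(1) by (simp add: K.K_simps algebra_simps)
  finally have "t * (sc.N z (zp - p))\<^sup>2 \<le> e \<bullet> (zp - p)"
    by (simp add: sc.N_sq[OF z] inner_diff_left)
  also have "\<dots> \<le> sc.Nd z e * sc.N z (zp - p)"
    using K.dual_pairing[of e "zp - p"] by (simp add: sc.N_def sc.Nd_def)
  also have "\<dots> \<le> (t * \<delta>) * sc.N z (zp - p)" by (intro mult_right_mono e sc.N_nonneg z)
  finally have "sc.N z (zp - p) \<le> (t * \<delta>) / t"
    using t \<delta> sc.N_nonneg[OF z] by (intro cancel_square_le) auto
  then have "sc.N z (zp - p) \<le> \<delta>" using t by simp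
  moreover have "sc.N z (zp - z) \<le> sc.N z (p - z) + sc.N z (zp - p)"
    using K.nrm_triangle[of "p - z" "zp - p"] by (simp add: sc.N_def)
  ultimately show ?thesis by (simp add: newton_decrement_eq z p_def)
qed

text \<open>
  The residual \<open>e\<close> at \<open>z\<close> rewrites \<open>a\<close> as the linearization at \<open>zp\<close> plus \<open>e\<close> and the linearization error of the gradient.
  Monotonicity at \<open>zp\<close> and its own Newton point bounds the new decrement by the dual norms of these two terms;
  passing from the dual norm at \<open>z\<close> to the one at \<open>zp\<close> costs the factor \<open>1 / (1 - r)\<close>.
\<close>

lemma newton_decrement_after_step:
  assumes z: "z \<in> interior Z" and t: "0 < t" and \<delta>: "0 \<le> \<delta>"
    and a: "a \<in> A zp" and e: "e = t *\<^sub>R (gradient F z + hessian F z (zp - z)) + a" "sc.Nd z e \<le> t * \<delta>"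
    and r: "sc.N z (zp - z) = r" "r < 1"
  shows "zp \<in> interior Z"
    and "newton_decrement F A t zp \<le> (r / (1 - r))\<^sup>2 + \<delta> / (1 - r)"
    and "sc.Nd zp a \<le> t * ((sqrt \<nu> + r + \<delta>) / (1 - r))"
proof -
  interpret K: positive_operator "hessian F z" by (rule sc.positive_operator_H[OF z])
  define d where "d = zp - z"
  have zp_eq: "zp = z + d" by (simp add: d_def)
  have rd: "sc.N z d = r" "sc.N z d < 1" using r by (auto simp: d_def)
  have r0: "0 \<le> r" using rd sc.N_nonneg[OF z, of d] by simp
  show zp: "zp \<in> interior Z" unfolding zp_eq by (rule Dikin_ellipsoid[OF z rd(2)])
  interpret Kp: positive_operator "hessian F zp" by (rule sc.positive_operator_H[OF zp])
  have dual: "sc.Nd zp v \<le> sc.Nd z v / (1 - r)" for v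
    using sc.Nd_comparison[OF z zp[unfolded zp_eq] rd(2), of v] unfolding zp_eq[symmetric] rd .
  define err where "err = gradient F zp - gradient F z - hessian F z d"
  have "sc.Nd z err \<le> r\<^sup>2 / (1 - r)"
    using sc.gradient_linearization_error[OF z zp[unfolded zp_eq] rd(2)] unfolding zp_eq[symmetric] rd err_def .
  then have "sc.Nd z err / (1 - r) \<le> r\<^sup>2 / (1 - r) / (1 - r)" using r by (intro divide_right_mono) auto
  with dual[of err] have err: "sc.Nd zp err \<le> (r / (1 - r))\<^sup>2" by (simp add: power2_eq_square)
  have "sc.Nd z e / (1 - r) \<le> t * \<delta> / (1 - r)" using e r by (intro divide_right_mono) auto
  with dual[of e] have ep: "sc.Nd zp e \<le> t * (\<delta> / (1 - r))" by simp
  define y where "y = newton_point F A t zp"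
  define B where "B = (r / (1 - r))\<^sup>2 + \<delta> / (1 - r)"
  have "0 \<le> (- (t *\<^sub>R (gradient F zp + hessian F zp (y - zp))) - a) \<bullet> (y - zp)"
    unfolding y_def by (intro A_mono a newton_point_inclusion zp t)
  also have "- (t *\<^sub>R (gradient F zp + hessian F zp (y - zp))) - a = - (t *\<^sub>R err + e) - t *\<^sub>R hessian F zp (y - zp)"
    unfolding e(1) err_def d_def by (simp add: algebra_simps)
  finally have "t * (sc.N zp (y - zp))\<^sup>2 \<le> - (t *\<^sub>R err + e) \<bullet> (y - zp)"
    by (simp add: sc.N_sq[OF zp] inner_diff_left)
  also have "\<dots> \<le> sc.Nd zp (t *\<^sub>R err + e) * sc.N zp (y - zp)"
    using Kp.dual_pairing[of "t *\<^sub>R err + e" "y - zp"] unfolding inner_minus_left sc.N_def sc.Nd_def by linarith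
  also have "\<dots> \<le> (t * B) * sc.N zp (y - zp)"
  proof (intro mult_right_mono sc.N_nonneg zp)
    have "sc.Nd zp (t *\<^sub>R err + e) \<le> t * sc.Nd zp err + sc.Nd zp e"
      using Kp.dnrm_triangle[of "t *\<^sub>R err" e] t by (simp add: sc.Nd_def Kp.dnrm_scale)
    also have "\<dots> \<le> t * (r / (1 - r))\<^sup>2 + t * (\<delta> / (1 - r))"
      using err ep t by (intro add_mono mult_left_mono) auto
    finally show "sc.Nd zp (t *\<^sub>R err + e) \<le> t * B" by (simp add: B_def distrib_left)
  qed
  finally have "sc.N zp (y - zp) \<le> (t * B) / t"
    using t \<delta> r r0 sc.N_nonneg[OF zp] by (intro cancel_square_le) (auto simp: B_def)
  then show "newton_decrement F A t zp \<le> (r / (1 - r))\<^sup>2 + \<delta> / (1 - r)"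
    using t by (simp add: newton_decrement_eq zp y_def B_def)
  have "a = e + - (t *\<^sub>R (gradient F z + hessian F z d))" by (simp add: e(1) d_def)
  then have "sc.Nd z a \<le> sc.Nd z e + t * sc.Nd z (gradient F z + hessian F z d)"
    using K.dnrm_triangle[of e "- (t *\<^sub>R (gradient F z + hessian F z d))"] t
    by (simp add: sc.Nd_def K.dnrm_minus K.dnrm_scale)
  also have "\<dots> \<le> t * \<delta> + t * (sqrt \<nu> + r)"
  proof (intro add_mono mult_left_mono e)
    have "sc.Nd z (gradient F z + hessian F z d) \<le> sc.Nd z (gradient F z) + sc.N z d"
      using K.dnrm_triangle[of "gradient F z" "hessian F z d"] by (simp add: sc.Nd_def sc.N_def K.dnrm_K)
    then show "sc.Nd z (gradient F z + hessian F z d) \<le> sqrt \<nu> + r"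
      using gradient_dual_norm_le[OF z] rd by linarith
  qed (use t in simp)
  also have "\<dots> = t * (sqrt \<nu> + r + \<delta>)" by (simp add: algebra_simps)
  finally have "sc.Nd z a / (1 - r) \<le> t * (sqrt \<nu> + r + \<delta>) / (1 - r)" using r by (intro divide_right_mono) auto
  with dual[of a] show "sc.Nd zp a \<le> t * ((sqrt \<nu> + r + \<delta>) / (1 - r))" by simp
qed

end

section \<open>Complexity of the path-following scheme\<close>

text \<open>
  The bound on the decrement of the old point for the new parameter.
\<close>

definition centring_radius :: "real \<Rightarrow> real \<Rightarrow> real" where
  "centring_radius c \<beta> = c * sqrt \<beta> / (1 + c * sqrt \<beta>)"

locale admissible_parameters =
  fixes c \<beta> :: real
  assumes c: "0 < c" "c \<le> 1" and \<beta>0: "0 < \<beta>"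
    and \<beta>: "\<beta> < 0.5 * (1 + 2 * c\<^sup>2 - sqrt (1 + 4 * c\<^sup>2))"
begin

abbreviation "\<kappa> \<equiv> centring_radius c \<beta>"

text \<open>
  The hypothesis on \<open>\<beta>\<close> is this inequality solved for \<open>\<beta>\<close>.
\<close>

lemma beta_add_sqrt_less: "\<beta> + sqrt \<beta> < c\<^sup>2"
proof -
  have lt: "sqrt (1 + 4 * c\<^sup>2) < 1 + 2 * c\<^sup>2 - 2 * \<beta>" using \<beta> by simp
  have "1 \<le> sqrt (1 + 4 * c\<^sup>2)" by simp
  with lt have pos: "\<beta> < c\<^sup>2" by linarith
  have "(sqrt (1 + 4 * c\<^sup>2))\<^sup>2 < (1 + 2 * c\<^sup>2 - 2 * \<beta>)\<^sup>2"
    using lt by (intro power_strict_mono) auto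
  then have "(sqrt \<beta>)\<^sup>2 < (c\<^sup>2 - \<beta>)\<^sup>2"
    using \<beta>0 by (simp add: power2_eq_square algebra_simps)
  then have "sqrt \<beta> < c\<^sup>2 - \<beta>" by (rule power_less_imp_less_base) (use pos in simp)
  then show ?thesis by simp
qed

lemma c_sqrt_beta_pos: "0 < c * sqrt \<beta>" using c \<beta>0 by simp

lemma beta_le_c_sqrt_beta: "\<beta> \<le> c * sqrt \<beta>"
proof -
  have "c\<^sup>2 \<le> c" using c mult_right_mono[of c 1 c] by (simp add: power2_eq_square)
  then have "sqrt \<beta> \<le> c" using beta_add_sqrt_less \<beta>0 by linarith
  then have "sqrt \<beta> * sqrt \<beta> \<le> c * sqrt \<beta>" using \<beta>0 by (intro mult_right_mono) auto
  then show ?thesis using \<beta>0 by simp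
qed

lemma beta_less_1: "\<beta> < 1"
proof -
  have "c\<^sup>2 \<le> 1" using c by (simp add: power_le_one)
  then show ?thesis using beta_add_sqrt_less \<beta>0 real_sqrt_gt_zero[OF \<beta>0] by linarith
qed

lemma kappa_bounds: "\<beta> < \<kappa>" "0 < \<kappa>" "\<kappa> < 1"
proof -
  have x: "0 < c * sqrt \<beta>" by (rule c_sqrt_beta_pos)
  have s0: "0 < sqrt \<beta>" "sqrt \<beta> * sqrt \<beta> = \<beta>" using \<beta>0 by auto
  have "\<beta> * (1 + c * sqrt \<beta>) < c * sqrt \<beta>"
  proof -
    have "sqrt \<beta> + c * \<beta> < c"
    proof -
      have "\<beta> * (1 - c) \<ge> 0" using \<beta>0 c by simp
      moreover have "c\<^sup>2 \<le> c" using c mult_right_mono[of c 1 c] by (simp add: power2_eq_square)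
      ultimately show ?thesis using beta_add_sqrt_less by (simp add: algebra_simps)
    qed
    then have "sqrt \<beta> * (sqrt \<beta> + c * \<beta>) < sqrt \<beta> * c" using s0 by (intro mult_strict_left_mono)
    moreover have "sqrt \<beta> * (sqrt \<beta> + c * \<beta>) = \<beta> * (1 + c * sqrt \<beta>)" using s0 by (simp add: algebra_simps)
    ultimately show ?thesis by (simp add: mult.commute)
  qed
  then show "\<beta> < \<kappa>" using x by (simp add: centring_radius_def field_simps)
  show "0 < \<kappa>" "\<kappa> < 1" using x by (auto simp: centring_radius_def field_simps)
qed

lemma sigma_bar_eq: "sigma_bar c \<beta> \<nu> = (\<kappa> - \<beta>) / (sqrt \<nu> + \<kappa>)"
proof -
  define X where "X = 1 + c * sqrt \<beta>"
  have X: "0 < X" using c_sqrt_beta_pos by (simp add: X_def)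
  have k: "c * sqrt \<beta> = X * \<kappa>" using X by (simp add: centring_radius_def X_def)
  have "sigma_bar c \<beta> \<nu> = (X * (\<kappa> - \<beta>)) / (X * (sqrt \<nu> + \<kappa>))"
    unfolding sigma_bar_def X_def[symmetric] by (simp add: k algebra_simps)
  then show ?thesis using X by simp
qed

lemma delta_bar_nonneg: "0 \<le> delta_bar c \<beta>"
  unfolding delta_bar_def using c_sqrt_beta_pos \<beta>0 c
  by (intro divide_nonneg_nonneg mult_nonneg_nonneg add_nonneg_nonneg zero_le_power) (auto simp: power_le_one)

text \<open>
  With \<open>x = c\<surd>\<beta>\<close>, \<open>X = 1 + x\<close> and \<open>D = X \<delta>\<close>, the radius satisfies \<open>r / (1 - r) \<le> (x + D) / (1 - D)\<close>, because \<open>\<kappa> = x / X\<close>.  Without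
  errors the new decrement would be at most \<open>x^2 = c^2 \<beta>\<close>; the tolerance is small enough for the terms in \<open>D\<close> to
  fit into the remaining \<open>(1 - c^2) \<beta>\<close>.
\<close>

lemma inexact_step_bound:
  assumes \<delta>: "0 \<le> \<delta>" "\<delta> \<le> delta_bar c \<beta>" and r: "0 \<le> r" "r \<le> \<kappa> + \<delta>"
  shows "r < 1" and "(r / (1 - r))\<^sup>2 + \<delta> / (1 - r) \<le> \<beta>"
proof -
  define x where "x = c * sqrt \<beta>"
  define X where "X = 1 + x"
  define D where "D = X * \<delta>"
  have x: "0 < x" using c_sqrt_beta_pos by (simp add: x_def)
  have X: "1 < X" using x by (simp add: X_def)
  have x2: "x\<^sup>2 = c\<^sup>2 * \<beta>" using \<beta>0 by (simp add: x_def power_mult_distrib)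
  have D0: "0 \<le> D" using \<delta> X by (simp add: D_def)
  define Q where "Q = X\<^sup>2 * (3 * x + x\<^sup>2 + X ^ 3)"
  have Q: "1 + 2 * x + 2 * \<beta> \<le> Q"
  proof -
    have "1 + 3 * x \<le> X ^ 3"
      using x by (simp add: X_def power3_eq_cube algebra_simps)
    then have "1 + 4 * x \<le> 3 * x + x\<^sup>2 + X ^ 3" using x by (auto intro: add_increasing add_increasing2)
    also have "\<dots> \<le> Q"
      unfolding Q_def using X x mult_right_mono[of 1 "X\<^sup>2" "3 * x + x\<^sup>2 + X ^ 3"] by (simp add: one_le_power)
    finally show ?thesis using beta_le_c_sqrt_beta by (simp add: x_def)
  qed
  have Q1: "1 \<le> Q" using Q x \<beta>0 by linarith
  have DQ: "D * Q \<le> (1 - c\<^sup>2) * \<beta>"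
  proof -
    define Q' where "Q' = X ^ 3 * (3 * x + x\<^sup>2 + X ^ 3)"
    have Q': "0 < Q'" using X x unfolding Q'_def by (intro mult_pos_pos add_pos_pos) auto
    have "\<delta> \<le> (1 - c\<^sup>2) * \<beta> / Q'"
      using \<delta>(2) unfolding delta_bar_def Q'_def X_def x2 by (simp add: x_def mult.assoc)
    then have "\<delta> * Q' \<le> (1 - c\<^sup>2) * \<beta>" using Q' by (simp add: pos_le_divide_eq)
    moreover have "\<delta> * Q' = D * Q" by (simp add: D_def Q_def Q'_def power2_eq_square power3_eq_cube mult_ac)
    ultimately show ?thesis by simp
  qed
  have "D \<le> D * Q" using mult_left_mono[OF Q1 D0] by simp
  also have "D * Q \<le> (1 - c\<^sup>2) * \<beta>" by (rule DQ)
  also have "\<dots> \<le> \<beta>" using c \<beta>0 by (simp add: algebra_simps)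
  finally have D1: "D < 1" using beta_less_1 by simp
  have "D * (1 + 2 * x + 2 * \<beta>) \<le> D * Q" using Q D0 by (rule mult_left_mono)
  then have "D * (1 + 2 * x + 2 * \<beta>) \<le> (1 - c\<^sup>2) * \<beta>" using DQ by linarith
  then have key: "(x + D)\<^sup>2 + D * (1 - D) \<le> \<beta> * (1 - D)\<^sup>2"
  proof -
    have "(x + D)\<^sup>2 + D * (1 - D) = x\<^sup>2 + D * (1 + 2 * x + 2 * \<beta>) - 2 * \<beta> * D"
      by (simp add: power2_eq_square algebra_simps)
    also have "\<dots> \<le> \<beta> - 2 * \<beta> * D"
      using \<open>D * (1 + 2 * x + 2 * \<beta>) \<le> (1 - c\<^sup>2) * \<beta>\<close> x2 by (simp add: algebra_simps)
    also have "\<dots> \<le> \<beta> * (1 - D)\<^sup>2"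
      using \<beta>0 mult_nonneg_nonneg[of \<beta> "D * D"] by (simp add: power2_eq_square algebra_simps)
    finally show ?thesis .
  qed
  have kap: "\<kappa> = x / X" by (simp add: centring_radius_def x_def X_def)
  have rle: "r \<le> (x + D) / X" using r X by (simp add: kap D_def field_simps)
  have rle': "(1 - D) / X \<le> 1 - r"
    using rle X by (simp add: X_def field_simps)
  have p: "0 < (1 - D) / X" using D1 X by simp
  then show r1: "r < 1" using rle' by linarith
  have "r / (1 - r) \<le> ((x + D) / X) / ((1 - D) / X)"
    using rle rle' p r by (intro frac_le) auto
  then have 1: "r / (1 - r) \<le> (x + D) / (1 - D)" using X by simp
  have "\<delta> / (1 - r) \<le> \<delta> / ((1 - D) / X)"
    using rle' p \<delta> by (intro frac_le) auto
  then have 2: "\<delta> / (1 - r) \<le> D / (1 - D)" by (simp add: D_def mult.commute)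
  have "(r / (1 - r))\<^sup>2 \<le> ((x + D) / (1 - D))\<^sup>2"
    using 1 r r1 by (intro power_mono) auto
  with 2 have "(r / (1 - r))\<^sup>2 + \<delta> / (1 - r) \<le> ((x + D) / (1 - D))\<^sup>2 + D / (1 - D)" by linarith
  also have "D / (1 - D) = D * (1 - D) / (1 - D)\<^sup>2"
    using D1 by (simp add: power2_eq_square)
  also have "((x + D) / (1 - D))\<^sup>2 + D * (1 - D) / (1 - D)\<^sup>2 = ((x + D)\<^sup>2 + D * (1 - D)) / (1 - D)\<^sup>2"
    unfolding power_divide by (rule add_divide_distrib[symmetric])
  also have "\<dots> \<le> \<beta>" using key D1 by (simp add: pos_divide_le_eq)
  finally show "(r / (1 - r))\<^sup>2 + \<delta> / (1 - r) \<le> \<beta>" .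
qed

lemma radius_less_1: "\<kappa> + delta_bar c \<beta> < 1"
  using inexact_step_bound(1)[of "delta_bar c \<beta>" "\<kappa> + delta_bar c \<beta>"] delta_bar_nonneg kappa_bounds by simp

lemma M0_eq: "M0 c \<beta> \<nu> = (sqrt \<nu> + \<kappa> + 2 * delta_bar c \<beta>) / (1 - \<kappa> - delta_bar c \<beta>)"
  by (simp add: M0_def centring_radius_def divide_inverse mult.commute)

lemma M0_pos: "0 < \<nu> \<Longrightarrow> 0 < M0 c \<beta> \<nu>"
  unfolding M0_eq using radius_less_1 kappa_bounds(2) delta_bar_nonneg real_sqrt_gt_zero[of \<nu>]
  by (intro divide_pos_pos; linarith)

lemma parameter_update_within_radius:
  assumes \<nu>: "0 < \<nu>" and \<sigma>: "0 < \<sigma>" "\<sigma> \<le> sigma_bar c \<beta> \<nu>"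
  shows "\<sigma> < 1" and "(\<beta> + \<sigma> * sqrt \<nu>) / (1 - \<sigma>) \<le> \<kappa>"
proof -
  have q: "0 < sqrt \<nu> + \<kappa>" using \<nu> kappa_bounds by (simp add: add_pos_pos)
  have s: "\<sigma> * (sqrt \<nu> + \<kappa>) \<le> \<kappa> - \<beta>" using \<sigma>(2) q by (simp add: sigma_bar_eq pos_le_divide_eq)
  have "\<kappa> - \<beta> < sqrt \<nu> + \<kappa>" using \<beta>0 real_sqrt_gt_zero[OF \<nu>] by linarith
  with s have "\<sigma> * (sqrt \<nu> + \<kappa>) < sqrt \<nu> + \<kappa>" by linarith
  then show \<sigma>1: "\<sigma> < 1" using q mult_less_cancel_right_pos[OF q, of \<sigma> 1] by simp
  show "(\<beta> + \<sigma> * sqrt \<nu>) / (1 - \<sigma>) \<le> \<kappa>"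
    using s \<sigma>1 by (simp add: pos_divide_le_eq algebra_simps)
qed

lemma path_following_invariant:
  assumes incl: "self_concordant_inclusion Z F \<nu> A"
    and seq: "pfgn_sequence Z F \<nu> A c \<beta> \<sigma> \<delta> z t"
  shows "z k \<in> interior Z \<and> 0 < t k \<and> newton_decrement F A (t k) (z k) \<le> \<beta>"
    and "local_dist F (z (Suc k)) (A (z (Suc k))) \<le> ereal (M0 c \<beta> \<nu> * t (Suc k))"
proof -
  interpret self_concordant_inclusion Z F \<nu> A by (rule incl)
  have \<sigma>: "0 < \<sigma>" "\<sigma> \<le> sigma_bar c \<beta> \<nu>" and \<delta>: "\<And>k. 0 \<le> \<delta> k" "\<And>k. \<delta> k \<le> delta_bar c \<beta>"
    and init: "z 0 \<in> interior Z" "0 < t 0" "newton_decrement F A (t 0) (z 0) \<le> \<beta>"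
    and upd: "\<And>k. t (Suc k) = (1 - \<sigma>) * t k"
    and appr: "\<And>k. approx_newton_point F A (t (Suc k)) (\<delta> k) (z k) (z (Suc k))"
    using seq unfolding pfgn_sequence_def by auto
  have \<sigma>1: "\<sigma> < 1" by (rule parameter_update_within_radius[OF nu_pos \<sigma>])
  have step: "z (Suc k) \<in> interior Z \<and> 0 < t (Suc k) \<and> newton_decrement F A (t (Suc k)) (z (Suc k)) \<le> \<beta> \<and>
     local_dist F (z (Suc k)) (A (z (Suc k))) \<le> ereal (M0 c \<beta> \<nu> * t (Suc k))"
    if zk: "z k \<in> interior Z" "0 < t k" "newton_decrement F A (t k) (z k) \<le> \<beta>" for k
  proof -
    have t: "0 < t (Suc k)" using \<sigma>1 zk by (simp add: upd)
    obtain a e where a: "a \<in> A (z (Suc k))"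
      "e = t (Suc k) *\<^sub>R (gradient F (z k) + hessian F (z k) (z (Suc k) - z k)) + a" "sc.Nd (z k) e \<le> t (Suc k) * \<delta> k"
      using approx_newton_pointD[OF zk(1) appr] .
    define r where "r = sc.N (z k) (z (Suc k) - z k)"
    have "r \<le> newton_decrement F A (t (Suc k)) (z k) + \<delta> k"
      unfolding r_def by (rule approx_newton_distance[OF zk(1) t \<delta>(1) a])
    moreover have "newton_decrement F A (t (Suc k)) (z k) \<le> \<kappa>"
      using newton_decrement_parameter_update[OF zk(1,2) \<sigma>(1) \<sigma>1 zk(3)]
        parameter_update_within_radius(2)[OF nu_pos \<sigma>] by (simp add: upd)
    ultimately have r: "0 \<le> r" "r \<le> \<kappa> + \<delta> k" using sc.N_nonneg[OF zk(1)] by (auto simp: r_def)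
    note rb = inexact_step_bound[OF \<delta> r]
    note after = newton_decrement_after_step[OF zk(1) t \<delta>(1) a r_def[symmetric] rb(1)]
    have "(sqrt \<nu> + r + \<delta> k) / (1 - r) \<le> M0 c \<beta> \<nu>"
      unfolding M0_eq using r \<delta>[of k] radius_less_1 nu_pos kappa_bounds by (intro frac_le) auto
    then have "t (Suc k) * ((sqrt \<nu> + r + \<delta> k) / (1 - r)) \<le> t (Suc k) * M0 c \<beta> \<nu>" using t by (intro mult_left_mono) auto
    with after(3) have "sc.Nd (z (Suc k)) a \<le> M0 c \<beta> \<nu> * t (Suc k)" by (simp add: mult.commute)
    then have "local_dist F (z (Suc k)) (A (z (Suc k))) \<le> ereal (M0 c \<beta> \<nu> * t (Suc k))"
      unfolding local_dist_def using a(1) by (intro INF_lower2[of a]) (auto simp: dual_local_norm_eq[OF after(1)])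
    then show ?thesis using after(1,2) t rb(2) by auto
  qed
  have inv: "z k \<in> interior Z \<and> 0 < t k \<and> newton_decrement F A (t k) (z k) \<le> \<beta>" for k
    by (induction k) (use init step in auto)
  show "z k \<in> interior Z \<and> 0 < t k \<and> newton_decrement F A (t k) (z k) \<le> \<beta>" by (rule inv)
  show "local_dist F (z (Suc k)) (A (z (Suc k))) \<le> ereal (M0 c \<beta> \<nu> * t (Suc k))" using step inv by blast
qed

text \<open>
  The residual bound comes from a Newton step and says nothing about \<open>z 0\<close>, hence at least one iteration.
\<close>

lemma iteration_bound:
  assumes incl: "self_concordant_inclusion Z F \<nu> A"
    and seq: "pfgn_sequence Z F \<nu> A c \<beta> \<sigma> \<delta> z t" and \<epsilon>: "0 < \<epsilon>"
  shows "\<exists>k. int k \<le> max 1 (\<lfloor>1 / \<sigma> * ln (M0 c \<beta> \<nu> * t 0 / \<epsilon>)\<rfloor> + 1) \<and> eps_solution Z F A \<epsilon> (z k)"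
proof -
  interpret self_concordant_inclusion Z F \<nu> A by (rule incl)
  have \<sigma>: "0 < \<sigma>" "\<sigma> \<le> sigma_bar c \<beta> \<nu>" and t0: "0 < t 0"
    and upd: "\<And>k. t (Suc k) = (1 - \<sigma>) * t k"
    using seq unfolding pfgn_sequence_def by auto
  have \<sigma>1: "\<sigma> < 1" by (rule parameter_update_within_radius[OF nu_pos \<sigma>])
  have tk: "t k = (1 - \<sigma>) ^ k * t 0" for k by (induction k) (auto simp: upd)
  define Q where "Q = M0 c \<beta> \<nu> * t 0 / \<epsilon>"
  have Q: "0 < Q" using M0_pos[OF nu_pos] t0 \<epsilon> by (simp add: Q_def)
  define m where "m = max 1 (\<lfloor>1 / \<sigma> * ln Q\<rfloor> + 1)"
  define k where "k = nat m"
  have k: "int k = m" "k \<noteq> 0" by (auto simp: k_def m_def)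
  then obtain j where j: "k = Suc j" using not0_implies_Suc by blast
  have "1 / \<sigma> * ln Q \<le> real_of_int (\<lfloor>1 / \<sigma> * ln Q\<rfloor> + 1)" by linarith
  also have "\<dots> \<le> real_of_int m" unfolding m_def by (simp only: of_int_le_iff max.cobounded2)
  also have "\<dots> = real k" using k(1) by (metis of_int_of_nat_eq)
  finally have "ln Q \<le> \<sigma> * real k" using \<sigma>(1) by (simp add: field_simps)
  then have "exp (ln Q) \<le> exp (\<sigma> * real k)" by simp
  then have Qle: "Q \<le> exp (\<sigma> * real k)" using Q by simp
  have "(1 - \<sigma>) ^ k \<le> exp (- \<sigma>) ^ k"
    using \<sigma>1 exp_ge_add_one_self[of "- \<sigma>"] by (intro power_mono) auto
  also have "\<dots> = inverse (exp (\<sigma> * real k))"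
    by (simp add: exp_of_nat_mult[symmetric] exp_minus[symmetric] mult.commute)
  also have "\<dots> \<le> inverse Q" using Qle Q by (intro le_imp_inverse_le)
  finally have "Q * (1 - \<sigma>) ^ k \<le> 1" using Q by (simp add: field_simps)
  then have "\<epsilon> * (Q * (1 - \<sigma>) ^ k) \<le> \<epsilon>" using \<epsilon> by simp
  moreover have "\<epsilon> * (Q * (1 - \<sigma>) ^ k) = M0 c \<beta> \<nu> * t k" using \<epsilon> by (simp add: Q_def tk[of k])
  ultimately have "ereal (M0 c \<beta> \<nu> * t k) \<le> ereal \<epsilon>" by simp
  then have "local_dist F (z k) (A (z k)) \<le> ereal \<epsilon>"
    using path_following_invariant(2)[OF incl seq, of j] unfolding j by (rule order_trans[rotated])
  then have "eps_solution Z F A \<epsilon> (z k)"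
    using path_following_invariant(1)[OF incl seq, of k] by (simp add: eps_solution_def)
  then show ?thesis using k(1) by (intro exI[of _ k]) (simp add: m_def Q_def)
qed

lemma k_max_eq: "k_max c \<beta> \<nu> t0 \<epsilon> = \<lfloor>1 / sigma_bar c \<beta> \<nu> * ln (M0 c \<beta> \<nu> * t0 / \<epsilon>)\<rfloor> + 1"
  by (simp add: k_max_def sigma_bar_def)

definition "M0_factor = (1 + \<kappa> + 2 * delta_bar c \<beta>) / (1 - \<kappa> - delta_bar c \<beta>)"

lemma M0_factor_pos: "0 < M0_factor"
  unfolding M0_factor_def using radius_less_1 kappa_bounds delta_bar_nonneg by (intro divide_pos_pos) auto

lemma M0_le: assumes "1 \<le> \<nu>" shows "M0 c \<beta> \<nu> \<le> M0_factor * sqrt \<nu>"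
proof -
  have s: "1 \<le> sqrt \<nu>" using assms by simp
  have "sqrt \<nu> + \<kappa> + 2 * delta_bar c \<beta> \<le> (1 + \<kappa> + 2 * delta_bar c \<beta>) * sqrt \<nu>"
  proof -
    have "\<kappa> * 1 \<le> \<kappa> * sqrt \<nu>" "delta_bar c \<beta> * 1 \<le> delta_bar c \<beta> * sqrt \<nu>"
      using s kappa_bounds delta_bar_nonneg by (auto intro!: mult_left_mono simp del: mult_1_right)
    then show ?thesis by (simp add: algebra_simps)
  qed
  then show ?thesis unfolding M0_eq M0_factor_def using radius_less_1 by (simp add: divide_right_mono)
qed

definition "complexity_constant = (1 + \<kappa>) / (\<kappa> - \<beta>) * (\<bar>ln M0_factor\<bar> + 1) + 1"

lemma complexity_constant_ge_1: "1 \<le> complexity_constant"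
  unfolding complexity_constant_def using kappa_bounds by simp

text \<open>
  The threshold \<open>exp 1\<close> makes the logarithm at least one, and then it absorbs all additive constants.
\<close>

lemma k_max_le:
  assumes \<nu>: "1 \<le> \<nu>" and t0: "0 < t0" and e: "0 < e" and R: "exp 1 \<le> sqrt \<nu> * t0 / e"
  defines "L \<equiv> ln (sqrt \<nu> * t0 / e)"
  shows "real_of_int (k_max c \<beta> \<nu> t0 e) \<le> complexity_constant * (sqrt \<nu> * L)"
    and "1 \<le> complexity_constant * (sqrt \<nu> * L)"
proof -
  have s: "1 \<le> sqrt \<nu>" using \<nu> by simp
  have q: "0 < sqrt \<nu> * t0 / e" using s t0 e by simp
  have L: "1 \<le> L" unfolding L_def using R q by (simp add: ln_ge_iff)
  have sL: "1 \<le> sqrt \<nu> * L" using s L mult_mono[of 1 "sqrt \<nu>" 1 L] by simp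
  have \<nu>0: "0 < \<nu>" using \<nu> by simp
  have "M0 c \<beta> \<nu> * t0 / e \<le> M0_factor * (sqrt \<nu> * t0 / e)"
    using mult_right_mono[OF M0_le[OF \<nu>], of "t0 / e"] t0 e by (simp add: mult.assoc)
  then have "ln (M0 c \<beta> \<nu> * t0 / e) \<le> ln (M0_factor * (sqrt \<nu> * t0 / e))"
    using M0_pos[OF \<nu>0] t0 e by (intro ln_mono) auto
  also have "\<dots> = ln M0_factor + L" unfolding L_def using M0_factor_pos q by (intro ln_mult_pos)
  also have "\<dots> \<le> (\<bar>ln M0_factor\<bar> + 1) * L"
  proof -
    have "ln M0_factor \<le> \<bar>ln M0_factor\<bar> * L" using mult_left_mono[OF L, of "\<bar>ln M0_factor\<bar>"] by linarith
    then show ?thesis by (simp add: algebra_simps)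
  qed
  finally have ln_le: "ln (M0 c \<beta> \<nu> * t0 / e) \<le> (\<bar>ln M0_factor\<bar> + 1) * L" .
  have inv: "1 / sigma_bar c \<beta> \<nu> = (sqrt \<nu> + \<kappa>) / (\<kappa> - \<beta>)" by (simp add: sigma_bar_eq)
  have "1 / sigma_bar c \<beta> \<nu> * ln (M0 c \<beta> \<nu> * t0 / e) \<le> (sqrt \<nu> + \<kappa>) / (\<kappa> - \<beta>) * ((\<bar>ln M0_factor\<bar> + 1) * L)"
    unfolding inv using ln_le kappa_bounds \<nu> by (intro mult_left_mono) auto
  also have "\<dots> \<le> ((1 + \<kappa>) * sqrt \<nu>) / (\<kappa> - \<beta>) * ((\<bar>ln M0_factor\<bar> + 1) * L)"
  proof (intro mult_right_mono divide_right_mono)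
    have "\<kappa> * 1 \<le> \<kappa> * sqrt \<nu>" using s kappa_bounds by (intro mult_left_mono) auto
    then show "sqrt \<nu> + \<kappa> \<le> (1 + \<kappa>) * sqrt \<nu>" by (simp add: algebra_simps)
  qed (use kappa_bounds L in auto)
  also have "\<dots> = (complexity_constant - 1) * (sqrt \<nu> * L)"
    by (simp add: complexity_constant_def mult_ac)
  finally have "1 / sigma_bar c \<beta> \<nu> * ln (M0 c \<beta> \<nu> * t0 / e) \<le> (complexity_constant - 1) * (sqrt \<nu> * L)" .
  moreover have "real_of_int (k_max c \<beta> \<nu> t0 e) \<le> 1 / sigma_bar c \<beta> \<nu> * ln (M0 c \<beta> \<nu> * t0 / e) + 1"
    unfolding k_max_eq by simp
  ultimately show "real_of_int (k_max c \<beta> \<nu> t0 e) \<le> complexity_constant * (sqrt \<nu> * L)"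
    using sL by (simp add: algebra_simps)
  show "1 \<le> complexity_constant * (sqrt \<nu> * L)"
    using mult_mono[of 1 complexity_constant 1 "sqrt \<nu> * L"] complexity_constant_ge_1 sL by simp
qed

lemma M0_bigo: "M0 c \<beta> \<in> O(sqrt)"
proof (rule bigoI[where c = M0_factor])
  show "eventually (\<lambda>\<nu>. norm (M0 c \<beta> \<nu>) \<le> M0_factor * norm (sqrt \<nu>)) at_top"
    using eventually_ge_at_top[of "1::real"]
  proof eventually_elim
    case (elim \<nu>)
    then show ?case using M0_le[of \<nu>] M0_pos[of \<nu>] by simp
  qed
qed

lemma complexity_bound:
  assumes incl: "self_concordant_inclusion Z F \<nu> A"
    and seq: "pfgn_sequence Z F \<nu> A c \<beta> (sigma_bar c \<beta> \<nu>) \<delta> z t"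
    and e: "0 < e" and R: "exp 1 \<le> sqrt \<nu> * t 0 / e"
  shows "\<exists>k. real k \<le> complexity_constant * (sqrt \<nu> * ln (sqrt \<nu> * t 0 / e)) \<and> eps_solution Z F A e (z k)"
proof -
  interpret self_concordant_inclusion Z F \<nu> A by (rule incl)
  have t0: "0 < t 0" using seq unfolding pfgn_sequence_def by auto
  obtain k where k: "int k \<le> max 1 (k_max c \<beta> \<nu> (t 0) e)" "eps_solution Z F A e (z k)"
    using iteration_bound[OF incl seq e] unfolding k_max_eq by blast
  have "real k = real_of_int (int k)" by simp
  also have "\<dots> \<le> real_of_int (max 1 (k_max c \<beta> \<nu> (t 0) e))" using k(1) by (simp only: of_int_le_iff)
  also have "\<dots> \<le> complexity_constant * (sqrt \<nu> * ln (sqrt \<nu> * t 0 / e))"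
    using k_max_le[OF nu_ge_1 t0 e R] by (simp add: max_def)
  finally show ?thesis using k(2) by blast
qed

end

theorem theorem4:
  fixes Z :: "'a::euclidean_space set"
    and F :: "'a \<Rightarrow> real"
    and A :: "'a \<Rightarrow> 'a set"
    and z :: "nat \<Rightarrow> 'a"
    and t \<delta> :: "nat \<Rightarrow> real"
    and \<nu> c \<beta> \<sigma> \<epsilon> :: real
  assumes "self_concordant_inclusion Z F \<nu> A"
    and "0 < c" "c \<le> 1"
    and "0 < \<beta>" "\<beta> < 0.5 * (1 + 2 * c\<^sup>2 - sqrt (1 + 4 * c\<^sup>2))"
    and "pfgn_sequence Z F \<nu> A c \<beta> \<sigma> \<delta> z t"
    and "0 < \<epsilon>"
  shows
    "(\<forall>k. z k \<in> interior Z \<and> newton_decrement F A (t k) (z k) \<le> \<beta>) \<and>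
     (\<exists>k. int k \<le> max 1 (\<lfloor>1 / \<sigma> * ln (M0 c \<beta> \<nu> * t 0 / \<epsilon>)\<rfloor> + 1) \<and>
          eps_solution Z F A \<epsilon> (z k)) \<and>
     (\<sigma> = sigma_bar c \<beta> \<nu> \<longrightarrow>
        (\<exists>k. int k \<le> max 1 (k_max c \<beta> \<nu> (t 0) \<epsilon>) \<and> eps_solution Z F A \<epsilon> (z k))) \<and>
     M0 c \<beta> \<in> O(sqrt) \<and>
     (\<exists>C>0. \<exists>R>1.
        (\<forall>\<nu>'\<ge>1. \<forall>t0>0. \<forall>e>0. R \<le> sqrt \<nu>' * t0 / e \<longrightarrow>
           real_of_int (k_max c \<beta> \<nu>' t0 e) \<le> C * (sqrt \<nu>' * ln (sqrt \<nu>' * t0 / e))) \<and>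
        (\<forall>(Z' :: 'a set) F' \<nu>' A' \<delta>' z' t' e.
           self_concordant_inclusion Z' F' \<nu>' A' \<and>
           pfgn_sequence Z' F' \<nu>' A' c \<beta> (sigma_bar c \<beta> \<nu>') \<delta>' z' t' \<and>
           0 < e \<and> R \<le> sqrt \<nu>' * t' 0 / e \<longrightarrow>
           (\<exists>k. real k \<le> C * (sqrt \<nu>' * ln (sqrt \<nu>' * t' 0 / e)) \<and>
                eps_solution Z' F' A' e (z' k))))"
proof -
  interpret admissible_parameters c \<beta> by unfold_locales (rule assms)+
  have "\<forall>k. z k \<in> interior Z \<and> newton_decrement F A (t k) (z k) \<le> \<beta>"
    using path_following_invariant(1)[OF assms(1,6)] by blast
  moreover note bound = iteration_bound[OF assms(1,6,7)]
  moreover have "\<sigma> = sigma_bar c \<beta> \<nu> \<longrightarrow>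
        (\<exists>k. int k \<le> max 1 (k_max c \<beta> \<nu> (t 0) \<epsilon>) \<and> eps_solution Z F A \<epsilon> (z k))"
    using bound unfolding k_max_eq by auto
  moreover have "\<exists>C>0. \<exists>R>1.
        (\<forall>\<nu>'\<ge>1. \<forall>t0>0. \<forall>e>0. R \<le> sqrt \<nu>' * t0 / e \<longrightarrow>
           real_of_int (k_max c \<beta> \<nu>' t0 e) \<le> C * (sqrt \<nu>' * ln (sqrt \<nu>' * t0 / e))) \<and>
        (\<forall>(Z' :: 'a set) F' \<nu>' A' \<delta>' z' t' e.
           self_concordant_inclusion Z' F' \<nu>' A' \<and>
           pfgn_sequence Z' F' \<nu>' A' c \<beta> (sigma_bar c \<beta> \<nu>') \<delta>' z' t' \<and>
           0 < e \<and> R \<le> sqrt \<nu>' * t' 0 / e \<longrightarrow>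
           (\<exists>k. real k \<le> C * (sqrt \<nu>' * ln (sqrt \<nu>' * t' 0 / e)) \<and>
                eps_solution Z' F' A' e (z' k)))"
  proof (rule exI[of _ complexity_constant], intro exI[of _ "exp 1"] conjI allI impI)
    show "0 < complexity_constant" using complexity_constant_ge_1 by simp
  qed (auto intro: k_max_le(1) complexity_bound)
  ultimately show ?thesis using M0_bigo by blast
qed

end
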